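(* Let $l,m$ be integers with $1\le m\le l$, and let $u,v$ be weights on $\mathbb R^+=(0,\infty)$ such that $u^{-2}\in B_\delta$ for some $\delta\ge0$ and $v^{-1}\in L_2(0,r)$ for all $r>0$. Then the multiplier space $M(W^{(l)}_{2,u}\to W^{(m)}_{2,v})$ consists of those and only those functions $\varphi$ which satisfy $$\|(\varphi x^k)^{(m)}v\|_{L_2(\mathbb R^+)}<\infty,\qquad k=0,\dots,l-1,$$ $$\sup_{r>0}\ \|(\varphi x^k)^{(m)}v\|_{L_2(r,\infty)}\cdot\|x^{l-k-1}u^{-1}\|_{L_2(0,r)}<\infty,\qquad k=0,\dots,l-1,$$ and, in the case $m=l$, additionally $$\|\varphi v u^{-1}\|_{L_\infty(\mathbb R^+)}<\infty .$$
   Context: A weight is a nonnegative measurable function on $\mathbb R^+=(0,\infty)$. For a weight $u$ and a positive integer $l$, $W^{(l)}_{2,u}$ is the weighted Sobolev space of functions $f$ on $\mathbb R^+$ having a locally integrable generalized derivative $f^{(l)}$ of order $l$, with finite norm $$\|f\|_{W^{(l)}_{2,u}}=\|f\|_{L_2(0,1)}+\|f^{(l)}u\|_{L_2(\mathbb R^+)}.$$ A function $\varphi$ on $\mathbb R^+$ is a (pointwise) multiplier from $W^{(l)}_{2,u}$ to $W^{(m)}_{2,v}$ if $\varphi f\in W^{(m)}_{2,v}$ for all $f\in W^{(l)}_{2,u}$; the set of all such $\varphi$ is $M(W^{(l)}_{2,u}\to W^{(m)}_{2,v})$. Here $\varphi x^k$ denotes the function $x\mapsto x^k\varphi(x)$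 and $(\cdot)^{(m)}$ the (generalized, locally integrable) derivative of order $m$; a condition involving it includes its existence. For $\delta\ge0$, $B_\delta$ denotes the set of positive locally summable functions $w$ on $\mathbb R^+$ for which there is a constant $D(w)$ such that $$\int_\Delta w(x)\,dx\le D(w)\int_{\frac12\Delta}w(x)\,dx$$ for every (bounded, nondegenerate) interval $\Delta\subset\mathbb R^+$ of length $|\Delta|\ge\delta$, where $\frac12\Delta$ is the interval of length $\frac12|\Delta|$ with the same center as $\Delta$. *)

theory Defs
  imports "HOL-Analysis.Analysis" "HOL-Probability.Essential_Supremum"
begin

text \<open>
  A function on the half-line \<open>(0,\<infinity>)\<close> is represented by a function on \<open>real\<close>; every definition
  below depends only on its values on \<open>{0<..}\<close>.
\<close>

definition weight :: "(real \<Rightarrow> real) \<Rightarrow> bool" where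
  "weight u \<longleftrightarrow> u \<in> borel_measurable (lebesgue_on {0<..}) \<and> (\<forall>x>0. 0 \<le> u x)"

text \<open>
  Norms take integrands with values in \<open>ennreal\<close>, so that \<open>inverse (ennreal (u x))\<close> is \<open>\<infinity>\<close>
  at zeros of \<open>u\<close>, whereas division in \<open>real\<close> would give \<open>0\<close> there.
\<close>

definition L2_norm :: "real set \<Rightarrow> (real \<Rightarrow> ennreal) \<Rightarrow> ennreal" where
  "L2_norm S f =
     (let I = (\<integral>\<^sup>+x\<in>S. (f x)\<^sup>2 \<partial>lebesgue) in if I = top then top else ennreal (sqrt (enn2real I)))"

definition Linf_norm :: "real set \<Rightarrow> (real \<Rightarrow> ennreal) \<Rightarrow> ennreal" where
  "Linf_norm S f = esssup (lebesgue_on S) f"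

definition locally_integrable :: "(real \<Rightarrow> real) \<Rightarrow> bool" where
  "locally_integrable f \<longleftrightarrow> (\<forall>K. compact K \<and> K \<subseteq> {0<..} \<longrightarrow> f absolutely_integrable_on K)"

definition test_function :: "(real \<Rightarrow> real) \<Rightarrow> bool" where
  "test_function \<eta> \<longleftrightarrow>
     (\<forall>n x. (deriv ^^ n) \<eta> field_differentiable (at x)) \<and>
     compact (closure {x. \<eta> x \<noteq> 0}) \<and> closure {x. \<eta> x \<noteq> 0} \<subseteq> {0<..}"

definition has_gen_deriv :: "nat \<Rightarrow> (real \<Rightarrow> real) \<Rightarrow> (real \<Rightarrow> real) \<Rightarrow> bool" where
  "has_gen_deriv n f g \<longleftrightarrow>
     locally_integrable f \<and> locally_integrable g \<and>
     (\<forall>\<eta>. test_function \<eta> \<longrightarrow>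
        (LINT x:{0<..}|lebesgue. f x * (deriv ^^ n) \<eta> x) =
        (-1) ^ n * (LINT x:{0<..}|lebesgue. g x * \<eta> x))"

definition gen_differentiable :: "nat \<Rightarrow> (real \<Rightarrow> real) \<Rightarrow> bool" where
  "gen_differentiable n f \<longleftrightarrow> (\<exists>g. has_gen_deriv n f g)"

text \<open>The generalized derivative is unique up to null sets, hence the choice below is immaterial.\<close>

definition gen_deriv :: "nat \<Rightarrow> (real \<Rightarrow> real) \<Rightarrow> real \<Rightarrow> real" where
  "gen_deriv n f = (SOME g. has_gen_deriv n f g)"

definition sobolev_norm :: "nat \<Rightarrow> (real \<Rightarrow> real) \<Rightarrow> (real \<Rightarrow> real) \<Rightarrow> ennreal" where
  "sobolev_norm l u f =
     L2_norm {0<..<1} (\<lambda>x. ennreal \<bar>f x\<bar>) + L2_norm {0<..} (\<lambda>x. ennreal \<bar>gen_deriv l f x * u x\<bar>)"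

definition sobolev_space :: "nat \<Rightarrow> (real \<Rightarrow> real) \<Rightarrow> (real \<Rightarrow> real) set" where
  "sobolev_space l u = {f. gen_differentiable l f \<and> sobolev_norm l u f < top}"

definition multipliers :: "(real \<Rightarrow> real) set \<Rightarrow> (real \<Rightarrow> real) set \<Rightarrow> (real \<Rightarrow> real) set" where
  "multipliers X Y = {\<phi>. \<forall>f\<in>X. (\<lambda>x. \<phi> x * f x) \<in> Y}"

text \<open>
  The half \<open>\<Delta>/2\<close> of \<open>\<Delta> = (a,b)\<close> has end points \<open>(3a+b)/4\<close> and \<open>(a+3b)/4\<close>. Since \<open>\<Delta>\<close> may touch
  \<open>0\<close>, where \<open>w\<close> is not a priori integrable, the condition is stated with the nonnegative integral.
  Positivity is understood almost everywhere.
\<close>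

definition B_class :: "real \<Rightarrow> (real \<Rightarrow> real) set" where
  "B_class \<delta> = {w. locally_integrable w \<and> (AE x in lebesgue_on {0<..}. 0 < w x) \<and>
     (\<exists>D::real. \<forall>a b. 0 \<le> a \<and> a < b \<and> \<delta> \<le> b - a \<longrightarrow>
        (\<integral>\<^sup>+x\<in>{a<..<b}. ennreal (w x) \<partial>lebesgue) \<le>
        ennreal D * (\<integral>\<^sup>+x\<in>{(3 * a + b) / 4<..<(a + 3 * b) / 4}. ennreal (w x) \<partial>lebesgue))}"

end

theory Submission
  imports Defs
begin

text \<open>
  The doubling condition makes \<open>u\<^sup>-\<^sup>2\<close> integrable up to \<open>0\<close>, so every \<open>f\<close> in the domain is a polynomial
  of degree less than \<open>l\<close> plus the \<open>l\<close>-fold integral \<open>F\<close> of \<open>g = f\<^sup>(\<^sup>l\<^sup>)\<close>. Expanding the kernel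
  \<open>(x - t)\<^sup>l\<^sup>-\<^sup>1\<close> in powers of \<open>x\<close>, the Leibniz rule gives
  \<open>(\<phi> F)\<^sup>(\<^sup>m\<^sup>) = \<Sum>\<^sub>k c\<^sub>k (\<phi> x\<^sup>k)\<^sup>(\<^sup>m\<^sup>) \<integral>\<^sub>0\<^sup>x t\<^sup>l\<^sup>-\<^sup>1\<^sup>-\<^sup>k g(t) dt\<close>, with the extra term \<open>\<phi> g\<close> if \<open>m = l\<close>.

  Sufficiency is then the weighted Hardy inequality for each summand. For necessity, the uniform
  boundedness principle turns the multiplier property into an estimate for the operator acting on
  \<open>h = g u\<close>. It is tested on \<open>g = z u\<^sup>-\<^sup>2\<close> on \<open>(0,r)\<close>, where \<open>z\<close> is a monomial minus its orthogonal
  projection in \<open>L\<^sub>2(u\<^sup>-\<^sup>2)\<close> onto the other monomials: on \<open>(r,\<infinity>)\<close> this isolates a single summand. The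
  norm of \<open>z\<close> is bounded below since a polynomial with one coefficient equal to \<open>1\<close> is large on one
  of finitely many intervals of length comparable to \<open>r\<close>, and by doubling each of these carries a
  fixed share of the mass of \<open>(0,r)\<close>. This needs \<open>r\<close> large compared with \<open>\<delta>\<close>; for small \<open>r\<close> the first
  condition suffices. For \<open>m = l\<close>, subtracting the Hardy summands leaves a bounded multiplication
  operator.
\<close>

section \<open>Smooth bump functions\<close>

text \<open>The hypothesis is a bare membership statement, while the conditions to be derived are
  quantitative; hence the detour over uniform boundedness. A generalized derivative, moreover, is
  given only through pairings. Before the operator can even be written down, the functions in the
  domain must be recovered from these pairings, and this rests on one fact: a test function with
  integral 0 is itself the derivative of a test function. This is why explicit bump functions open
  the development. The integrability of \<open>v\<^sup>-\<^sup>2\<close> up to 0 is the counterpart,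
  in the target space, of that of \<open>u\<^sup>-\<^sup>2\<close>. It makes the derivative of order
  m of \<phi> integrable up to 0, so \<phi> has a representative whose derivatives of order below m
  are absolutely continuous on every [0,r]. Products with it obey the classical Leibniz rule, and
  their norm over (0,1) is finite automatically. The Hardy summands may cancel each other, so a
  bound for their sum says nothing about a single one until the others have been removed. Removing
  them to the right of r is enough because the first factor of the supremum condition only sees that
  part.\<close>

definition smooth :: "(real \<Rightarrow> real) \<Rightarrow> bool" where
  "smooth f \<longleftrightarrow> (\<forall>n x. (deriv ^^ n) f field_differentiable (at x))"

lemma iterated_deriv_eqI:
  assumes "\<And>n x. (D n has_field_derivative D (Suc n) x) (at x)"
  shows "(deriv ^^ n) (D 0) = D n"
proof (induction n)
  case (Suc n)
  have "deriv (D n) = D (Suc n)"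
    using assms DERIV_imp_deriv by blast
  then show ?case using Suc by simp
qed simp

lemma smoothI:
  assumes "\<And>n x. (D n has_field_derivative D (Suc n) x) (at x)"
  shows "smooth (D 0)"
  unfolding smooth_def iterated_deriv_eqI[where D=D, OF assms]
  using assms field_differentiable_def by blast

lemma smooth_deriv_iterate:
  "smooth f \<Longrightarrow> ((deriv ^^ n) f has_field_derivative (deriv ^^ Suc n) f x) (at x)"
  by (simp add: smooth_def DERIV_deriv_iff_field_differentiable)

text \<open>Pascal's rule. With abstract sequences \<open>a\<close> and \<open>b\<close> it serves
  both the pointwise derivatives of smooth functions and the integral densities of a
  \<open>chain\<close>.\<close>

lemma sum_binomial_Leibniz:
  fixes a b :: "nat \<Rightarrow> 'a::comm_semiring_1"
  shows "(\<Sum>i\<le>n. of_nat (n choose i) * (a (Suc (n - i)) * b i + a (n - i) * b (Suc i))) =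
         (\<Sum>i\<le>Suc n. of_nat (Suc n choose i) * (a (Suc n - i) * b i))"
proof -
  have "(\<Sum>i\<le>Suc n. of_nat (Suc n choose i) * (a (Suc n - i) * b i))
      = a (Suc n) * b 0 + (\<Sum>i\<le>n. of_nat (Suc n choose Suc i) * (a (n - i) * b (Suc i)))"
    by (subst sum.atMost_Suc_shift) simp
  also have "\<dots> = (a (Suc n) * b 0 + (\<Sum>i\<le>n. of_nat (n choose Suc i) * (a (n - i) * b (Suc i))))
      + (\<Sum>i\<le>n. of_nat (n choose i) * (a (n - i) * b (Suc i)))"
    by (simp add: algebra_simps sum.distrib)
  also have "a (Suc n) * b 0 + (\<Sum>i\<le>n. of_nat (n choose Suc i) * (a (n - i) * b (Suc i)))
      = (\<Sum>i\<le>Suc n. of_nat (n choose i) * (a (Suc n - i) * b i))"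
    by (subst sum.atMost_Suc_shift) simp
  also have "\<dots> = (\<Sum>i\<le>n. of_nat (n choose i) * (a (Suc (n - i)) * b i))"
  proof -
    have "of_nat (n choose Suc n) = (0 :: 'a)" by (simp add: binomial_eq_0)
    then show ?thesis
      by (subst sum.atMost_Suc) (auto intro!: sum.cong simp: Suc_diff_le)
  qed
  finally show ?thesis by (simp add: algebra_simps sum.distrib)
qed

lemma smooth_mult:
  assumes f: "smooth f" and g: "smooth g"
  shows "smooth (\<lambda>x. f x * g x)"
proof -
  define D where "D n x = (\<Sum>i\<le>n. of_nat (n choose i) * ((deriv ^^ (n - i)) f x * (deriv ^^ i) g x))"
    for n x
  have "(D n has_field_derivative D (Suc n) x) (at x)" for n x
  proof -
    have "(D n has_field_derivative
      (\<Sum>i\<le>n. of_nat (n choose i) * ((deriv ^^ Suc (n - i)) f x * (deriv ^^ i) g x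
          + (deriv ^^ (n - i)) f x * (deriv ^^ Suc i) g x))) (at x)"
      unfolding D_def
      by (intro DERIV_sum DERIV_cmult DERIV_cong[OF DERIV_mult[OF smooth_deriv_iterate[OF f] smooth_deriv_iterate[OF g]]])
         simp
    also have "(\<Sum>i\<le>n. of_nat (n choose i) * ((deriv ^^ Suc (n - i)) f x * (deriv ^^ i) g x
          + (deriv ^^ (n - i)) f x * (deriv ^^ Suc i) g x)) = D (Suc n) x"
      unfolding D_def by (rule sum_binomial_Leibniz)
    finally show ?thesis .
  qed
  from smoothI[of D, OF this] show ?thesis by (simp add: D_def[abs_def])
qed

lemma smooth_affine:
  assumes f: "smooth f"
  shows "smooth (\<lambda>x. f (a * x + b))"
proof -
  define D where "D n x = a ^ n * (deriv ^^ n) f (a * x + b)" for n x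
  have "(D n has_field_derivative D (Suc n) x) (at x)" for n x
  proof -
    have "((\<lambda>x. (deriv ^^ n) f (a * x + b)) has_field_derivative (deriv ^^ Suc n) f (a * x + b) * a) (at x)"
      by (rule DERIV_chain2[OF smooth_deriv_iterate[OF f]]) (auto intro!: derivative_eq_intros)
    from DERIV_cmult[OF this, of "a ^ n"] show ?thesis
      unfolding D_def by (simp add: ac_simps)
  qed
  from smoothI[of D, OF this] show ?thesis by (simp add: D_def[abs_def])
qed

lemma iterated_deriv_linear:
  assumes "smooth f" "smooth g"
  shows "(deriv ^^ n) (\<lambda>x. f x + c * g x) = (\<lambda>x. (deriv ^^ n) f x + c * (deriv ^^ n) g x)"
    and "smooth (\<lambda>x. f x + c * g x)"
proof -
  define D where "D n x = (deriv ^^ n) f x + c * (deriv ^^ n) g x" for n x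
  have *: "(D n has_field_derivative D (Suc n) x) (at x)" for n x
    unfolding D_def using assms
    by (intro DERIV_add DERIV_cmult smooth_deriv_iterate)
  show "(deriv ^^ n) (\<lambda>x. f x + c * g x) = (\<lambda>x. (deriv ^^ n) f x + c * (deriv ^^ n) g x)"
    using iterated_deriv_eqI[of D n, OF *] by (simp add: D_def[abs_def])
  show "smooth (\<lambda>x. f x + c * g x)"
    using smoothI[of D, OF *] by (simp add: D_def[abs_def])
qed

lemma smooth_const: "smooth (\<lambda>_. c)"
proof -
  define D :: "nat \<Rightarrow> real \<Rightarrow> real" where "D n x = (if n = 0 then c else 0)" for n x
  have "(D n has_field_derivative D (Suc n) x) (at x)" for n x
    by (cases n) (simp_all add: D_def[abs_def])
  from smoothI[of D, OF this] show ?thesis by (simp add: D_def[abs_def])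
qed

lemma smooth_deriv:
  assumes "smooth f" shows "smooth (deriv f)"
  using smoothI[of "\<lambda>n. (deriv ^^ Suc n) f", OF smooth_deriv_iterate[OF assms]] by simp

lemma smooth_antiderivI:
  assumes "\<And>x. (f has_field_derivative g x) (at x)" and "smooth g"
  shows "smooth f"
proof -
  define D where "D n = (case n of 0 \<Rightarrow> f | Suc k \<Rightarrow> (deriv ^^ k) g)" for n
  have "(D n has_field_derivative D (Suc n) x) (at x)" for n x
    using assms(1) smooth_deriv_iterate[OF assms(2)] by (cases n) (auto simp: D_def)
  from smoothI[of D, OF this] show ?thesis by (simp add: D_def[abs_def])
qed

lemma poly_div_exp_tendsto_0: "((\<lambda>x. poly p x / exp x) \<longlongrightarrow> 0) (at_top :: real filter)"
proof -
  have "((\<lambda>x. \<Sum>i\<le>degree p. coeff p i * (x ^ i / exp x)) \<longlongrightarrow> (\<Sum>i\<le>degree p. coeff p i * 0)) (at_top :: real filter)"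
    by (intro tendsto_intros tendsto_power_div_exp_0)
  then show ?thesis
    by (simp add: poly_altdef sum_divide_distrib)
qed

definition flat :: "real \<Rightarrow> real" where
  "flat x = (if x \<le> 0 then 0 else exp (- (1 / x)))"

lemma smooth_flat: "smooth flat"
proof -
  \<comment> \<open>For x > 0 the derivative of order n is \<open>P n\<close> at 1/x times exp
    (-1/x). With y = 1/x, the chain rule contributes the factor y^2 and turns \<open>P n\<close>
    into \<open>P n - pderiv (P n)\<close>.\<close>
  define P where "P = rec_nat (1 :: real poly) (\<lambda>_ p. [:0,0,1:] * (p - pderiv p))"
  have P: "P 0 = 1" "P (Suc n) = [:0,0,1:] * (P n - pderiv (P n))" for n
    by (auto simp: P_def)
  define D where "D n x = (if x \<le> 0 then 0 else poly (P n) (1 / x) * exp (- (1 / x)))" for n x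
  have D0: "D n 0 = 0" for n by (simp add: D_def)
  have "(D n has_field_derivative D (Suc n) x) (at x)" for n x
  proof -
    consider "x < 0" | "x = 0" | "x > 0" by linarith
    then show ?thesis
    proof cases
      case 1
      have "((\<lambda>_. 0) has_field_derivative 0) (at x)" by simp
      then have "(D n has_field_derivative 0) (at x)"
        by (rule has_field_derivative_transform_within_open[where S="{..<0}"]) (use 1 in \<open>simp_all add: D_def\<close>)
      with 1 show ?thesis by (simp add: D_def)
    next
      case 2
      have left: "((\<lambda>y. D n y / y) \<longlongrightarrow> 0) (at_left 0)"
        by (rule tendsto_eventually) (simp add: D_def eventually_at_filter)
      \<comment> \<open>The difference quotient at 0 carries an extra factor 1/y, which
        \<open>pCons 0\<close> absorbs into the polynomial; the exponential still wins.\<close>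
      have "((\<lambda>y. poly (pCons 0 (P n)) (inverse y) / exp (inverse y)) \<longlongrightarrow> 0) (at_right (0::real))"
        by (rule filterlim_compose[OF poly_div_exp_tendsto_0 filterlim_inverse_at_top_right])
      moreover have "\<forall>\<^sub>F y in at_right 0. poly (pCons 0 (P n)) (inverse y) / exp (inverse y) = D n y / y"
        unfolding eventually_at_right_field
        by (intro exI[of _ 1]) (simp add: D_def divide_inverse exp_minus)
      ultimately have right: "((\<lambda>y. D n y / y) \<longlongrightarrow> 0) (at_right 0)"
        by (rule Lim_transform_eventually)
      have "((\<lambda>h. (D n (0 + h) - D n 0) / h) \<longlongrightarrow> 0) (at 0)"
        unfolding filterlim_at_split using left right by (simp only: add_0 diff_zero D0)
      then have "(D n has_field_derivative 0) (at 0)"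
        unfolding DERIV_def .
      then show ?thesis
        by (simp only: 2 D0)
    next
      case 3
      have "((\<lambda>x. poly (P n) (1 / x) * exp (- (1 / x))) has_field_derivative D (Suc n) x) (at x)"
        using 3
        apply (auto intro!: derivative_eq_intros DERIV_chain2[OF poly_DERIV] simp: D_def P)
        apply (simp add: field_simps power2_eq_square)
        done
      then show ?thesis
        by (rule has_field_derivative_transform_within_open[where S="{0<..}"]) (use 3 in \<open>simp_all add: D_def\<close>)
    qed
  qed
  from smoothI[of D, OF this] have "smooth (D 0)" .
  moreover have "D 0 = flat" by (auto simp: D_def P flat_def)
  ultimately show ?thesis by simp
qed

definition bump :: "real \<Rightarrow> real" where
  "bump x = flat x * flat (1 - x)"

lemma smooth_bump: "smooth bump"
  using smooth_mult[OF smooth_flat smooth_affine[OF smooth_flat, of "-1" 1]]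
  by (simp add: bump_def[abs_def])

lemma bump_nonneg: "0 \<le> bump x" and bump_pos: "0 < x \<Longrightarrow> x < 1 \<Longrightarrow> 0 < bump x"
  and bump_zero: "x \<le> 0 \<or> 1 \<le> x \<Longrightarrow> bump x = 0"
  by (auto simp: bump_def flat_def)

lemma smooth_continuous_on: "smooth f \<Longrightarrow> continuous_on S f"
  using smooth_deriv_iterate[of f 0]
  by (auto intro!: DERIV_continuous_on continuous_at_imp_continuous_on DERIV_isCont)

text \<open>The lower limit -1 instead of 0 puts the point 0 in the interior of the domain of
  integration, so the fundamental theorem gives a two-sided derivative there too;
  \<open>bump\<close> vanishes on (-1,0), so the value is unaffected.\<close>

definition bump_step :: "real \<Rightarrow> real" where
  "bump_step x = integral {-1..x} bump / integral {-1..1} bump"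

lemma bump_integral_pos: "integral {-1..1} bump > 0"
proof -
  have "integral {-1..1} bump \<noteq> 0"
  proof
    assume "integral {-1..1} bump = 0"
    moreover have "bump integrable_on {-1..1}"
      by (intro integrable_continuous_real smooth_continuous_on smooth_bump)
    ultimately have "(bump has_integral 0) (cbox (-1) 1)"
      by (metis has_integral_integral box_real(2))
    then have "bump (1/2) = 0"
      by (rule has_integral_0_cbox_imp_0[rotated 2])
         (auto simp: bump_nonneg intro!: smooth_continuous_on smooth_bump)
    with bump_pos[of "1/2"] show False by simp
  qed
  moreover have "integral {-1..1} bump \<ge> 0"
    by (intro integral_nonneg integrable_continuous_real smooth_continuous_on smooth_bump bump_nonneg)
  ultimately show ?thesis by simp
qed

lemma bump_step_left: "bump_step x = 0" if "x \<le> 0"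
proof -
  have "integral {-1..x} bump = integral {-1..x} (\<lambda>_. 0)"
    using that by (intro integral_cong) (auto simp: bump_zero)
  then show ?thesis by (simp add: bump_step_def)
qed

lemma bump_integrable: "bump integrable_on {a..b}"
  by (intro integrable_continuous_real smooth_continuous_on smooth_bump)

lemma bump_step_right: "bump_step x = 1" if "1 \<le> x"
proof -
  have "integral {-1..x} bump = integral {-1..1} bump + integral {1..x} bump"
    using that by (intro Henstock_Kurzweil_Integration.integral_combine[symmetric] bump_integrable) auto
  moreover have "integral {1..x} bump = integral {1..x} (\<lambda>_. 0)"
    using that by (intro integral_cong) (auto simp: bump_zero)
  ultimately show ?thesis using bump_integral_pos by (simp add: bump_step_def)
qed

lemma bump_step_deriv:
  "(bump_step has_field_derivative bump x / integral {-1..1} bump) (at x)"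
proof (cases "x < 0")
  case True
  have "((\<lambda>_. 0) has_field_derivative 0) (at x)" by simp
  then have "(bump_step has_field_derivative 0) (at x)"
    by (rule has_field_derivative_transform_within_open[where S="{..<0}"])
       (use True in \<open>auto simp: bump_step_left\<close>)
  with True show ?thesis by (simp add: bump_zero)
next
  case False
  have "((\<lambda>x. integral {-1..x} bump) has_real_derivative bump x) (at x within {-1..x+1})"
    using False by (intro integral_has_real_derivative smooth_continuous_on smooth_bump) auto
  moreover have "at x within {-1..x+1} = at x"
    using False by (intro at_within_interior) auto
  ultimately show ?thesis
    unfolding bump_step_def[abs_def] by (auto intro: DERIV_cdivide)
qed

lemma smooth_bump_step: "smooth bump_step"
proof (rule smooth_antiderivI[OF bump_step_deriv])
  have "smooth (\<lambda>x. 0 + (1 / integral {-1..1} bump) * bump x)"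
    by (rule iterated_deriv_linear(2)[OF smooth_const smooth_bump])
  then show "smooth (\<lambda>x. bump x / integral {-1..1} bump)" by simp
qed

lemma bump_step_bounds: "0 \<le> bump_step x" "bump_step x \<le> 1"
proof -
  have m: "mono bump_step"
  proof (rule monoI)
    fix x y :: real assume "x \<le> y"
    then show "bump_step x \<le> bump_step y"
    proof (rule DERIV_nonneg_imp_nondecreasing)
      fix z
      show "\<exists>d. (bump_step has_real_derivative d) (at z) \<and> 0 \<le> d"
        using bump_step_deriv bump_nonneg bump_integral_pos by (meson divide_nonneg_pos)
    qed
  qed
  show "0 \<le> bump_step x"
    using monoD[OF m, of 0 x] bump_step_left by (cases "x \<le> 0") auto
  show "bump_step x \<le> 1"
    using monoD[OF m, of x 1] bump_step_right by (cases "x \<le> 1") auto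
qed

section \<open>Test functions: closure under differentiation, and plateaus\<close>

lemma test_functionI:
  assumes "smooth \<eta>" "0 < a" "\<And>x. \<eta> x \<noteq> 0 \<Longrightarrow> a \<le> x \<and> x \<le> b"
  shows "test_function \<eta>"
proof -
  have "closure {x. \<eta> x \<noteq> 0} \<subseteq> {a..b}"
    using assms(3) by (intro closure_minimal) auto
  then have "closure {x. \<eta> x \<noteq> 0} = {a..b} \<inter> closure {x. \<eta> x \<noteq> 0}" by blast
  then have "compact (closure {x. \<eta> x \<noteq> 0})"
    using compact_Int_closed[OF compact_Icc closed_closure] by metis
  moreover have "closure {x. \<eta> x \<noteq> 0} \<subseteq> {0<..}"
    using assms(2) \<open>closure {x. \<eta> x \<noteq> 0} \<subseteq> {a..b}\<close> by fastforce
  moreover have "\<forall>n x. (deriv ^^ n) \<eta> field_differentiable (at x)"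
    using assms(1) unfolding smooth_def .
  ultimately show ?thesis
    unfolding test_function_def by blast
qed

lemma test_functionE:
  assumes "test_function \<eta>"
  obtains a b where "0 < a" "a < b" "smooth \<eta>" "\<And>x. \<eta> x \<noteq> 0 \<Longrightarrow> a \<le> x \<and> x \<le> b"
proof -
  let ?S = "closure {x. \<eta> x \<noteq> 0}"
  have S: "compact ?S" "?S \<subseteq> {0<..}" and sm: "smooth \<eta>"
    using assms by (auto simp: test_function_def smooth_def)
  show ?thesis
  proof (cases "?S = {}")
    case True
    then have "\<eta> x = 0" for x using closure_subset by fastforce
    then show ?thesis using that[of 1 2] sm by auto
  next
    case False
    obtain a where a: "a \<in> ?S" "\<And>x. x \<in> ?S \<Longrightarrow> a \<le> x"
      using compact_attains_inf[OF S(1) False] by blast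
    obtain b where b: "b \<in> ?S" "\<And>x. x \<in> ?S \<Longrightarrow> x \<le> b"
      using compact_attains_sup[OF S(1) False] by blast
    \<comment> \<open>The extremes \<open>a\<close> and \<open>b\<close> of the support are only
      known to satisfy a \<le> b; adding 1 gives the strict inequality.\<close>
    have "a \<le> x \<and> x \<le> b + 1" if "\<eta> x \<noteq> 0" for x
      using a(2)[of x] b(2)[of x] that closure_subset[of "{x. \<eta> x \<noteq> 0}"] by fastforce
    then show ?thesis using that[of a "b + 1"] a b sm S(2) by force
  qed
qed

lemma test_function_deriv:
  assumes "test_function \<eta>" shows "test_function (deriv \<eta>)"
proof -
  obtain a b where ab: "0 < a" "a < b" "smooth \<eta>" "\<And>x. \<eta> x \<noteq> 0 \<Longrightarrow> a \<le> x \<and> x \<le> b"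
    using assms by (rule test_functionE) (rule that)
  show ?thesis
  proof (rule test_functionI[OF smooth_deriv[OF ab(3)] ab(1), of b])
    fix x assume *: "deriv \<eta> x \<noteq> 0"
    show "a \<le> x \<and> x \<le> b"
    proof (rule ccontr)
      assume "\<not> (a \<le> x \<and> x \<le> b)"
      then have x: "x \<in> - {a..b}" by auto
      have "((\<lambda>_. 0) has_field_derivative 0) (at x)" by simp
      then have "(\<eta> has_field_derivative 0) (at x)"
        by (rule has_field_derivative_transform_within_open[OF _ _ x]) (use ab(4) in force)+
      with * show False using DERIV_imp_deriv by blast
    qed
  qed
qed

lemma test_function_deriv_iterate: "test_function \<eta> \<Longrightarrow> test_function ((deriv ^^ n) \<eta>)"
  by (induction n) (auto intro: test_function_deriv)

lemma test_function_integrable: 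
  assumes "test_function \<eta>" shows "\<eta> integrable_on {a..b}"
  using assms by (intro integrable_continuous_real smooth_continuous_on) (auto elim: test_functionE)

text \<open>A smooth stand-in for the indicator of (a,b]: both ramps have width 1/n and lie to the
  right of their end points, which is why the limit is closed at b and open at a.\<close>

lemma test_function_plateau:
  assumes "0 < a" "a < b" "0 < n"
  shows "test_function (\<lambda>x. bump_step (n * (x - a)) - bump_step (n * (x - b)))"
proof (rule test_functionI[of _ a "b + 1 / n"])
  show "smooth (\<lambda>x. bump_step (n * (x - a)) - bump_step (n * (x - b)))"
    using iterated_deriv_linear(2)[OF smooth_affine[OF smooth_bump_step, of n "- n * a"] 
       smooth_affine[OF smooth_bump_step, of n "- n * b"], of "-1"]
    by (simp add: algebra_simps)
  fix x assume *: "bump_step (n * (x - a)) - bump_step (n * (x - b)) \<noteq> 0"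
  show "a \<le> x \<and> x \<le> b + 1 / n"
  proof (rule ccontr)
    assume "\<not> (a \<le> x \<and> x \<le> b + 1 / n)"
    then consider "x < a" | "x > b + 1 / n" by linarith
    then show False
    proof cases
      case 1
      then have "n * (x - a) \<le> 0" "n * (x - b) \<le> 0"
        using assms by (auto simp: mult_le_0_iff)
      with * show False by (simp add: bump_step_left)
    next
      case 2
      then have "1 \<le> n * (x - b)" using assms by (simp add: field_simps)
      moreover have "n * (x - b) \<le> n * (x - a)" using assms by simp
      ultimately show False using * by (simp add: bump_step_right)
    qed
  qed
qed (use assms in auto)

section \<open>Integration on the half-line\<close>

abbreviation half_line :: "real measure" where
  "half_line \<equiv> lebesgue_on {0<..}"

lemma sigma_finite_lebesgue: "sigma_finite_measure (lebesgue :: real measure)"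
proof
  obtain A :: "real set set" where A: "countable A" "A \<subseteq> sets lborel" "\<Union>A = space lborel"
    "\<forall>a\<in>A. emeasure lborel a \<noteq> \<infinity>"
    using lborel.sigma_finite_countable by blast
  then show "\<exists>A::real set set. countable A \<and> A \<subseteq> sets lebesgue \<and> \<Union>A = space lebesgue \<and> (\<forall>a\<in>A. emeasure lebesgue a \<noteq> \<infinity>)"
    by (intro exI[of _ A]) auto
qed

interpretation lebesgue: sigma_finite_measure "lebesgue :: real measure"
  by (rule sigma_finite_lebesgue)

lemma sigma_finite_lebesgue_on:
  "S \<in> sets lebesgue \<Longrightarrow> sigma_finite_measure (lebesgue_on (S::real set))"
  by (rule sigma_finite_measure_restrict_space[OF sigma_finite_lebesgue])

interpretation half_line: sigma_finite_measure half_line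
  by (rule sigma_finite_lebesgue_on) simp

lemma ident_measurable_lebesgue_on[measurable]: "(\<lambda>x. x) \<in> borel_measurable (lebesgue_on (S::real set))"
  by (rule measurable_restrict_space1) (simp add: measurable_completion)

lemma AE_half_line: "(AE x in half_line. P x) \<longleftrightarrow> (AE x in lebesgue. x > 0 \<longrightarrow> P x)"
  by (simp add: AE_restrict_space_iff)

lemma set_integral_half_line: "(LINT x:{0<..}|lebesgue. f x) = (LINT x|half_line. f x :: real)"
  by (simp add: integral_restrict_space set_lebesgue_integral_def)

lemma locally_integrableD:
  assumes "locally_integrable f" "0 < a"
  shows "f absolutely_integrable_on {a..b}"
  using assms unfolding locally_integrable_def by (elim allE[of _ "{a..b}"]) auto

text \<open>Integrability on each interval [1/(n+1), n+1] includes measurability there; these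
  intervals exhaust the half-line, so the pieces can be glued.\<close>

lemma locally_integrable_measurable:
  assumes "locally_integrable f"
  shows "f \<in> borel_measurable half_line"
proof -
  let ?A = "\<lambda>n::nat. {1 / real (Suc n)..real (Suc n)}"
  have U: "{0::real<..} = (\<Union>n. ?A n)"
  proof (intro set_eqI iffI)
    fix x :: real assume x: "x \<in> {0<..}"
    obtain n where n: "max x (1/x) \<le> real n" using real_arch_simple by blast
    then have "1 / x \<le> real (Suc n)" "x \<le> real (Suc n)" by auto
    then have "x \<in> ?A n" using x by (auto simp: field_simps)
    then show "x \<in> (\<Union>n. ?A n)" by blast
  qed (auto intro: less_le_trans[rotated])
  have m: "(\<lambda>x. indicator (?A n) x *\<^sub>R f x) \<in> borel_measurable lebesgue" for n
    using locally_integrableD[OF assms, of "1 / real (Suc n)" "real (Suc n)"]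
    unfolding set_integrable_def by (auto intro: borel_measurable_integrable)
  show ?thesis
  proof (rule measurable_piecewise_restrict2[where A="?A"])
    show "space half_line = (\<Union>n. ?A n)" by (simp only: U[symmetric] space_restrict_space) simp
    show "?A n \<in> sets half_line" for n
      by (auto simp: sets_restrict_space_iff intro: less_le_trans[rotated])
    show "\<exists>h\<in>borel_measurable half_line. \<forall>x\<in>?A n. f x = h x" for n
      by (intro bexI[of _ "\<lambda>x. indicator (?A n) x *\<^sub>R f x"] measurable_restrict_space1 m) simp
  qed
qed

text \<open>The rays form an intersection-stable generator of the Borel sets, so Dynkin's argument
  extends the vanishing to all Borel sets, with \<open>total\<close> handling complements. A
  Lebesgue set is Borel up to a null set, and a density with all integrals 0 is 0.\<close>

lemma zero_AE_of_interval_integrals: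
  fixes f :: "real \<Rightarrow> real"
  assumes f: "integrable lebesgue f" and z: "\<And>x. (LINT t:{..x}|lebesgue. f t) = 0"
    and total: "(LINT t|lebesgue. f t) = 0"
  shows "AE x in lebesgue. f x = 0"
proof (rule lebesgue.density_zero[OF f])
  have si: "set_integrable lebesgue A f" if "A \<in> sets lebesgue" for A
    using f that unfolding set_integrable_def by (rule integrable_mult_indicator[rotated])
  have borel: "(LINT t:A|lebesgue. f t) = 0" if "A \<in> sets (borel :: real measure)" for A
  proof -
    let ?G = "range (\<lambda>x. {..x::real})"
    have leb: "A \<in> sets lebesgue" if "A \<in> sigma_sets UNIV ?G" for A
      using that sets_completionI_sets[of A lborel] by (simp add: borel_eq_atMost)
    have 1: "A \<in> sigma_sets UNIV ?G"
      using that by (simp add: borel_eq_atMost)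
    have 2: "Int_stable ?G"
      by (auto simp: Int_stable_def)
    have 3: "?G \<subseteq> Pow UNIV" by auto
    show ?thesis
    proof (rule sigma_sets_induct_disjoint[OF 2 3 1, of "\<lambda>A. (LINT t:A|lebesgue. f t) = 0"])
      fix A assume "A \<in> ?G" then show "(LINT t:A|lebesgue. f t) = 0" using z by auto
    next
      show "(LINT t:{}|lebesgue. f t) = 0" by (simp add: set_lebesgue_integral_def)
    next
      fix A assume *: "A \<in> sigma_sets UNIV ?G" "(LINT t:A|lebesgue. f t) = 0"
      have "(LINT t:UNIV - A|lebesgue. f t) = (LINT t:(UNIV - A) \<union> A|lebesgue. f t) - (LINT t:A|lebesgue. f t)"
        using leb[OF *(1)] by (subst set_integral_Un) (auto intro!: si)
      then show "(LINT t:UNIV - A|lebesgue. f t) = 0"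
        using * total by (simp add: set_lebesgue_integral_def)
    next
      fix A :: "nat \<Rightarrow> real set"
      assume *: "disjoint_family A" "range A \<subseteq> sigma_sets UNIV ?G" "\<And>i. (LINT t:A i|lebesgue. f t) = 0"
      have A: "A i \<in> sets lebesgue" for i using *(2) leb by auto
      show "(LINT t:(\<Union>i. A i)|lebesgue. f t) = 0"
        using * A by (subst lebesgue_integral_countable_add) (auto intro!: si simp: disjoint_family_on_def)
    qed
  qed
  fix A :: "real set" assume A: "A \<in> sets lebesgue"
  then obtain B N N' where B: "A = B \<union> N" "N \<subseteq> N'" "N' \<in> null_sets lborel" "B \<in> sets borel"
    by (auto elim: sets_completionE)
  then have N: "N \<in> null_sets lebesgue"
    using null_sets_completion_subset null_sets_completionI by blast
  have "(LINT t:A|lebesgue. f t) = (LINT t:B|lebesgue. f t)"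
    unfolding set_lebesgue_integral_def
    using f A B(4) AE_not_in[OF N] B(1)
    by (intro integral_cong_AE borel_measurable_scaleR borel_measurable_indicator borel_measurable_integrable[OF f])
       (auto simp: indicator_def elim!: eventually_mono)
  with borel B(4) show "(LINT t:A|lebesgue. f t) = 0" by simp
qed

section \<open>The fundamental lemma of the calculus of variations\<close>

lemma test_function_pairing_integrable:
  assumes d: "locally_integrable d" and e: "test_function \<eta>"
  shows "integrable half_line (\<lambda>x. d x * \<eta> x)"
proof -
  obtain a b where ab: "0 < a" "a < b" "smooth \<eta>" "\<And>x. \<eta> x \<noteq> 0 \<Longrightarrow> a \<le> x \<and> x \<le> b"
    using e by (rule test_functionE) (rule that)
  have "(\<lambda>x. \<eta> x * d x) absolutely_integrable_on {a..b}"
  proof (rule absolutely_integrable_bounded_measurable_product_real)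
    show "\<eta> \<in> borel_measurable (lebesgue_on {a..b})"
      by (intro continuous_imp_measurable_on_sets_lebesgue smooth_continuous_on ab(3)) simp
    show "bounded (\<eta> ` {a..b})"
      by (intro compact_imp_bounded compact_continuous_image smooth_continuous_on ab(3)) simp
    show "d absolutely_integrable_on {a..b}" by (rule locally_integrableD[OF d ab(1)])
  qed simp
  then have "integrable lebesgue (\<lambda>x. indicator {a..b} x *\<^sub>R (\<eta> x * d x))"
    by (simp add: set_integrable_def)
  also have "(\<lambda>x. indicator {a..b} x *\<^sub>R (\<eta> x * d x)) = (\<lambda>x. indicator {0<..} x *\<^sub>R (d x * \<eta> x))"
    using ab by (force simp: indicator_def)
  finally show ?thesis by (simp add: integrable_restrict_space)
qed

lemma abs_mult_le_indicator:
  fixes d e :: real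
  assumes "x \<notin> S \<Longrightarrow> e = 0" "\<bar>e\<bar> \<le> 1"
  shows "norm (d * e) \<le> \<bar>indicator S x *\<^sub>R d\<bar>"
  using assms mult_left_mono[of "\<bar>e\<bar>" 1 "\<bar>d\<bar>"] by (auto simp: indicator_def abs_mult)

text \<open>Dominated convergence along plateau functions that tend to the indicator of
  (a,b].\<close>

lemma fundamental_lemma_interval:
  assumes d: "locally_integrable d"
    and z: "\<And>\<eta>. test_function \<eta> \<Longrightarrow> (LINT x|half_line. d x * \<eta> x) = 0"
    and ab: "0 < a" "a < b"
  shows "(LINT x:{a<..b}|lebesgue. d x) = 0"
proof -
  \<comment> \<open>Slopes of at least 1 (hence \<open>Suc n\<close>) keep all supports inside
    [a, b+1], so that \<open>d\<close> restricted to this interval dominates the whole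
    sequence.\<close>
  let ?e = "\<lambda>n x. bump_step (real (Suc n) * (x - a)) - bump_step (real (Suc n) * (x - b))"
  have t: "test_function (?e n)" for n by (rule test_function_plateau) (use ab in auto)
  have step: "(\<lambda>n. bump_step (real (Suc n) * y)) \<longlonglongrightarrow> (if y \<le> 0 then 0 else 1)" for y
  proof (cases "y \<le> 0")
    case True
    then show ?thesis by (simp add: bump_step_left mult_le_0_iff)
  next
    case False
    then obtain N where N: "1 / y \<le> real N" using real_arch_simple by blast
    have "bump_step (real (Suc n) * y) = 1" if "n \<ge> N" for n
    proof (rule bump_step_right)
      have "1 / y \<le> real (Suc n)" using N that by linarith
      then show "1 \<le> real (Suc n) * y" using False by (simp add: field_simps)
    qed
    then show ?thesis using False
      by (intro tendsto_eventually) (simp add: eventually_sequentially del: of_nat_Suc, blast)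
  qed
  have lim: "(\<lambda>n. ?e n x) \<longlonglongrightarrow> indicator {a<..b} x" for x
  proof -
    have "(\<lambda>n. ?e n x) \<longlonglongrightarrow> (if x - a \<le> 0 then 0 else 1) - (if x - b \<le> 0 then 0 else 1)"
      by (intro tendsto_diff step)
    then show ?thesis using ab by (auto simp: indicator_def split: if_splits)
  qed
  have supp: "?e n x = 0" if "x \<notin> {a..b+1}" for n x
  proof -
    have "x < a \<or> x > b + 1" using that by auto
    then show ?thesis
    proof
      assume 1: "x < a"
      then have "real (Suc n) * (x - a) \<le> 0" "real (Suc n) * (x - b) \<le> 0"
        using ab by (auto simp only: mult_le_0_iff)
      then show ?thesis by (simp only: bump_step_left diff_self)
    next
      assume 2: "x > b + 1"
      have *: "1 \<le> real (Suc n) * y" if "1 \<le> y" for y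
        using mult_mono[of 1 "real (Suc n)" 1 y] that by simp
      have "1 \<le> real (Suc n) * (x - a)" "1 \<le> real (Suc n) * (x - b)"
        using *[of "x - a"] *[of "x - b"] 2 ab by auto
      then show ?thesis by (simp only: bump_step_right diff_self)
    qed
  qed
  have bd: "\<bar>?e n x\<bar> \<le> 1" for n x
    using bump_step_bounds[of "real (Suc n) * (x - a)"] bump_step_bounds[of "real (Suc n) * (x - b)"]
    by linarith
  have [measurable]: "d \<in> borel_measurable half_line" by (rule locally_integrable_measurable[OF d])
  have "(\<lambda>n. LINT x|half_line. d x * ?e n x) \<longlonglongrightarrow> (LINT x|half_line. d x * indicator {a<..b} x)"
  proof (rule integral_dominated_convergence[where w="\<lambda>x. \<bar>indicator {a..b+1} x *\<^sub>R d x\<bar>"])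
    have "integrable lebesgue (\<lambda>x. indicator {0<..} x *\<^sub>R (indicator {a..b+1} x *\<^sub>R d x))"
      by (rule integrable_mult_indicator[OF _ locally_integrableD[OF d ab(1), of "b+1", unfolded set_integrable_def]]) simp
    then show "integrable half_line (\<lambda>x. \<bar>indicator {a..b+1} x *\<^sub>R d x\<bar>)"
      by (intro integrable_abs) (simp add: integrable_restrict_space)
    show "(\<lambda>x. d x * indicator {a<..b} x) \<in> borel_measurable half_line" by measurable
    show "(\<lambda>x. d x * ?e n x) \<in> borel_measurable half_line" for n
      using test_function_pairing_integrable[OF d t] by (rule borel_measurable_integrable)
    show "AE x in half_line. (\<lambda>n. d x * ?e n x) \<longlonglongrightarrow> d x * indicator {a<..b} x"
      by (intro AE_I2 tendsto_mult_left lim)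
    show "AE x in half_line. norm (d x * ?e n x) \<le> \<bar>indicator {a..b+1} x *\<^sub>R d x\<bar>" for n
      by (intro AE_I2 abs_mult_le_indicator supp bd)
  qed
  moreover have "(LINT x|half_line. d x * ?e n x) = 0" for n
    by (rule z[OF t])
  ultimately have "(LINT x|half_line. d x * indicator {a<..b} x) = 0"
    using LIMSEQ_unique[OF _ tendsto_const] by simp
  also have "(LINT x|half_line. d x * indicator {a<..b} x) = (LINT x:{a<..b}|lebesgue. d x)"
    using ab unfolding set_lebesgue_integral_def
    by (simp add: integral_restrict_space) (intro Bochner_Integration.integral_cong refl; auto simp: indicator_def)
  finally show ?thesis .
qed

lemma fundamental_lemma:
  assumes d: "locally_integrable d"
    and z: "\<And>\<eta>. test_function \<eta> \<Longrightarrow> (LINT x|half_line. d x * \<eta> x) = 0"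
  shows "AE x in half_line. d x = 0"
proof -
  have *: "AE x in lebesgue. indicator {a<..b} x * d x = 0" if ab: "0 < a" "a < b" for a b
  proof (rule zero_AE_of_interval_integrals)
    have "set_integrable lebesgue {a<..b} d"
      using locally_integrableD[OF d ab(1), of b] by (rule set_integrable_subset) auto
    then show "integrable lebesgue (\<lambda>x. indicator {a<..b} x * d x)"
      by (simp add: set_integrable_def)
    show "(LINT t|lebesgue. indicator {a<..b} t * d t) = 0"
      using fundamental_lemma_interval[OF d z ab] by (simp add: set_lebesgue_integral_def)
    fix x
    have eq: "(LINT t:{..x}|lebesgue. indicator {a<..b} t * d t) = (LINT t:{a<..min x b}|lebesgue. d t)"
      unfolding set_lebesgue_integral_def
      by (intro Bochner_Integration.integral_cong refl) (auto simp: indicator_def)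
    show "(LINT t:{..x}|lebesgue. indicator {a<..b} t * d t) = 0"
    proof (cases "a < min x b")
      case True
      then show ?thesis unfolding eq using fundamental_lemma_interval[OF d z ab(1)] by blast
    next
      case False
      then have "{a<..min x b} = {}" by auto
      show ?thesis unfolding eq \<open>{a<..min x b} = {}\<close> by (simp add: set_lebesgue_integral_def)
    qed
  qed
  \<comment> \<open>A countable exhaustion is needed to collect the exceptional null sets; the
    offset 2 ensures 1/(n+2) < n+2 already for n = 0.\<close>
  have "AE x in lebesgue. \<forall>n::nat. indicator {1 / real (n+2)<..real (n+2)} x * d x = 0"
    unfolding AE_all_countable
    by (intro allI * order.strict_trans1[of "1 / real (_ + 2)" 1]) auto
  then show ?thesis
    unfolding AE_half_line
  proof eventually_elim
    case (elim x)
    show ?case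
    proof
      assume x: "x > 0"
      obtain n where n: "max x (1/x) \<le> real n" using real_arch_simple by blast
      then have "1 / x < real (n+2)" "x \<le> real (n+2)" by auto
      then have "x \<in> {1 / real (n+2)<..real (n+2)}" using x by (auto simp: field_simps)
      with elim[rule_format, of n] show "d x = 0" by simp
    qed
  qed
qed

text \<open>Fubini's theorem on the square, cut along the diagonal.\<close>

lemma integral_product_split:
  fixes f h :: "real \<Rightarrow> real"
  assumes M: "sigma_finite_measure M" and [measurable]: "(\<lambda>x. x) \<in> borel_measurable M"
    and f: "integrable M f" and h: "integrable M h"
  shows "(LINT s|M. f s) * (LINT t|M. h t) =
    (LINT s|M. f s * (LINT t|M. indicator {..s} t * h t)) + (LINT t|M. (LINT s|M. indicator {..<t} s * f s) * h t)"
    and "integrable M (\<lambda>s. f s * (LINT t|M. indicator {..s} t * h t))"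
    and "integrable M (\<lambda>t. (LINT s|M. indicator {..<t} s * f s) * h t)"
proof -
  interpret M: sigma_finite_measure M by fact
  interpret P: pair_sigma_finite M M ..
  have [measurable]: "f \<in> borel_measurable M" "h \<in> borel_measurable M"
    using f h by auto
  have fh: "integrable (M \<Otimes>\<^sub>M M) (\<lambda>(s,t). f s * h t)"
    using f h by (intro P.Fubini_integrable) (auto simp: abs_mult)
  have 1: "integrable (M \<Otimes>\<^sub>M M) (\<lambda>(s,t). f s * (indicator {..s} t * h t))"
    by (rule Bochner_Integration.integrable_bound[OF fh]) (auto simp: indicator_def abs_mult)
  have 2: "integrable (M \<Otimes>\<^sub>M M) (\<lambda>(s,t). (indicator {..<t} s * f s) * h t)"
    by (rule Bochner_Integration.integrable_bound[OF fh]) (auto simp: indicator_def abs_mult)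
  show "integrable M (\<lambda>s. f s * (LINT t|M. indicator {..s} t * h t))"
    using P.integrable_fst[OF 1] by simp
  show "integrable M (\<lambda>t. (LINT s|M. indicator {..<t} s * f s) * h t)"
    using P.integrable_snd[OF 2] by simp
  have "(LINT s|M. f s) * (LINT t|M. h t) = (LINT s|M. (LINT t|M. f s * h t))"
    by simp
  also have "\<dots> = (LINT p|(M \<Otimes>\<^sub>M M). (case p of (s,t) \<Rightarrow> f s * h t))"
    by (rule P.integral_fst[OF fh])
  also have "\<dots> = (LINT p|(M \<Otimes>\<^sub>M M). (case p of (s,t) \<Rightarrow> f s * (indicator {..s} t * h t)) + (case p of (s,t) \<Rightarrow> (indicator {..<t} s * f s) * h t))"
    by (intro Bochner_Integration.integral_cong refl) (auto simp: indicator_def)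
  also have "\<dots> = (LINT p|(M \<Otimes>\<^sub>M M). (case p of (s,t) \<Rightarrow> f s * (indicator {..s} t * h t))) + (LINT p|(M \<Otimes>\<^sub>M M). (case p of (s,t) \<Rightarrow> (indicator {..<t} s * f s) * h t))"
    by (rule Bochner_Integration.integral_add[OF 1 2])
  also have "\<dots> = (LINT s|M. (LINT t|M. f s * (indicator {..s} t * h t))) + (LINT t|M. (LINT s|M. (indicator {..<t} s * f s) * h t))"
    by (simp only: P.integral_fst[OF 1] P.integral_snd[OF 2])
  also have "\<dots> = (LINT s|M. f s * (LINT t|M. indicator {..s} t * h t)) + (LINT t|M. (LINT s|M. indicator {..<t} s * f s) * h t)"
    by simp
  finally show "(LINT s|M. f s) * (LINT t|M. h t) =
    (LINT s|M. f s * (LINT t|M. indicator {..s} t * h t)) + (LINT t|M. (LINT s|M. indicator {..<t} s * f s) * h t)" .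
qed

section \<open>Absolutely continuous functions and generalized derivatives\<close>

text \<open>Unlike \<open>locally_integrable\<close>, this reaches down to the end point 0, so that
  primitives can be based at 0.\<close>

definition L1_0 :: "(real \<Rightarrow> real) \<Rightarrow> bool" where
  "L1_0 f \<longleftrightarrow> (\<forall>r. f absolutely_integrable_on {0..r})"

text \<open>Absolute continuity of \<open>F\<close> on each [0,r] with density \<open>f\<close>,
  encoded by the integral formula. Differentiability almost everywhere is thereby avoided
  throughout.\<close>

definition primitive :: "(real \<Rightarrow> real) \<Rightarrow> (real \<Rightarrow> real) \<Rightarrow> bool" where
  "primitive F f \<longleftrightarrow> L1_0 f \<and> (\<forall>x\<ge>0. F x = F 0 + integral {0..x} f)"

lemma primitiveD: "primitive F f \<Longrightarrow> L1_0 f"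
    "primitive F f \<Longrightarrow> 0 \<le> x \<Longrightarrow> F 0 + integral {0..x} f = F x"
    "primitive F f \<Longrightarrow> 0 \<le> x \<Longrightarrow> integral {0..x} f = F x - F 0"
  unfolding primitive_def by (metis, metis, metis add_diff_cancel_left')

lemma L1_0D: "L1_0 f \<Longrightarrow> f absolutely_integrable_on {0..r}"
  by (simp add: L1_0_def)

lemma L1_0_integrable_on: "L1_0 f \<Longrightarrow> f integrable_on {0..r}"
  by (simp add: L1_0_def absolutely_integrable_on_def)

lemma L1_0_integrable: "L1_0 f \<Longrightarrow> integrable (lebesgue_on {0..r}) f"
  by (simp add: L1_0_def absolutely_integrable_imp_integrable)

lemma L1_0_locally_integrable: "L1_0 f \<Longrightarrow> locally_integrable f"
  unfolding locally_integrable_def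
proof (intro allI impI)
  fix K :: "real set" assume f: "L1_0 f" and K: "compact K \<and> K \<subseteq> {0<..}"
  then obtain r where "\<And>x. x \<in> K \<Longrightarrow> \<bar>x\<bar> \<le> r"
    using compact_imp_bounded bounded_real by metis
  then have "K \<subseteq> {0..r}" using K by force
  then show "f absolutely_integrable_on K"
    by (intro set_integrable_subset[OF L1_0D[OF f, of r]] sets_completionI_sets)
       (use K in \<open>simp_all add: borel_compact\<close>)
qed

lemma L1_0_measurable: "L1_0 f \<Longrightarrow> f \<in> borel_measurable half_line"
  by (intro locally_integrable_measurable L1_0_locally_integrable)

lemma L1_0_continuous: "continuous_on {0..} f \<Longrightarrow> L1_0 f"
  unfolding L1_0_def
  by (auto intro!: absolutely_integrable_continuous_real elim: continuous_on_subset)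

lemma L1_0_zero: "L1_0 (\<lambda>_. 0)"
  by (rule L1_0_continuous) simp

lemma L1_0_add: "L1_0 f \<Longrightarrow> L1_0 g \<Longrightarrow> L1_0 (\<lambda>x. f x + g x)"
  unfolding L1_0_def using set_integral_add(1) by blast

lemma L1_0_cmult: "L1_0 f \<Longrightarrow> L1_0 (\<lambda>x. c * f x)"
  by (simp add: L1_0_def)

lemma L1_0_continuous_mult:
  assumes F: "continuous_on {0..} F" and f: "L1_0 f"
  shows "L1_0 (\<lambda>x. F x * f x)"
  unfolding L1_0_def
proof (intro allI absolutely_integrable_bounded_measurable_product_real L1_0D f)
  fix r :: real
  have c: "continuous_on {0..r} F" using F by (rule continuous_on_subset) auto
  show "F \<in> borel_measurable (lebesgue_on {0..r})"
    by (intro continuous_imp_measurable_on_sets_lebesgue c) simp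
  show "bounded (F ` {0..r})"
    by (intro compact_imp_bounded compact_continuous_image c) simp
qed simp

lemma continuous_on_atLeastI:
  assumes "\<And>r. continuous_on {0..r} (F :: real \<Rightarrow> real)"
  shows "continuous_on {0..} F"
  unfolding continuous_on_eq_continuous_within
proof
  fix x :: real assume x: "x \<in> {0..}"
  have "at x within {0..} = at x within {0..x+1}"
    by (rule at_within_nhd[of x "{..<x+1}"]) auto
  then show "continuous (at x within {0..}) F"
    using assms[of "x+1"] x by (auto simp: continuous_on_eq_continuous_within)
qed

lemma primitive_continuous:
  assumes "primitive F f" shows "continuous_on {0..} F"
proof (rule continuous_on_atLeastI)
  fix r
  have "continuous_on {0..r} (\<lambda>x. F 0 + integral {0..x} f)"
    by (intro continuous_intros indefinite_integral_continuous_1 L1_0_integrable_on primitiveD[OF assms])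
  then show "continuous_on {0..r} F"
    by (rule continuous_on_eq) (simp add: primitiveD(2)[OF assms])
qed

lemma primitive_L1_0: "primitive F f \<Longrightarrow> L1_0 F"
  by (intro L1_0_continuous primitive_continuous)

lemma primitive_integral: "L1_0 f \<Longrightarrow> primitive (\<lambda>x. integral {0..x} f) f"
  by (simp add: primitive_def)

lemma primitive_zero: "primitive (\<lambda>_. 0) (\<lambda>_. 0)"
  by (simp add: primitive_def L1_0_zero)

lemma primitive_add:
  assumes "primitive F f" "primitive H h"
  shows "primitive (\<lambda>x. F x + H x) (\<lambda>x. f x + h x)"
proof -
  have L: "L1_0 f" "L1_0 h" using assms by (auto dest: primitiveD)
  then have S: "integral {0..x} (\<lambda>x. f x + h x) = integral {0..x} f + integral {0..x} h" for x
    by (intro Henstock_Kurzweil_Integration.integral_add L1_0_integrable_on)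
  have "F x + H x = F 0 + H 0 + integral {0..x} (\<lambda>x. f x + h x)" if "0 \<le> x" for x
    using S[of x] primitiveD(3)[OF assms(1) that] primitiveD(3)[OF assms(2) that] by linarith
  then show ?thesis
    unfolding primitive_def using L1_0_add[OF L] by blast
qed

lemma primitive_cmult:
  assumes "primitive F f" shows "primitive (\<lambda>x. c * F x) (\<lambda>x. c * f x)"
  unfolding primitive_def
  by (auto simp: L1_0_cmult primitiveD[OF assms] simp flip: distrib_left)

lemma primitive_sum:
  "(\<And>i. i \<in> I \<Longrightarrow> primitive (F i) (f i)) \<Longrightarrow> primitive (\<lambda>x. \<Sum>i\<in>I. F i x) (\<lambda>x. \<Sum>i\<in>I. f i x)"
  by (induction I rule: infinite_finite_induct) (auto intro: primitive_add primitive_zero)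

lemma primitive_DERIV:
  assumes "\<And>x. (F has_real_derivative f x) (at x)" "continuous_on UNIV f"
  shows "primitive F f"
  unfolding primitive_def
proof (intro conjI allI impI)
  show "L1_0 f" by (rule L1_0_continuous) (rule continuous_on_subset[OF assms(2)], simp)
  fix x :: real assume "0 \<le> x"
  then have "(f has_integral (F x - F 0)) {0..x}"
    by (intro fundamental_theorem_of_calculus)
       (auto simp: has_real_derivative_iff_has_vector_derivative[symmetric] intro!: has_field_derivative_at_within assms(1))
  then show "F x = F 0 + integral {0..x} f" by (simp add: integral_unique)
qed

lemma integral_lebesgue_on_indicator:
  fixes f :: "real \<Rightarrow> real"
  assumes f: "integrable (lebesgue_on {0..x}) f" and s: "0 \<le> s" "s \<le> x"
  shows "(LINT t|lebesgue_on {0..x}. indicator {..s} t * f t) = integral {0..s} f"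
    and "(LINT t|lebesgue_on {0..x}. indicator {..<s} t * f t) = integral {0..s} f"
proof -
  have i: "integrable lebesgue (\<lambda>t. indicator {0..x} t *\<^sub>R f t)"
    using f by (simp add: integrable_restrict_space)
  have "integrable lebesgue (\<lambda>t. indicator {0..s} t *\<^sub>R (indicator {0..x} t *\<^sub>R f t))"
    by (rule integrable_mult_indicator[OF _ i]) simp
  also have "(\<lambda>t. indicator {0..s} t *\<^sub>R (indicator {0..x} t *\<^sub>R f t)) = (\<lambda>t. indicator {0..s} t *\<^sub>R f t)"
    using s by (auto simp: indicator_def)
  finally have f': "integrable (lebesgue_on {0..s}) f"
    by (simp add: integrable_restrict_space)
  have "(LINT t|lebesgue_on {0..x}. indicator {..s} t * f t) = (LINT t|lebesgue. indicator {0..x} t *\<^sub>R (indicator {..s} t * f t))"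
    by (simp add: integral_restrict_space)
  also have "\<dots> = (LINT t|lebesgue. indicator {0..s} t *\<^sub>R f t)"
    using s by (intro Bochner_Integration.integral_cong) (auto simp: indicator_def)
  also have "\<dots> = (LINT t|lebesgue_on {0..s}. f t)"
    by (simp add: integral_restrict_space)
  also have "\<dots> = integral {0..s} f"
    by (rule lebesgue_integral_eq_integral[OF f']) simp
  finally show 1: "(LINT t|lebesgue_on {0..x}. indicator {..s} t * f t) = integral {0..s} f" .
  have n: "AE t in lebesgue_on {0..x}. t \<noteq> s"
    by (subst AE_restrict_space_iff) (auto intro!: eventually_mono[OF AE_not_in[of "{s}" lebesgue]])
  have [measurable]: "f \<in> borel_measurable (lebesgue_on {0..x})" using f by auto
  have "(LINT t|lebesgue_on {0..x}. indicator {..<s} t * f t) = (LINT t|lebesgue_on {0..x}. indicator {..s} t * f t)"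
    by (intro integral_cong_AE) (use n in \<open>auto simp: indicator_def elim!: eventually_mono\<close>)
  with 1 show "(LINT t|lebesgue_on {0..x}. indicator {..<s} t * f t) = integral {0..s} f" by simp
qed

text \<open>Integration by parts for absolutely continuous functions. The product of the two
  integrals over [0,x] is a double integral over a square; cut along the diagonal, its halves
  contain the increments of \<open>H\<close> and of \<open>F\<close> as inner integrals.\<close>

lemma primitive_mult:
  assumes F: "primitive F f" and H: "primitive H h"
  shows "primitive (\<lambda>x. F x * H x) (\<lambda>x. f x * H x + F x * h x)"
  unfolding primitive_def
proof (intro conjI allI impI)
  have f: "L1_0 f" and h: "L1_0 h" using F H by (auto dest: primitiveD)
  have L: "L1_0 (\<lambda>x. f x * H x)" "L1_0 (\<lambda>x. F x * h x)"
    using L1_0_continuous_mult[OF primitive_continuous[OF H] f]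
      L1_0_continuous_mult[OF primitive_continuous[OF F] h] by (simp_all add: ac_simps)
  then show "L1_0 (\<lambda>x. f x * H x + F x * h x)" by (rule L1_0_add)
  fix x :: real assume x: "0 \<le> x"
  let ?M = "lebesgue_on {0..x}"
  have fi: "integrable ?M f" and hi: "integrable ?M h"
    using f h by (auto intro: L1_0_integrable)
  have I: "(LINT t|?M. g t) = integral {0..x} g" if "integrable ?M g" for g :: "real \<Rightarrow> real"
    by (rule lebesgue_integral_eq_integral[OF that]) simp
  note P = integral_product_split[OF sigma_finite_lebesgue_on ident_measurable_lebesgue_on fi hi]
  have "integral {0..x} f * integral {0..x} h =
      (LINT s|?M. f s * (LINT t|?M. indicator {..s} t * h t)) + (LINT t|?M. (LINT s|?M. indicator {..<t} s * f s) * h t)"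
    using P(1) I[OF fi] I[OF hi] by simp
  also have "(LINT s|?M. f s * (LINT t|?M. indicator {..s} t * h t)) = (LINT s|?M. f s * (H s - H 0))"
    by (intro Bochner_Integration.integral_cong refl)
      (auto simp: integral_lebesgue_on_indicator[OF hi] primitiveD(3)[OF H])
  also have "(LINT t|?M. (LINT s|?M. indicator {..<t} s * f s) * h t) = (LINT t|?M. (F t - F 0) * h t)"
    by (intro Bochner_Integration.integral_cong refl)
      (auto simp: integral_lebesgue_on_indicator[OF fi] primitiveD(3)[OF F])
  also have "(LINT s|?M. f s * (H s - H 0)) = (LINT s|?M. f s * H s) - (LINT s|?M. f s) * H 0"
    using fi L1_0_integrable[OF L(1), of x] by (simp add: right_diff_distrib)
  also have "(LINT t|?M. (F t - F 0) * h t) = (LINT t|?M. F t * h t) - F 0 * (LINT t|?M. h t)"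
    using hi L1_0_integrable[OF L(2), of x] by (simp add: left_diff_distrib)
  finally have eq: "integral {0..x} f * integral {0..x} h =
      integral {0..x} (\<lambda>s. f s * H s) - integral {0..x} f * H 0 +
      (integral {0..x} (\<lambda>s. F s * h s) - F 0 * integral {0..x} h)"
    using L by (simp add: I L1_0_integrable f h)
  have "integral {0..x} (\<lambda>s. f s * H s + F s * h s) =
      integral {0..x} (\<lambda>s. f s * H s) + integral {0..x} (\<lambda>s. F s * h s)"
    by (intro Henstock_Kurzweil_Integration.integral_add L1_0_integrable_on L)
  moreover have "F x * H x = (F 0 + integral {0..x} f) * (H 0 + integral {0..x} h)"
    by (simp only: primitiveD(2)[OF F x] primitiveD(2)[OF H x])
  ultimately show "F x * H x = F 0 * H 0 + integral {0..x} (\<lambda>s. f s * H s + F s * h s)"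
    using eq by (simp add: algebra_simps)
qed

text \<open>A function \<open>F 0\<close> together with its derivatives up to order n. Those below
  order n are absolutely continuous, the last is merely integrable: the class in which generalized
  derivatives can be computed classically.\<close>

definition chain :: "nat \<Rightarrow> (nat \<Rightarrow> real \<Rightarrow> real) \<Rightarrow> bool" where
  "chain n F \<longleftrightarrow> L1_0 (F n) \<and> (\<forall>j<n. primitive (F j) (F (Suc j)))"

lemma chain_L1_0: "chain n F \<Longrightarrow> j \<le> n \<Longrightarrow> L1_0 (F j)"
  unfolding chain_def by (metis le_neq_implies_less primitive_L1_0)

lemma chain_continuous: "chain n F \<Longrightarrow> j < n \<Longrightarrow> continuous_on {0..} (F j)"
  unfolding chain_def by (metis primitive_continuous)

lemma chain_mult:
  assumes "0 < n" and A: "chain n A" and B: "chain n B"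
  shows "chain n (\<lambda>j x. \<Sum>i\<le>j. real (j choose i) * (A (j - i) x * B i x))"
proof -
  have prim: "primitive (\<lambda>x. \<Sum>i\<le>j. real (j choose i) * (A (j - i) x * B i x))
     (\<lambda>x. \<Sum>i\<le>Suc j. real (Suc j choose i) * (A (Suc j - i) x * B i x))" if "j < n" for j
  proof -
    have "primitive (\<lambda>x. \<Sum>i\<le>j. real (j choose i) * (A (j - i) x * B i x))
      (\<lambda>x. \<Sum>i\<le>j. real (j choose i) * (A (Suc (j - i)) x * B i x + A (j - i) x * B (Suc i) x))"
      using A B that by (intro primitive_sum primitive_cmult primitive_mult) (auto simp: chain_def)
    then show ?thesis by (subst sum_binomial_Leibniz[symmetric])
  qed
  \<comment> \<open>The sum of order n is integrable because it is the density of the sum of order n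
    - 1. For n = 0 it would be a product of two merely integrable functions.\<close>
  have "L1_0 (\<lambda>x. \<Sum>i\<le>n. real (n choose i) * (A (n - i) x * B i x))"
    using primitiveD(1)[OF prim[of "n - 1"]] \<open>0 < n\<close> by simp
  with prim show ?thesis by (auto simp: chain_def)
qed

lemma pairing_Icc:
  assumes g: "L1_0 g" and e: "test_function \<eta>" and ab: "0 < a" "\<And>x. \<eta> x \<noteq> 0 \<Longrightarrow> a \<le> x \<and> x \<le> b"
  shows "(LINT x|half_line. g x * \<eta> x) = integral {0..b} (\<lambda>x. g x * \<eta> x)"
proof -
  have eq: "(\<lambda>x. indicator {0<..} x *\<^sub>R (g x * \<eta> x)) = (\<lambda>x. indicator {0..b} x *\<^sub>R (g x * \<eta> x))"
    using ab by (force simp: indicator_def)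
  have "integrable half_line (\<lambda>x. g x * \<eta> x)"
    using L1_0_locally_integrable[OF g] e by (rule test_function_pairing_integrable)
  then have "integrable lebesgue (\<lambda>x. indicator {0<..} x *\<^sub>R (g x * \<eta> x))"
    by (simp add: integrable_restrict_space)
  then have i: "integrable (lebesgue_on {0..b}) (\<lambda>x. g x * \<eta> x)"
    unfolding eq by (simp add: integrable_restrict_space)
  have "(LINT x|half_line. g x * \<eta> x) = (LINT x|lebesgue. indicator {0..b} x *\<^sub>R (g x * \<eta> x))"
    by (subst integral_restrict_space) (simp_all only: eq, simp)
  also have "\<dots> = (LINT x|lebesgue_on {0..b}. g x * \<eta> x)"
    by (subst integral_restrict_space) simp_all
  also have "\<dots> = integral {0..b} (\<lambda>x. g x * \<eta> x)"
    by (rule lebesgue_integral_eq_integral[OF i]) simp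
  finally show ?thesis .
qed

lemma test_function_primitive:
  assumes "test_function \<eta>" shows "primitive \<eta> (deriv \<eta>)"
proof -
  have s: "smooth \<eta>" using assms by (auto elim: test_functionE)
  show ?thesis
    by (rule primitive_DERIV) (use smooth_deriv_iterate[OF s, of 0] smooth_continuous_on[OF smooth_deriv[OF s]] in auto)
qed

text \<open>The product rule on [0,r], where the boundary terms vanish because \<open>\<eta>\<close>
  is 0 at both ends.\<close>

lemma primitive_pairing:
  assumes F: "primitive F f" and e: "test_function \<eta>"
  shows "(LINT x|half_line. F x * deriv \<eta> x) = - (LINT x|half_line. f x * \<eta> x)"
proof -
  obtain a b where ab: "0 < a" "a < b" "smooth \<eta>" "\<And>x. \<eta> x \<noteq> 0 \<Longrightarrow> a \<le> x \<and> x \<le> b"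
    using e by (rule test_functionE) (rule that)
  obtain a' b' where ab': "0 < a'" "a' < b'" "smooth (deriv \<eta>)" "\<And>x. deriv \<eta> x \<noteq> 0 \<Longrightarrow> a' \<le> x \<and> x \<le> b'"
    using test_function_deriv[OF e] by (rule test_functionE) (rule that)
  \<comment> \<open>One right end for the supports of \<open>\<eta>\<close> and
    \<open>deriv \<eta>\<close>; the summand 1 places it strictly outside, so that
    \<open>\<eta> r = 0\<close>.\<close>
  define r where "r = max b b' + 1"
  have r: "\<And>x. \<eta> x \<noteq> 0 \<Longrightarrow> a \<le> x \<and> x \<le> r" "\<And>x. deriv \<eta> x \<noteq> 0 \<Longrightarrow> a' \<le> x \<and> x \<le> r" "0 \<le> r"
    using ab ab' by (force simp: r_def)+
  have "\<not> r \<le> b" by (simp add: r_def)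
  then have z: "\<eta> 0 = 0" "\<eta> r = 0" using ab(4)[of 0] ab(4)[of r] ab(1) by auto
  have P: "primitive (\<lambda>x. F x * \<eta> x) (\<lambda>x. f x * \<eta> x + F x * deriv \<eta> x)"
    by (rule primitive_mult[OF F test_function_primitive[OF e]])
  have L: "L1_0 (\<lambda>x. f x * \<eta> x)" "L1_0 (\<lambda>x. F x * deriv \<eta> x)"
    using L1_0_continuous_mult[OF smooth_continuous_on[OF ab(3)] primitiveD(1)[OF F]]
       L1_0_continuous_mult[OF smooth_continuous_on[OF ab'(3)] primitive_L1_0[OF F]] by (simp_all add: ac_simps)
  have "0 = integral {0..r} (\<lambda>x. f x * \<eta> x + F x * deriv \<eta> x)"
    using primitiveD(2)[OF P r(3)] z by simp
  also have "\<dots> = integral {0..r} (\<lambda>x. f x * \<eta> x) + integral {0..r} (\<lambda>x. F x * deriv \<eta> x)"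
    by (intro Henstock_Kurzweil_Integration.integral_add L1_0_integrable_on L)
  also have "integral {0..r} (\<lambda>x. f x * \<eta> x) = (LINT x|half_line. f x * \<eta> x)"
    by (rule pairing_Icc[OF primitiveD(1)[OF F] e ab(1) r(1), symmetric])
  also have "integral {0..r} (\<lambda>x. F x * deriv \<eta> x) = (LINT x|half_line. F x * deriv \<eta> x)"
    by (rule pairing_Icc[OF primitive_L1_0[OF F] test_function_deriv[OF e] ab'(1) r(2), symmetric])
  finally show ?thesis by simp
qed

text \<open>One derivative at a time moves from the test function to the chain. The innermost one is
  peeled off, so the induction hypothesis is applied to \<open>deriv \<eta>\<close>.\<close>

lemma chain_pairing:
  assumes "chain n F" "test_function \<eta>"
  shows "(LINT x|half_line. F 0 x * (deriv ^^ n) \<eta> x) = (-1) ^ n * (LINT x|half_line. F n x * \<eta> x)"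
  using assms
proof (induction n arbitrary: \<eta>)
  case (Suc n)
  have c: "chain n F" using Suc.prems(1) chain_L1_0[OF Suc.prems(1), of n] by (auto simp: chain_def)
  have p: "primitive (F n) (F (Suc n))" using Suc.prems(1) by (auto simp: chain_def)
  have "(LINT x|half_line. F 0 x * (deriv ^^ Suc n) \<eta> x) = (LINT x|half_line. F 0 x * (deriv ^^ n) (deriv \<eta>) x)"
    by (simp only: funpow_Suc_right comp_def)
  also have "\<dots> = (-1) ^ n * (LINT x|half_line. F n x * deriv \<eta> x)"
    by (rule Suc.IH[OF c test_function_deriv[OF Suc.prems(2)]])
  finally show ?case using primitive_pairing[OF p Suc.prems(2)] by simp
qed simp

section \<open>Generalized derivatives, determined up to null sets\<close>

lemma has_gen_deriv_iff:
  "has_gen_deriv n f g \<longleftrightarrow> locally_integrable f \<and> locally_integrable g \<and>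
     (\<forall>\<eta>. test_function \<eta> \<longrightarrow>
        (LINT x|half_line. f x * (deriv ^^ n) \<eta> x) = (-1) ^ n * (LINT x|half_line. g x * \<eta> x))"
  by (simp add: has_gen_deriv_def set_integral_half_line)

lemma chain_has_gen_deriv: "chain n F \<Longrightarrow> has_gen_deriv n (F 0) (F n)"
  unfolding has_gen_deriv_iff
  using chain_L1_0[of n F 0] chain_L1_0[of n F n] chain_pairing by (auto intro: L1_0_locally_integrable)

lemma locally_integrable_diff:
  "locally_integrable f \<Longrightarrow> locally_integrable g \<Longrightarrow> locally_integrable (\<lambda>x. f x - g x)"
  unfolding locally_integrable_def using set_integral_diff(1) by blast

lemma locally_integrable_cong:
  assumes f: "locally_integrable f" and fg: "AE x in half_line. f x = g x"
  shows "locally_integrable g"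
  unfolding locally_integrable_def
proof (intro allI impI)
  fix K :: "real set" assume K: "compact K \<and> K \<subseteq> {0<..}"
  have "AE x in lebesgue. 0 < x \<longrightarrow> f x = g x" using fg by (simp add: AE_half_line)
  then obtain N where N: "N \<in> null_sets lebesgue" "{x. \<not> (0 < x \<longrightarrow> f x = g x)} \<subseteq> N"
    by (auto simp: eventually_ae_filter)
  show "g absolutely_integrable_on K"
  proof (rule absolutely_integrable_spike[where f=f and S=N])
    show "f absolutely_integrable_on K" using f K by (simp add: locally_integrable_def)
    show "negligible N" using N(1) by (simp add: negligible_iff_null_sets)
    show "g x = f x" if "x \<in> K - N" for x using that N(2) K by auto
  qed
qed

lemma pairing_cong:
  assumes "locally_integrable f" "AE x in half_line. f x = g x" "test_function \<eta>"
  shows "(LINT x|half_line. f x * \<eta> x) = (LINT x|half_line. g x * \<eta> x)"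
  using test_function_pairing_integrable[OF assms(1,3)]
    test_function_pairing_integrable[OF locally_integrable_cong[OF assms(1,2)] assms(3)] assms(2)
  by (intro integral_cong_AE borel_measurable_integrable) (auto elim: eventually_mono)

lemma has_gen_deriv_cong:
  assumes h: "has_gen_deriv n f g" and f: "AE x in half_line. f x = f' x" and g: "AE x in half_line. g x = g' x"
  shows "has_gen_deriv n f' g'"
  unfolding has_gen_deriv_iff
proof (intro conjI allI impI)
  have l: "locally_integrable f" "locally_integrable g" using h by (auto simp: has_gen_deriv_iff)
  then show "locally_integrable f'" "locally_integrable g'"
    using f g by (auto intro: locally_integrable_cong)
  fix \<eta> assume e: "test_function \<eta>"
  show "(LINT x|half_line. f' x * (deriv ^^ n) \<eta> x) = (- 1) ^ n * (LINT x|half_line. g' x * \<eta> x)"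
    using h e unfolding has_gen_deriv_iff
    by (simp only: pairing_cong[OF l(1) f test_function_deriv_iterate[OF e], symmetric] pairing_cong[OF l(2) g e, symmetric])
qed

lemma has_gen_deriv_unique:
  assumes "has_gen_deriv n f g" "has_gen_deriv n f g'"
  shows "AE x in half_line. g x = g' x"
proof -
  have l: "locally_integrable g" "locally_integrable g'" using assms by (auto simp: has_gen_deriv_iff)
  have "AE x in half_line. g x - g' x = 0"
  proof (rule fundamental_lemma[OF locally_integrable_diff[OF l]])
    fix \<eta> assume e: "test_function \<eta>"
    have "(LINT x|half_line. (g x - g' x) * \<eta> x) = (LINT x|half_line. g x * \<eta> x) - (LINT x|half_line. g' x * \<eta> x)"
      using test_function_pairing_integrable[OF l(1) e] test_function_pairing_integrable[OF l(2) e]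
      by (simp add: left_diff_distrib)
    moreover have "(-1) ^ n * (LINT x|half_line. g x * \<eta> x) = (-1) ^ n * (LINT x|half_line. g' x * \<eta> x)"
      using assms e by (simp add: has_gen_deriv_iff)
    then have "(LINT x|half_line. g x * \<eta> x) = (LINT x|half_line. g' x * \<eta> x)"
      by simp
    ultimately show "(LINT x|half_line. (g x - g' x) * \<eta> x) = 0" by simp
  qed
  then show ?thesis by (auto elim: eventually_mono)
qed

text \<open>Neutralizes the choice in \<open>gen_deriv\<close>: any derivative found explicitly may
  replace it under an integral.\<close>

lemma gen_deriv_eqI:
  assumes "has_gen_deriv n f g" shows "gen_differentiable n f" "AE x in half_line. gen_deriv n f x = g x"
proof -
  show "gen_differentiable n f" using assms by (auto simp: gen_differentiable_def)
  have "has_gen_deriv n f (gen_deriv n f)"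
    using someI[of "has_gen_deriv n f", OF assms] by (simp add: gen_deriv_def)
  then show "AE x in half_line. gen_deriv n f x = g x"
    using assms by (rule has_gen_deriv_unique)
qed

lemma gen_differentiableD: "gen_differentiable n f \<Longrightarrow> has_gen_deriv n f (gen_deriv n f)"
  using someI_ex[of "has_gen_deriv n f"] by (simp add: gen_differentiable_def gen_deriv_def)

section \<open>Functions with vanishing generalized derivative are polynomials\<close>

lemma continuous_on_poly: "continuous_on S (poly (p :: real poly))"
  by (rule continuous_intros)+

lemma chain_poly: "chain n (\<lambda>j. poly ((pderiv ^^ j) (p :: real poly)))"
  unfolding chain_def
  by (auto intro!: L1_0_continuous continuous_on_poly primitive_DERIV)

lemma pderiv_iterate_eq_0: "degree p < n \<Longrightarrow> (pderiv ^^ n) (p :: real poly) = 0"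
proof (induction n arbitrary: p)
  case (Suc n)
  show ?case
  proof (cases "degree p = 0")
    case True
    then have "pderiv p = 0" by (simp add: pderiv_eq_0_iff)
    moreover have "(pderiv ^^ n) (0 :: real poly) = 0" by (induction n) auto
    ultimately show ?thesis by (simp add: funpow_Suc_right del: funpow.simps)
  next
    case False
    then have "degree (pderiv p) < n" using Suc.prems by (simp add: degree_pderiv)
    then show ?thesis using Suc.IH by (simp add: funpow_Suc_right del: funpow.simps)
  qed
qed simp

lemma pderiv_iterate_monom: "(pderiv ^^ n) (monom c n) = [:fact n * c :: real:]"
proof (induction n arbitrary: c)
  case (Suc n)
  have "(pderiv ^^ Suc n) (monom c (Suc n)) = (pderiv ^^ n) (monom (of_nat (Suc n) * c) n)"
    by (simp add: funpow_Suc_right pderiv_monom del: funpow.simps)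
  then show ?case using Suc by (simp add: algebra_simps)
qed (simp add: monom_0)

text \<open>The integral of \<open>\<eta>\<close> from 0 is eventually the constant
  \<open>LINT x|half_line. \<eta> x\<close>, and this is the only obstacle to compact support.
  Subtracting that multiple of a fixed bump of integral 1 on (1,2) removes it.\<close>

lemma test_function_antideriv:
  assumes e: "test_function \<eta>"
  obtains \<zeta> where "test_function \<zeta>"
    "deriv \<zeta> = (\<lambda>x. \<eta> x + (- (LINT x|half_line. \<eta> x)) * (bump (x - 1) / integral {-1..1} bump))"
proof -
  obtain a b where ab: "0 < a" "a < b" "smooth \<eta>" "\<And>x. \<eta> x \<noteq> 0 \<Longrightarrow> a \<le> x \<and> x \<le> b"
    using e by (rule test_functionE) (rule that)
  define c where "c = (LINT x|half_line. \<eta> x)"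
  have c_eq: "c = integral {0..b} \<eta>"
    unfolding c_def using pairing_Icc[of "\<lambda>_. 1", OF L1_0_continuous e ab(1,4)] by simp
  have int: "\<eta> integrable_on {s..t}" for s t
    by (rule test_function_integrable[OF e])
  let ?E = "\<lambda>x. integral {0..x} \<eta>"
  have E0: "?E x = 0" if "x < a" for x
  proof -
    have "?E x = integral {0..x} (\<lambda>_. 0)"
      using that ab(4) by (intro integral_cong) force
    then show ?thesis by simp
  qed
  have Eb: "?E x = c" if "b \<le> x" for x
  proof -
    have "?E x = integral {0..b} \<eta> + integral {b..x} \<eta>"
      using that ab by (intro Henstock_Kurzweil_Integration.integral_combine[symmetric] int) auto
    also have "integral {b..x} \<eta> = integral {b..x} (\<lambda>t. if t = b then \<eta> b else 0)"
      using ab(4) by (intro integral_cong) force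
    also have "\<dots> = integral {b..x} (\<lambda>t. 0)"
      by (rule integral_spike[of "{b}"]) auto
    finally show ?thesis using c_eq by simp
  qed
  have Ed: "(?E has_field_derivative \<eta> x) (at x)" for x
  proof (cases "x < a")
    case True
    have "((\<lambda>_. 0) has_field_derivative (0::real)) (at x)" by simp
    then have "(?E has_field_derivative 0) (at x)"
      by (rule has_field_derivative_transform_within_open[where S="{..<a}"]) (use True E0 in auto)
    moreover have "\<eta> x = 0" using ab(4)[of x] True by auto
    ultimately show ?thesis by simp
  next
    case False
    have "(?E has_real_derivative \<eta> x) (at x within {0..x+1})"
      using False ab(1) by (intro integral_has_real_derivative smooth_continuous_on ab(3)) auto
    moreover have "at x within {0..x+1} = at x"
      using False ab(1) by (intro at_within_interior) auto
    ultimately show ?thesis by simp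
  qed
  \<comment> \<open>The shifted step is the antiderivative of the normalized bump on (1,2); both
    terms are constant and cancel from \<open>max b 2\<close> on.\<close>
  define \<zeta> where "\<zeta> x = ?E x + (- c) * bump_step (x - 1)" for x
  have sh: "smooth (\<lambda>x. bump_step (x - 1))" 
    using smooth_affine[OF smooth_bump_step, of 1 "-1"] by simp
  have "smooth \<zeta>"
    unfolding \<zeta>_def[abs_def] by (rule iterated_deriv_linear(2)[OF smooth_antiderivI[OF Ed ab(3)] sh])
  moreover have "min a 1 \<le> x \<and> x \<le> max b 2" if "\<zeta> x \<noteq> 0" for x
  proof (rule ccontr)
    assume "\<not> (min a 1 \<le> x \<and> x \<le> max b 2)"
    then have "x < a \<and> x < 1 \<or> b \<le> x \<and> 2 \<le> x" by auto
    then have "\<zeta> x = 0" using E0[of x] Eb[of x] by (auto simp: \<zeta>_def bump_step_left bump_step_right)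
    with that show False by simp
  qed
  ultimately have "test_function \<zeta>" using ab(1) by (intro test_functionI[of \<zeta> "min a 1" "max b 2"]) auto
  moreover have "(\<zeta> has_field_derivative \<eta> x + (- c) * (bump (x - 1) / integral {-1..1} bump)) (at x)" for x
  proof -
    have "((\<lambda>x. bump_step (x - 1)) has_field_derivative (bump (x - 1) / integral {-1..1} bump * 1)) (at x)"
      by (rule DERIV_chain2[OF bump_step_deriv]) (auto intro!: derivative_eq_intros)
    then show ?thesis
      unfolding \<zeta>_def[abs_def] by (intro DERIV_add DERIV_cmult Ed) simp
  qed
  then have "deriv \<zeta> = (\<lambda>x. \<eta> x + (- c) * (bump (x - 1) / integral {-1..1} bump))"
    using DERIV_imp_deriv by blast
  ultimately show thesis using that c_def by blast
qed

text \<open>The argument of du Bois-Reymond, by induction on n. The degree bound is stated through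
  coefficients so that n = 0 forces the zero polynomial.\<close>

lemma gen_deriv_zero_imp_poly:
  assumes "locally_integrable d"
    and "\<And>\<eta>. test_function \<eta> \<Longrightarrow> (LINT x|half_line. d x * (deriv ^^ n) \<eta> x) = 0"
  shows "\<exists>p. (\<forall>i\<ge>n. coeff p i = 0) \<and> (AE x in half_line. d x = poly p x)"
  using assms
proof (induction n arbitrary: d)
  case 0
  then have "AE x in half_line. d x = 0" by (intro fundamental_lemma) auto
  then show ?case by (intro exI[of _ 0]) simp
next
  case (Suc n)
  let ?\<psi> = "\<lambda>x. bump (x - 1) / integral {-1..1} bump"
  have "smooth (\<lambda>x. 0 + (1 / integral {-1..1} bump) * bump (1 * x + (-1)))"
    by (rule iterated_deriv_linear(2)[OF smooth_const smooth_affine[OF smooth_bump]])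
  then have \<psi>: "test_function ?\<psi>"
    by (intro test_functionI[of _ 1 2]) (auto intro: ccontr simp: bump_zero)
  have s\<psi>: "smooth ?\<psi>" using \<psi> by (auto elim: test_functionE)
  define C where "C = (LINT x|half_line. d x * (deriv ^^ n) ?\<psi> x)"
  \<comment> \<open>The functional on the left kills derivatives of test functions. Every
    \<open>\<eta>\<close> differs from such a derivative by its integral times the fixed bump, so
    the functional is \<open>C\<close> times the integral.\<close>
  have dC: "(LINT x|half_line. d x * (deriv ^^ n) \<eta> x) = C * (LINT x|half_line. \<eta> x)"
    if e: "test_function \<eta>" for \<eta>
  proof -
    define c where "c = (LINT x|half_line. \<eta> x)"
    obtain \<zeta> where \<zeta>: "test_function \<zeta>" "deriv \<zeta> = (\<lambda>x. \<eta> x + (- c) * ?\<psi> x)"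
      using test_function_antideriv[OF e] unfolding c_def by blast
    have se: "smooth \<eta>" using e by (auto elim: test_functionE)
    have "0 = (LINT x|half_line. d x * (deriv ^^ n) (deriv \<zeta>) x)"
      using Suc.prems(2)[OF \<zeta>(1)] by (simp add: funpow_Suc_right del: funpow.simps)
    also have "\<dots> = (LINT x|half_line. d x * (deriv ^^ n) \<eta> x + (- c) * (d x * (deriv ^^ n) ?\<psi> x))"
      unfolding \<zeta>(2) iterated_deriv_linear(1)[OF se s\<psi>] by (simp add: algebra_simps)
    also have "\<dots> = (LINT x|half_line. d x * (deriv ^^ n) \<eta> x) + (- c) * C"
      unfolding C_def
      by (subst Bochner_Integration.integral_add)
         (auto intro!: test_function_pairing_integrable Suc.prems(1) test_function_deriv_iterate e \<psi>)
    finally show ?thesis by (simp add: c_def)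
  qed
  \<comment> \<open>The derivative of order n of this monomial is the constant
    \<open>(-1) ^ n * C\<close>. The sign cancels the one from n partial integrations, so
    \<open>q\<close> induces the same functional as \<open>d\<close>, and \<open>d - q\<close> falls
    under the induction hypothesis.\<close>
  define q where "q = monom ((-1) ^ n * C / fact n) n"
  have lq: "locally_integrable (poly q)"
    by (intro L1_0_locally_integrable L1_0_continuous continuous_on_poly)
  have q: "(LINT x|half_line. poly q x * (deriv ^^ n) \<eta> x) = C * (LINT x|half_line. \<eta> x)"
    if e: "test_function \<eta>" for \<eta>
    using chain_pairing[OF chain_poly[of n q] e]
    by (simp add: q_def pderiv_iterate_monom flip: power_mult_distrib)
  have "\<exists>p. (\<forall>i\<ge>n. coeff p i = 0) \<and> (AE x in half_line. d x - poly q x = poly p x)"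
  proof (rule Suc.IH)
    show "locally_integrable (\<lambda>x. d x - poly q x)"
      by (rule locally_integrable_diff[OF Suc.prems(1) lq])
    fix \<eta> assume e: "test_function \<eta>"
    have "(LINT x|half_line. (d x - poly q x) * (deriv ^^ n) \<eta> x) =
        (LINT x|half_line. d x * (deriv ^^ n) \<eta> x) - (LINT x|half_line. poly q x * (deriv ^^ n) \<eta> x)"
      unfolding left_diff_distrib
      by (intro Bochner_Integration.integral_diff test_function_pairing_integrable Suc.prems(1) lq test_function_deriv_iterate e)
    then show "(LINT x|half_line. (d x - poly q x) * (deriv ^^ n) \<eta> x) = 0"
      using dC[OF e] q[OF e] by simp
  qed
  then obtain p where p: "\<forall>i\<ge>n. coeff p i = 0" "AE x in half_line. d x - poly q x = poly p x" by blast
  show ?case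
  proof (intro exI[of _ "p + q"] conjI)
    show "\<forall>i\<ge>Suc n. coeff (p + q) i = 0" using p(1) by (simp add: q_def)
    show "AE x in half_line. d x = poly (p + q) x" using p(2) by (auto elim: eventually_mono)
  qed
qed

lemma chain_add:
  "chain n F \<Longrightarrow> chain n H \<Longrightarrow> chain n (\<lambda>j x. F j x + H j x)"
  by (simp add: chain_def L1_0_add primitive_add)

text \<open>\<open>F 0\<close> has the same generalized derivative as \<open>f\<close>, so the
  difference pairs to 0 with every n-th derivative of a test function and must be a
  polynomial.\<close>

theorem has_gen_deriv_representation:
  assumes h: "has_gen_deriv n f g" and g: "L1_0 g" and F: "chain n F" "F n = g"
  obtains p :: "real poly" where "\<forall>i\<ge>n. coeff p i = 0"
    "AE x in half_line. f x = F 0 x + poly p x"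
proof -
  have lf: "locally_integrable f" using h by (simp add: has_gen_deriv_iff)
  have F0: "has_gen_deriv n (F 0) g" using chain_has_gen_deriv[OF F(1)] F(2) by simp
  then have lF: "locally_integrable (F 0)" by (simp add: has_gen_deriv_iff)
  have "\<exists>p. (\<forall>i\<ge>n. coeff p i = 0) \<and> (AE x in half_line. f x - F 0 x = poly p x)"
  proof (rule gen_deriv_zero_imp_poly[OF locally_integrable_diff[OF lf lF]])
    fix \<eta> assume e: "test_function \<eta>"
    have "(LINT x|half_line. (f x - F 0 x) * (deriv ^^ n) \<eta> x) =
        (LINT x|half_line. f x * (deriv ^^ n) \<eta> x) - (LINT x|half_line. F 0 x * (deriv ^^ n) \<eta> x)"
      unfolding left_diff_distrib
      by (intro Bochner_Integration.integral_diff test_function_pairing_integrable lf lF test_function_deriv_iterate e)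
    then show "(LINT x|half_line. (f x - F 0 x) * (deriv ^^ n) \<eta> x) = 0"
      using h F0 e by (simp add: has_gen_deriv_iff)
  qed
  then obtain p where p: "\<forall>i\<ge>n. coeff p i = 0" "AE x in half_line. f x - F 0 x = poly p x" by blast
  show thesis
    by (rule that[OF p(1)]) (use p(2) in \<open>auto elim!: eventually_mono\<close>)
qed

section \<open>The derivative of a product with an iterated integral\<close>

lemma pderiv_iterate_add: "(pderiv ^^ n) (p + q) = (pderiv ^^ n) p + (pderiv ^^ n) (q :: real poly)"
  by (induction n) (auto simp: pderiv_add)

lemma pderiv_iterate_smult: "(pderiv ^^ n) (smult c p) = smult c ((pderiv ^^ n) (p :: real poly))"
  by (induction n) (auto simp: pderiv_smult)

lemma pderiv_iterate_0: "(pderiv ^^ n) 0 = (0 :: real poly)"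
  by (induction n) auto

lemma pderiv_iterate_sum: "(pderiv ^^ n) (\<Sum>i\<in>I. p i) = (\<Sum>i\<in>I. (pderiv ^^ n) (p i :: real poly))"
  by (induction I rule: infinite_finite_induct) (auto simp: pderiv_iterate_add pderiv_iterate_0)

lemma pderiv_iterate_linear_power:
  "i \<le> n \<Longrightarrow> (pderiv ^^ i) ([:- t, 1:] ^ n) = smult (fact n / fact (n - i)) ([:- t, 1 :: real:] ^ (n - i))"
proof (induction i)
  case (Suc i)
  obtain k where k: "n - i = Suc k" "n - Suc i = k" using Suc.prems by (metis Suc_diff_Suc Suc_le_lessD)
  have "(pderiv ^^ Suc i) ([:- t, 1:] ^ n) = smult (fact n / fact (Suc k)) (pderiv ([:- t, 1:] ^ Suc k))"
    using Suc k by (simp add: pderiv_smult)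
  also have "pderiv ([:- t, 1:] ^ Suc k) = smult (real (Suc k)) ([:- t, 1:] ^ k)"
    by (subst pderiv_power_Suc) (simp add: pderiv_pCons)
  also have "smult (fact n / fact (Suc k)) (smult (real (Suc k)) ([:- t, 1:] ^ k)) = smult (fact n / fact k) ([:- t, 1:] ^ k)"
  proof -
    have "fact n / fact (Suc k) * real (Suc k) = (fact n / fact k :: real)"
      by (simp add: fact_Suc del: of_nat_Suc)
    then show ?thesis by (simp only: smult_smult)
  qed
  finally show ?case by (simp only: k(2))
qed simp

text \<open>The coefficient of \<open>x ^ k * t ^ (l - 1 - k)\<close> in the binomial expansion of
  \<open>(x - t) ^ (l - 1) / fact (l - 1)\<close>.\<close>

definition taylor_coeff :: "nat \<Rightarrow> nat \<Rightarrow> real" where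
  "taylor_coeff l k = (-1) ^ (l - 1 - k) * real ((l - 1) choose k) / fact (l - 1)"

lemma taylor_coeff_nonzero: "k < l \<Longrightarrow> taylor_coeff l k \<noteq> 0"
  by (simp add: taylor_coeff_def)

text \<open>The monomials combine to the kernel \<open>(y - t)\<^sup>l\<^sup>-\<^sup>1 / (l - 1)!\<close> of iterated integration,
  differentiated \<open>i\<close> times in \<open>y\<close> and evaluated on the diagonal.\<close>

lemma taylor_coeff_sum:
  assumes "i < l"
  shows "(\<Sum>k<l. taylor_coeff l k * (poly ((pderiv ^^ i) (monom 1 k)) t * t ^ (l - 1 - k))) = (if i = l - 1 then 1 else 0)"
proof -
  define n where "n = l - 1"
  have l: "l = Suc n" using assms by (simp add: n_def)
  have mp: "monom 1 1 ^ k = (monom 1 k :: real poly)" for k by (simp add: monom_power)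
  have "[:- t, 1:] = monom 1 1 + [:- t:]" by (simp add: monom_altdef)
  then have "[:- t, 1:] ^ n = (\<Sum>k\<le>n. of_nat (n choose k) * monom 1 1 ^ k * [:- t:] ^ (n - k))"
    by (simp only: binomial_ring)
  also have "\<dots> = (\<Sum>k\<le>n. smult (real (n choose k) * (- t) ^ (n - k)) (monom 1 k))"
    by (intro sum.cong refl) (simp only: mp, simp add: of_nat_poly poly_const_pow mult.commute)
  finally have e: "[:- t, 1:] ^ n = (\<Sum>k\<le>n. smult (real (n choose k) * (- t) ^ (n - k)) (monom 1 k))" .
  have "(\<Sum>k<l. taylor_coeff l k * (poly ((pderiv ^^ i) (monom 1 k)) t * t ^ (l - 1 - k)))
      = (\<Sum>k\<le>n. (real (n choose k) * (- t) ^ (n - k)) * poly ((pderiv ^^ i) (monom 1 k)) t / fact n)"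
    unfolding l lessThan_Suc_atMost
    by (intro sum.cong refl) (simp add: taylor_coeff_def power_minus[of t] mult_ac)
  also have "\<dots> = poly ((pderiv ^^ i) ([:- t, 1:] ^ n)) t / fact n"
    by (simp add: e pderiv_iterate_sum pderiv_iterate_smult poly_sum sum_divide_distrib)
  also have "\<dots> = (if i = n then 1 else 0)"
    using assms l by (subst pderiv_iterate_linear_power) (auto simp: power_0_left)
  finally show ?thesis by (simp add: l)
qed

definition moment :: "(real \<Rightarrow> real) \<Rightarrow> nat \<Rightarrow> real \<Rightarrow> real" where
  "moment g q x = integral {0..x} (\<lambda>t. t ^ q * g t)"

text \<open>For i < l, the i-th derivative of the l-fold integral of \<open>g\<close> from 0, with
  Cauchy's kernel already expanded so that x and t are separated. The value \<open>g\<close> at i =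
  l closes the chain.\<close>

definition iterated_integral :: "nat \<Rightarrow> (real \<Rightarrow> real) \<Rightarrow> nat \<Rightarrow> real \<Rightarrow> real" where
  "iterated_integral l g i x =
    (if i < l then \<Sum>k<l. taylor_coeff l k * (poly ((pderiv ^^ i) (monom 1 k)) x * moment g (l - 1 - k) x) else g x)"

lemma moment_primitive: "L1_0 g \<Longrightarrow> primitive (moment g q) (\<lambda>t. t ^ q * g t)"
  unfolding moment_def[abs_def]
  by (intro primitive_integral L1_0_continuous_mult continuous_intros)

text \<open>The product rule yields two sums. One is the next expression of the same form; the other
  is \<open>g\<close> times the i-th derivative of the kernel on the diagonal, which vanishes except
  for i = l - 1, where it is 1.\<close>

lemma iterated_integral_chain:
  assumes g: "L1_0 g"
  shows "chain l (iterated_integral l g)"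
proof -
  have "primitive (iterated_integral l g i) (iterated_integral l g (Suc i))" if i: "i < l" for i
  proof -
    have pp: "primitive (poly ((pderiv ^^ i) (monom 1 k))) (poly ((pderiv ^^ Suc i) (monom 1 k)))" for k
      using chain_poly[of "Suc i" "monom 1 k"] by (auto simp: chain_def)
    have "primitive (\<lambda>x. \<Sum>k<l. taylor_coeff l k * (poly ((pderiv ^^ i) (monom 1 k)) x * moment g (l - 1 - k) x))
      (\<lambda>x. \<Sum>k<l. taylor_coeff l k * (poly ((pderiv ^^ Suc i) (monom 1 k)) x * moment g (l - 1 - k) x +
          poly ((pderiv ^^ i) (monom 1 k)) x * (x ^ (l - 1 - k) * g x)))"
      by (intro primitive_sum primitive_cmult primitive_mult pp moment_primitive g)
    moreover have "(\<Sum>k<l. taylor_coeff l k * (poly ((pderiv ^^ Suc i) (monom 1 k)) x * moment g (l - 1 - k) x +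
          poly ((pderiv ^^ i) (monom 1 k)) x * (x ^ (l - 1 - k) * g x))) = iterated_integral l g (Suc i) x" for x
    proof -
      have "(\<Sum>k<l. taylor_coeff l k * (poly ((pderiv ^^ Suc i) (monom 1 k)) x * moment g (l - 1 - k) x +
          poly ((pderiv ^^ i) (monom 1 k)) x * (x ^ (l - 1 - k) * g x)))
        = (\<Sum>k<l. taylor_coeff l k * (poly ((pderiv ^^ Suc i) (monom 1 k)) x * moment g (l - 1 - k) x))
         + (\<Sum>k<l. taylor_coeff l k * (poly ((pderiv ^^ i) (monom 1 k)) x * x ^ (l - 1 - k))) * g x"
        by (simp only: sum_distrib_right sum.distrib[symmetric]) (simp only: distrib_left mult.assoc)
      also have "\<dots> = iterated_integral l g (Suc i) x"
      proof (cases "Suc i < l")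
        case True
        then have "i \<noteq> l - 1" by simp
        then show ?thesis unfolding taylor_coeff_sum[OF i] using True
          by (simp add: iterated_integral_def del: funpow.simps)
      next
        case False
        \<comment> \<open>At the last step the roles switch: all monomials of degree below l are
          annihilated, and only the diagonal term \<open>g\<close> survives.\<close>
        then have si: "Suc i = l" using i by simp
        have "(pderiv ^^ Suc i) (monom 1 k) = (0 :: real poly)" if "k < l" for k
          using that si by (intro pderiv_iterate_eq_0) (simp add: degree_monom_eq)
        then show ?thesis unfolding taylor_coeff_sum[OF i] using si
          by (auto simp: iterated_integral_def simp del: funpow.simps)
      qed
      finally show ?thesis .
    qed
    ultimately show ?thesis
      using i by (simp add: iterated_integral_def[abs_def])
  qed
  then show ?thesis using g by (simp add: chain_def iterated_integral_def[abs_def])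
qed

lemma chain_subset: "chain l F \<Longrightarrow> m \<le> l \<Longrightarrow> chain m F"
  using chain_L1_0[of l F m] by (auto simp: chain_def)

text \<open>For a chain \<open>A\<close> of derivatives of \<open>\<phi>\<close>, this is the derivative of order \<open>m\<close> of \<open>\<phi> x\<^sup>k\<close>.\<close>

definition monom_deriv :: "nat \<Rightarrow> (nat \<Rightarrow> real \<Rightarrow> real) \<Rightarrow> nat \<Rightarrow> real \<Rightarrow> real" where
  "monom_deriv m A k x = (\<Sum>i\<le>m. real (m choose i) * (A (m - i) x * poly ((pderiv ^^ i) (monom 1 k)) x))"

lemma monom_deriv_has_gen_deriv:
  assumes "0 < m" "chain m A"
  shows "has_gen_deriv m (\<lambda>x. A 0 x * x ^ k) (monom_deriv m A k)"
  using chain_has_gen_deriv[OF chain_mult[OF assms chain_poly[of m "monom 1 k"]]]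
  by (simp add: monom_deriv_def[abs_def] poly_monom)

text \<open>The Leibniz rule for \<open>A\<close> against the iterated integral. For fixed k,
  summing over the order i first reassembles the Leibniz formula for the product with a monomial,
  while the moment stays outside as a factor that is never differentiated.\<close>

lemma product_has_gen_deriv:
  assumes m: "0 < m" "m \<le> l" and A: "chain m A" and g: "L1_0 g"
  shows "has_gen_deriv m (\<lambda>x. A 0 x * iterated_integral l g 0 x)
    (\<lambda>x. (\<Sum>k<l. taylor_coeff l k * (monom_deriv m A k x * moment g (l - 1 - k) x)) +
         (if m = l then A 0 x * g x else 0))"
proof -
  have eq: "(\<Sum>i\<le>m. real (m choose i) * (A (m - i) x * iterated_integral l g i x)) =
      (\<Sum>k<l. taylor_coeff l k * (monom_deriv m A k x * moment g (l - 1 - k) x)) +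
         (if m = l then A 0 x * g x else 0)" for x
  proof -
    \<comment> \<open>The moment formula also for i = l, where it is 0. This isolates the
      exceptional summand: i \<le> m \<le> l reaches l only if m = l.\<close>
    define h where "h i = (\<Sum>k<l. taylor_coeff l k * (poly ((pderiv ^^ i) (monom 1 k)) x * moment g (l - 1 - k) x))" for i
    have hl: "h l = 0"
      unfolding h_def by (intro sum.neutral ballI) (simp add: pderiv_iterate_eq_0 degree_monom_eq)
    have "iterated_integral l g i x = h i + (if i = l then g x else 0)" if "i \<le> m" for i
    proof (cases "i < l")
      case False
      then have "i = l" using that m by simp
      then show ?thesis using hl by (simp add: iterated_integral_def)
    qed (simp add: iterated_integral_def h_def)
    then have "(\<Sum>i\<le>m. real (m choose i) * (A (m - i) x * iterated_integral l g i x)) =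
       (\<Sum>i\<le>m. real (m choose i) * (A (m - i) x * h i) + (if i = l then A 0 x * g x else 0))"
      using m by (intro sum.cong refl) (auto simp: distrib_left)
    also have "\<dots> = (\<Sum>i\<le>m. real (m choose i) * (A (m - i) x * h i)) + (if m = l then A 0 x * g x else 0)"
      using m by (auto simp: sum.distrib)
    also have "(\<Sum>i\<le>m. real (m choose i) * (A (m - i) x * h i)) =
       (\<Sum>k<l. taylor_coeff l k * (monom_deriv m A k x * moment g (l - 1 - k) x))"
      unfolding h_def monom_deriv_def sum_distrib_left sum_distrib_right
      by (subst sum.swap) (simp add: mult_ac)
    finally show ?thesis .
  qed
  have "has_gen_deriv m (\<lambda>x. A 0 x * iterated_integral l g 0 x)
     (\<lambda>x. \<Sum>i\<le>m. real (m choose i) * (A (m - i) x * iterated_integral l g i x))"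
    using chain_has_gen_deriv[OF chain_mult[OF m(1) A chain_subset[OF iterated_integral_chain[OF g, of l] m(2)]]]
    by simp
  then show ?thesis by (simp only: eq)
qed

lemma has_gen_deriv_add:
  assumes "has_gen_deriv n f g" "has_gen_deriv n f' g'"
  shows "has_gen_deriv n (\<lambda>x. f x + f' x) (\<lambda>x. g x + g' x)"
proof -
  have l: "locally_integrable f" "locally_integrable f'" "locally_integrable g" "locally_integrable g'"
    using assms by (auto simp: has_gen_deriv_iff)
  have a: "locally_integrable (\<lambda>x. h x + h' x)" if "locally_integrable h" "locally_integrable h'" for h h'
    using that unfolding locally_integrable_def using set_integral_add(1) by blast
  have p: "(LINT x|half_line. (h x + h' x) * \<eta> x) = (LINT x|half_line. h x * \<eta> x) + (LINT x|half_line. h' x * \<eta> x)"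
    if "locally_integrable h" "locally_integrable h'" "test_function \<eta>" for h h' \<eta>
    unfolding distrib_right
    by (intro Bochner_Integration.integral_add test_function_pairing_integrable that)
  show ?thesis
    unfolding has_gen_deriv_iff
    using assms by (simp add: a l p test_function_deriv_iterate has_gen_deriv_iff distrib_left)
qed

lemma has_gen_deriv_cmult:
  assumes "has_gen_deriv n f g"
  shows "has_gen_deriv n (\<lambda>x. c * f x) (\<lambda>x. c * g x)"
  using assms by (auto simp: has_gen_deriv_iff locally_integrable_def mult.assoc)

lemma has_gen_deriv_zero: "has_gen_deriv n (\<lambda>_. 0) (\<lambda>_. 0)"
  by (simp add: has_gen_deriv_iff locally_integrable_def)

lemma has_gen_deriv_sum:
  "(\<And>i. i \<in> I \<Longrightarrow> has_gen_deriv n (f i) (g i)) \<Longrightarrow> has_gen_deriv n (\<lambda>x. \<Sum>i\<in>I. f i x) (\<lambda>x. \<Sum>i\<in>I. g i x)"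
  by (induction I rule: infinite_finite_induct) (auto intro: has_gen_deriv_add has_gen_deriv_zero)

text \<open>The polynomial left over by the representation is itself the start of a chain and can be
  added to the iterated integral.\<close>

lemma has_gen_deriv_representation':
  assumes h: "has_gen_deriv n f g" and g: "L1_0 g"
  obtains A where "chain n A" "AE x in half_line. f x = A 0 x"
proof -
  note F = iterated_integral_chain[OF g, of n]
  have Fn: "iterated_integral n g n = g" by (auto simp: iterated_integral_def)
  obtain p where p: "AE x in half_line. f x = iterated_integral n g 0 x + poly p x"
    using has_gen_deriv_representation[OF h g F Fn] by blast
  show thesis
    by (rule that[OF chain_add[OF F chain_poly[of n p]]]) (use p in simp)
qed

section \<open>Integrability up to 0 and membership in the Sobolev spaces\<close>

lemma L1_0I:
  assumes [measurable]: "h \<in> borel_measurable half_line"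
    and fin: "\<And>r. (\<integral>\<^sup>+x. ennreal \<bar>h x\<bar> * indicator {..r} x \<partial>half_line) < \<infinity>"
  shows "L1_0 h"
  unfolding L1_0_def
proof
  fix r :: real
  have "integrable half_line (\<lambda>x. indicator {..r} x *\<^sub>R h x)"
  proof (rule integrableI_bounded)
    have "(\<integral>\<^sup>+x. ennreal (norm (indicator {..r} x *\<^sub>R h x)) \<partial>half_line) = (\<integral>\<^sup>+x. ennreal \<bar>h x\<bar> * indicator {..r} x \<partial>half_line)"
      by (intro nn_integral_cong) (auto simp: indicator_def)
    with fin[of r] show "(\<integral>\<^sup>+x. ennreal (norm (indicator {..r} x *\<^sub>R h x)) \<partial>half_line) < \<infinity>" by simp
  qed measurable
  then have "integrable lebesgue (\<lambda>x. indicator {0<..} x *\<^sub>R (indicator {..r} x *\<^sub>R h x))"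
    by (simp add: integrable_restrict_space)
  also have "(\<lambda>x. indicator {0<..} x *\<^sub>R (indicator {..r} x *\<^sub>R h x)) = (\<lambda>x. indicator {0<..r} x *\<^sub>R h x)"
    by (auto simp: indicator_def)
  finally have "h absolutely_integrable_on {0<..r}" by (simp add: set_integrable_def)
  moreover have "negligible {x \<in> {0..r} - {0<..r}. h x \<noteq> 0}" "negligible {x \<in> {0<..r} - {0..r}. h x \<noteq> 0}"
    by (rule negligible_subset[of "{0}"], auto)+
  ultimately show "h absolutely_integrable_on {0..r}"
    using absolutely_integrable_spike_set_eq by blast
qed

text \<open>The condition on \<open>1 / w\<close> makes weighted square integrability imply integrability up to \<open>0\<close>.\<close>

definition near0_weight :: "(real \<Rightarrow> real) \<Rightarrow> bool" where
  "near0_weight w \<longleftrightarrow> weight w \<and> (AE x in half_line. 0 < w x) \<and>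
     (\<forall>r>0. (\<integral>\<^sup>+x. ennreal (1 / (w x)\<^sup>2) * indicator {..r} x \<partial>half_line) < \<infinity>)"

text \<open>Only finiteness is at stake, so the pointwise bound
  \<open>\<bar>h\<bar> \<le> (h * w)\<^sup>2 + 1 / w\<^sup>2\<close> can replace the inequality of
  Cauchy and Schwarz.\<close>

lemma near0_weight_L1_0:
  assumes w: "near0_weight w" and [measurable]: "h \<in> borel_measurable half_line"
    and fin: "(\<integral>\<^sup>+x. ennreal ((h x * w x)\<^sup>2) \<partial>half_line) < \<infinity>"
  shows "L1_0 h"
proof (rule L1_0I)
  fix r :: real
  have [measurable]: "w \<in> borel_measurable half_line" and pos: "AE x in half_line. 0 < w x"
    using w by (auto simp: near0_weight_def weight_def)
  \<comment> \<open>\<open>near0_weight\<close> speaks of positive end points only, whereas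
    \<open>r\<close> is arbitrary here.\<close>
  let ?s = "max r 1"
  have le: "ennreal \<bar>h x\<bar> * indicator {..?s} x \<le>
     ennreal ((h x * w x)\<^sup>2) + ennreal (1 / (w x)\<^sup>2) * indicator {..?s} x" if "0 < w x" for x
  proof (cases "x \<le> ?s")
    case True
    have "2 * ((h x * w x) * (1 / w x)) \<le> (h x * w x)\<^sup>2 + (1 / w x)\<^sup>2"
      "2 * ((- (h x * w x)) * (1 / w x)) \<le> (- (h x * w x))\<^sup>2 + (1 / w x)\<^sup>2"
      using sum_squares_bound[of "h x * w x" "1 / w x"] sum_squares_bound[of "- (h x * w x)" "1 / w x"]
      by (simp_all only: mult.assoc)
    then have "\<bar>h x\<bar> \<le> (h x * w x)\<^sup>2 + 1 / (w x)\<^sup>2"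
      using that by (simp add: power_divide abs_if)
    then show ?thesis using True by (simp flip: ennreal_plus)
  next
    case False
    then show ?thesis by simp
  qed
  have "(\<integral>\<^sup>+x. ennreal \<bar>h x\<bar> * indicator {..?s} x \<partial>half_line) \<le>
     (\<integral>\<^sup>+x. ennreal ((h x * w x)\<^sup>2) + ennreal (1 / (w x)\<^sup>2) * indicator {..?s} x \<partial>half_line)"
    using pos le by (intro nn_integral_mono_AE) (auto elim: eventually_mono)
  also have "\<dots> = (\<integral>\<^sup>+x. ennreal ((h x * w x)\<^sup>2) \<partial>half_line) + (\<integral>\<^sup>+x. ennreal (1 / (w x)\<^sup>2) * indicator {..?s} x \<partial>half_line)"
    by (intro nn_integral_add) measurable
  also have "\<dots> < \<infinity>"
    using fin w by (auto simp: near0_weight_def)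
  finally show "(\<integral>\<^sup>+x. ennreal \<bar>h x\<bar> * indicator {..r} x \<partial>half_line) < \<infinity>"
    by (rule le_less_trans[rotated]) (auto intro!: nn_integral_mono simp: indicator_def)
qed measurable

lemma L2_norm_eq:
  "L2_norm S f < top \<longleftrightarrow> (\<integral>\<^sup>+x\<in>S. (f x)\<^sup>2 \<partial>lebesgue) < top"
  by (simp add: L2_norm_def Let_def less_top)

lemma L2_norm_square:
  "(L2_norm S f)\<^sup>2 = (\<integral>\<^sup>+x\<in>S. (f x)\<^sup>2 \<partial>lebesgue)"
proof (cases "(\<integral>\<^sup>+x\<in>S. (f x)\<^sup>2 \<partial>lebesgue) = top")
  case False
  then show ?thesis
    by (simp add: L2_norm_def Let_def power2_eq_square ennreal_mult[symmetric] ennreal_enn2real less_top[symmetric])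
qed (simp add: L2_norm_def Let_def power2_eq_square)

lemma set_nn_integral_half_line:
  "S \<subseteq> {0<..} \<Longrightarrow> (\<integral>\<^sup>+x\<in>S. f x \<partial>lebesgue) = (\<integral>\<^sup>+x. f x * indicator S x \<partial>half_line)"
  by (subst nn_integral_restrict_space) (auto intro!: nn_integral_cong simp: indicator_def)

text \<open>A representative continuous up to 0 is bounded on [0,1], so the unweighted part of the
  norm is finite and only the derivative counts.\<close>

lemma sobolev_space_iff:
  assumes h: "has_gen_deriv n f h" and F: "continuous_on {0..} F" "AE x in half_line. f x = F x"
  shows "f \<in> sobolev_space n w \<longleftrightarrow> (\<integral>\<^sup>+x. ennreal ((h x * w x)\<^sup>2) \<partial>half_line) < \<infinity>"
proof -
  have "bounded (F ` {0..1})"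
    using F(1) by (intro compact_imp_bounded compact_continuous_image) (auto elim: continuous_on_subset)
  then obtain B where B: "\<And>x. x \<in> {0..1} \<Longrightarrow> \<bar>F x\<bar> \<le> B" unfolding bounded_real by blast
  have "(\<integral>\<^sup>+x\<in>{0<..<1}. (ennreal \<bar>f x\<bar>)\<^sup>2 \<partial>lebesgue) \<le> (\<integral>\<^sup>+x. ennreal (B\<^sup>2) * indicator {0<..<1} x \<partial>half_line)"
  proof (subst set_nn_integral_half_line)
    show "(\<integral>\<^sup>+x. (ennreal \<bar>f x\<bar>)\<^sup>2 * indicator {0<..<1} x \<partial>half_line) \<le> (\<integral>\<^sup>+x. ennreal (B\<^sup>2) * indicator {0<..<1} x \<partial>half_line)"
    proof (rule nn_integral_mono_AE, use F(2) in eventually_elim)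
      case (elim x)
      show ?case
      proof (cases "x \<in> {0<..<1}")
        case True
        then have "\<bar>F x\<bar>\<^sup>2 \<le> B\<^sup>2" using B[of x] by (intro power_mono) auto
        then show ?thesis using True elim by (simp add: ennreal_power ennreal_leI)
      qed simp
    qed
  qed auto
  also have "\<dots> = ennreal (B\<^sup>2) * emeasure half_line {0<..<1}"
    by (rule nn_integral_cmult_indicator) (auto simp: sets_restrict_space_iff)
  also have "\<dots> < top"
    by (subst emeasure_restrict_space) (auto simp: ennreal_mult_less_top)
  finally have 1: "L2_norm {0<..<1} (\<lambda>x. ennreal \<bar>f x\<bar>) < top" by (simp add: L2_norm_eq)
  have "(\<integral>\<^sup>+x\<in>{0<..}. (ennreal \<bar>gen_deriv n f x * w x\<bar>)\<^sup>2 \<partial>lebesgue) = (\<integral>\<^sup>+x. ennreal ((h x * w x)\<^sup>2) \<partial>half_line)"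
  proof (subst set_nn_integral_half_line)
    show "(\<integral>\<^sup>+x. (ennreal \<bar>gen_deriv n f x * w x\<bar>)\<^sup>2 * indicator {0<..} x \<partial>half_line) = (\<integral>\<^sup>+x. ennreal ((h x * w x)\<^sup>2) \<partial>half_line)"
      using gen_deriv_eqI(2)[OF h] AE_space
      by (intro nn_integral_cong_AE, eventually_elim) (simp add: ennreal_power)
  qed simp
  then show ?thesis
    using 1 gen_deriv_eqI(1)[OF h] by (simp add: sobolev_space_def sobolev_norm_def L2_norm_eq)
qed

section \<open>A weighted Hardy inequality\<close>

lemma ennreal_two_mult_le_squares: "2 * (a * b) \<le> a\<^sup>2 + (b::ennreal)\<^sup>2"
proof (cases a)
  case a: (real x)
  show ?thesis
  proof (cases b)
    case b: (real y)
    have "ennreal (2 * (x * y)) \<le> ennreal (x\<^sup>2 + y\<^sup>2)"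
      using sum_squares_bound[of x y] by (intro ennreal_leI) (simp add: mult.assoc)
    then show ?thesis
      using a b by (simp add: ennreal_mult ennreal_power)
  qed (simp add: power2_eq_square)
qed (simp add: power2_eq_square)

lemma ennreal_le_of_square_le:
  assumes "x\<^sup>2 \<le> ennreal (c\<^sup>2)" "0 \<le> c" shows "x \<le> ennreal c"
proof (cases x)
  case (real r)
  then have "r\<^sup>2 \<le> c\<^sup>2" using assms by (simp add: ennreal_power)
  then have "r \<le> c" using assms(2) by (rule power2_le_imp_le)
  then show ?thesis using real by (simp add: ennreal_leI)
next
  case top
  then show ?thesis using assms by (simp add: power2_eq_square top_unique)
qed

text \<open>Integrate 2ab \<le> a^2 + b^2 over pairs (x,y), with a = f(x)g(y) and b = g(x)f(y). Both
  sides factor by pulling constants out of the inner integral, so no finiteness and no exchange of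
  integrals is involved.\<close>

lemma Cauchy_Schwarz_nn_integral:
  assumes [measurable]: "f \<in> borel_measurable M" "g \<in> borel_measurable M"
  shows "(\<integral>\<^sup>+x. f x * g x \<partial>M)\<^sup>2 \<le> (\<integral>\<^sup>+x. (f x)\<^sup>2 \<partial>M) * (\<integral>\<^sup>+x. (g x)\<^sup>2 \<partial>M)"
proof -
  let ?F = "\<integral>\<^sup>+x. (f x)\<^sup>2 \<partial>M" and ?G = "\<integral>\<^sup>+x. (g x)\<^sup>2 \<partial>M"
  have "2 * (\<integral>\<^sup>+x. f x * g x \<partial>M)\<^sup>2 = (\<integral>\<^sup>+x. \<integral>\<^sup>+y. 2 * ((f x * g y) * (f y * g x)) \<partial>M \<partial>M)"
  proof -
    have "(\<integral>\<^sup>+x. \<integral>\<^sup>+y. 2 * ((f x * g y) * (f y * g x)) \<partial>M \<partial>M) = (\<integral>\<^sup>+x. \<integral>\<^sup>+y. (2 * (f x * g x)) * (f y * g y) \<partial>M \<partial>M)"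
      by (simp only: mult_ac)
    also have "\<dots> = (\<integral>\<^sup>+x. (2 * (f x * g x)) * (\<integral>\<^sup>+y. f y * g y \<partial>M) \<partial>M)"
      by (intro nn_integral_cong nn_integral_cmult) measurable
    also have "\<dots> = (\<integral>\<^sup>+x. 2 * (f x * g x) \<partial>M) * (\<integral>\<^sup>+y. f y * g y \<partial>M)"
      by (rule nn_integral_multc) measurable
    also have "(\<integral>\<^sup>+x. 2 * (f x * g x) \<partial>M) = 2 * (\<integral>\<^sup>+x. f x * g x \<partial>M)"
      by (rule nn_integral_cmult) measurable
    also have "2 * (\<integral>\<^sup>+x. f x * g x \<partial>M) * (\<integral>\<^sup>+y. f y * g y \<partial>M) = 2 * (\<integral>\<^sup>+x. f x * g x \<partial>M)\<^sup>2"
      by (simp only: power2_eq_square mult.assoc)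
    finally show ?thesis by simp
  qed
  also have "\<dots> \<le> (\<integral>\<^sup>+x. \<integral>\<^sup>+y. (f x)\<^sup>2 * (g y)\<^sup>2 + (g x)\<^sup>2 * (f y)\<^sup>2 \<partial>M \<partial>M)"
    using ennreal_two_mult_le_squares[of "f _ * g _" "f _ * g _"]
    by (intro nn_integral_mono) (simp add: power_mult_distrib mult.commute)
  also have "\<dots> = ?F * ?G + ?G * ?F"
    by (simp add: nn_integral_add nn_integral_cmult nn_integral_multc)
  also have "\<dots> = 2 * (?F * ?G)"
    by (simp add: mult.commute mult_2)
  finally show ?thesis
    by (subst (asm) ennreal_mult_le_mult_iff) auto
qed

context sigma_finite_measure
begin

lemma nn_integral_swap:
  assumes "case_prod f \<in> borel_measurable (M \<Otimes>\<^sub>M M)"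
  shows "(\<integral>\<^sup>+x. \<integral>\<^sup>+y. f x y \<partial>M \<partial>M) = (\<integral>\<^sup>+y. \<integral>\<^sup>+x. f x y \<partial>M \<partial>M)"
proof -
  interpret P: pair_sigma_finite M M ..
  show ?thesis using P.Fubini'[OF assms] by simp
qed

text \<open>Replaces the identity that the square of a primitive is twice the integral of the
  primitive times its derivative. The square is a double integral; by symmetry the pairs in one
  order carry at least half of it, ties being counted twice.\<close>

lemma square_nn_integral_le:
  fixes i :: "'a \<Rightarrow> real"
  assumes [measurable]: "i \<in> borel_measurable M" "p \<in> borel_measurable M"
  shows "(\<integral>\<^sup>+t. p t \<partial>M)\<^sup>2 \<le> 2 * (\<integral>\<^sup>+t. p t * (\<integral>\<^sup>+s. (if i s \<le> i t then p s else 0) \<partial>M) \<partial>M)"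
    and "(\<integral>\<^sup>+t. p t \<partial>M)\<^sup>2 \<le> 2 * (\<integral>\<^sup>+t. p t * (\<integral>\<^sup>+s. (if i t \<le> i s then p s else 0) \<partial>M) \<partial>M)"
proof -
  let ?A = "\<integral>\<^sup>+t. p t * (\<integral>\<^sup>+s. (if i s \<le> i t then p s else 0) \<partial>M) \<partial>M"
  let ?B = "\<integral>\<^sup>+t. p t * (\<integral>\<^sup>+s. (if i t \<le> i s then p s else 0) \<partial>M) \<partial>M"
  have "?A = (\<integral>\<^sup>+t. \<integral>\<^sup>+s. (if i s \<le> i t then p t * p s else 0) \<partial>M \<partial>M)"
    by (subst nn_integral_cmult[symmetric]) (auto intro!: nn_integral_cong)
  also have "\<dots> = (\<integral>\<^sup>+s. \<integral>\<^sup>+t. (if i s \<le> i t then p t * p s else 0) \<partial>M \<partial>M)"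
    by (rule nn_integral_swap) measurable
  also have "\<dots> = ?B"
    by (subst nn_integral_cmult[symmetric]) (auto intro!: nn_integral_cong simp: mult.commute)
  finally have AB: "?A = ?B" .
  have "(\<integral>\<^sup>+t. p t \<partial>M)\<^sup>2 = (\<integral>\<^sup>+t. p t * (\<integral>\<^sup>+s. p s \<partial>M) \<partial>M)"
    by (simp add: nn_integral_multc power2_eq_square)
  also have "\<dots> \<le> (\<integral>\<^sup>+t. p t * (\<integral>\<^sup>+s. (if i s \<le> i t then p s else 0) + (if i t \<le> i s then p s else 0) \<partial>M) \<partial>M)"
    by (intro nn_integral_mono mult_left_mono) auto
  also have "\<dots> = ?A + ?B"
    by (simp add: nn_integral_add distrib_left)
  finally have *: "(\<integral>\<^sup>+t. p t \<partial>M)\<^sup>2 \<le> ?A + ?B" .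
  then show "(\<integral>\<^sup>+t. p t \<partial>M)\<^sup>2 \<le> 2 * ?A" unfolding AB[symmetric] by (simp add: mult_2)
  show "(\<integral>\<^sup>+t. p t \<partial>M)\<^sup>2 \<le> 2 * ?B" using * unfolding AB by (simp add: mult_2)
qed

text \<open>With V(t) the mass of \<open>W\<^sup>2\<close> on {x. i t \<le> i x}, J the left side,
  and H the integral of \<open>h\<^sup>2\<close>: expanding \<open>y\<^sup>2\<close> and exchanging
  integrals gives J \<le> 2 \<integral> h U y V, hence J^2 \<le> 4 H K with K = \<integral> (U y
  V)^2. Expanding V^2 in the same way and using that y increases gives K \<le> 2 A J. The real
  function \<open>i\<close> only supplies the order.\<close>

lemma hardy_finite:
  fixes i :: "'a \<Rightarrow> real" and W U h :: "'a \<Rightarrow> ennreal"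
  defines "y \<equiv> \<lambda>x. \<integral>\<^sup>+t. (if i t \<le> i x then U t * h t else 0) \<partial>M"
  assumes [measurable]: "i \<in> borel_measurable M" "W \<in> borel_measurable M" "U \<in> borel_measurable M" "h \<in> borel_measurable M"
    and A: "\<And>r. r \<in> space M \<Longrightarrow> (\<integral>\<^sup>+x. (if i r \<le> i x then (W x)\<^sup>2 else 0) \<partial>M) *
       (\<integral>\<^sup>+t. (if i t \<le> i r then (U t)\<^sup>2 else 0) \<partial>M) \<le> A"
    and fin: "(\<integral>\<^sup>+x. (W x * y x)\<^sup>2 \<partial>M) < \<infinity>"
  shows "(\<integral>\<^sup>+x. (W x * y x)\<^sup>2 \<partial>M) \<le> 8 * A * (\<integral>\<^sup>+x. (h x)\<^sup>2 \<partial>M)"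
proof -
  define V where "V t = (\<integral>\<^sup>+x. (if i t \<le> i x then (W x)\<^sup>2 else 0) \<partial>M)" for t
  define J where "J = (\<integral>\<^sup>+x. (W x * y x)\<^sup>2 \<partial>M)"
  define H where "H = (\<integral>\<^sup>+x. (h x)\<^sup>2 \<partial>M)"
  have [measurable]: "y \<in> borel_measurable M" unfolding y_def by measurable
  have [measurable]: "V \<in> borel_measurable M" unfolding V_def by measurable
  have y_mono: "y t \<le> y x" if "i t \<le> i x" for t x
    unfolding y_def using that by (intro nn_integral_mono) auto
  have V_mono: "V x \<le> V t" if "i t \<le> i x" for t x
    unfolding V_def using that by (intro nn_integral_mono) auto
  have y2: "(y x)\<^sup>2 \<le> 2 * (\<integral>\<^sup>+t. (if i t \<le> i x then U t * h t * y t else 0) \<partial>M)" for x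
  proof -
    have "(y x)\<^sup>2 \<le> 2 * (\<integral>\<^sup>+t. (if i t \<le> i x then U t * h t else 0) * (\<integral>\<^sup>+s. (if i s \<le> i t then (if i s \<le> i x then U s * h s else 0) else 0) \<partial>M) \<partial>M)"
      unfolding y_def by (rule square_nn_integral_le(1)) measurable
    also have "\<dots> \<le> 2 * (\<integral>\<^sup>+t. (if i t \<le> i x then U t * h t * y t else 0) \<partial>M)"
      unfolding y_def by (intro mult_left_mono nn_integral_mono) (auto intro!: mult_left_mono nn_integral_mono)
    finally show ?thesis .
  qed
  have V2: "(V t)\<^sup>2 \<le> 2 * (\<integral>\<^sup>+x. (if i t \<le> i x then (W x)\<^sup>2 * V x else 0) \<partial>M)" for t
  proof -
    have "(V t)\<^sup>2 \<le> 2 * (\<integral>\<^sup>+x. (if i t \<le> i x then (W x)\<^sup>2 else 0) * (\<integral>\<^sup>+s. (if i x \<le> i s then (if i t \<le> i s then (W s)\<^sup>2 else 0) else 0) \<partial>M) \<partial>M)"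
      unfolding V_def by (rule square_nn_integral_le(2)) measurable
    also have "\<dots> \<le> 2 * (\<integral>\<^sup>+x. (if i t \<le> i x then (W x)\<^sup>2 * V x else 0) \<partial>M)"
      unfolding V_def by (intro mult_left_mono nn_integral_mono) (auto intro!: mult_left_mono nn_integral_mono)
    finally show ?thesis .
  qed
  have "J = (\<integral>\<^sup>+x. (W x)\<^sup>2 * (y x)\<^sup>2 \<partial>M)"
    by (simp add: J_def power_mult_distrib)
  also have "\<dots> \<le> (\<integral>\<^sup>+x. (W x)\<^sup>2 * (2 * (\<integral>\<^sup>+t. (if i t \<le> i x then U t * h t * y t else 0) \<partial>M)) \<partial>M)"
    by (intro nn_integral_mono mult_left_mono y2) simp
  also have "\<dots> = 2 * (\<integral>\<^sup>+x. \<integral>\<^sup>+t. (if i t \<le> i x then (W x)\<^sup>2 * (U t * h t * y t) else 0) \<partial>M \<partial>M)"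
    by (subst nn_integral_cmult[symmetric], measurable)
       (auto intro!: nn_integral_cong simp: nn_integral_cmult[symmetric] mult_ac)
  also have "\<dots> = 2 * (\<integral>\<^sup>+t. \<integral>\<^sup>+x. (if i t \<le> i x then (W x)\<^sup>2 * (U t * h t * y t) else 0) \<partial>M \<partial>M)"
    by (subst nn_integral_swap) measurable
  also have "(\<integral>\<^sup>+t. \<integral>\<^sup>+x. (if i t \<le> i x then (W x)\<^sup>2 * (U t * h t * y t) else 0) \<partial>M \<partial>M) = (\<integral>\<^sup>+t. h t * (U t * y t * V t) \<partial>M)"
  proof (rule nn_integral_cong)
    fix t
    have "(\<integral>\<^sup>+x. (if i t \<le> i x then (W x)\<^sup>2 * (U t * h t * y t) else 0) \<partial>M) = (\<integral>\<^sup>+x. (U t * h t * y t) * (if i t \<le> i x then (W x)\<^sup>2 else 0) \<partial>M)"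
      by (intro nn_integral_cong) (simp add: mult.commute)
    also have "\<dots> = h t * (U t * y t * V t)"
      unfolding V_def by (subst nn_integral_cmult) (auto simp: mult_ac)
    finally show "(\<integral>\<^sup>+x. (if i t \<le> i x then (W x)\<^sup>2 * (U t * h t * y t) else 0) \<partial>M) = h t * (U t * y t * V t)" .
  qed
  finally have J1: "J \<le> 2 * (\<integral>\<^sup>+t. h t * (U t * y t * V t) \<partial>M)" .
  define K where "K = (\<integral>\<^sup>+t. (U t * y t * V t)\<^sup>2 \<partial>M)"
  have "J\<^sup>2 \<le> (2 * (\<integral>\<^sup>+t. h t * (U t * y t * V t) \<partial>M))\<^sup>2"
    using J1 by (rule power_mono) simp
  also have "\<dots> = 4 * (\<integral>\<^sup>+t. h t * (U t * y t * V t) \<partial>M)\<^sup>2"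
    by (simp add: power_mult_distrib)
  also have "\<dots> \<le> 4 * (H * K)"
    unfolding H_def K_def by (intro mult_left_mono Cauchy_Schwarz_nn_integral) auto
  finally have J2: "J\<^sup>2 \<le> 4 * (H * K)" .
  have "K = (\<integral>\<^sup>+t. (U t * y t)\<^sup>2 * (V t)\<^sup>2 \<partial>M)"
    by (simp add: K_def power_mult_distrib)
  also have "\<dots> \<le> (\<integral>\<^sup>+t. (U t * y t)\<^sup>2 * (2 * (\<integral>\<^sup>+x. (if i t \<le> i x then (W x)\<^sup>2 * V x else 0) \<partial>M)) \<partial>M)"
    by (intro nn_integral_mono mult_left_mono V2) simp
  also have "\<dots> = 2 * (\<integral>\<^sup>+t. \<integral>\<^sup>+x. (if i t \<le> i x then (U t * y t)\<^sup>2 * ((W x)\<^sup>2 * V x) else 0) \<partial>M \<partial>M)"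
    by (subst nn_integral_cmult[symmetric], measurable)
       (auto intro!: nn_integral_cong simp: nn_integral_cmult[symmetric] mult_ac)
  also have "\<dots> = 2 * (\<integral>\<^sup>+x. \<integral>\<^sup>+t. (if i t \<le> i x then (U t * y t)\<^sup>2 * ((W x)\<^sup>2 * V x) else 0) \<partial>M \<partial>M)"
    by (subst nn_integral_swap) measurable
  also have "\<dots> \<le> 2 * (\<integral>\<^sup>+x. A * (W x * y x)\<^sup>2 \<partial>M)"
  proof (intro mult_left_mono nn_integral_mono)
    fix x assume x: "x \<in> space M"
    have "(\<integral>\<^sup>+t. (if i t \<le> i x then (U t * y t)\<^sup>2 * ((W x)\<^sup>2 * V x) else 0) \<partial>M) \<le>
      (\<integral>\<^sup>+t. ((W x * y x)\<^sup>2 * V x) * (if i t \<le> i x then (U t)\<^sup>2 else 0) \<partial>M)"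
    proof (intro nn_integral_mono)
      fix t
      show "(if i t \<le> i x then (U t * y t)\<^sup>2 * ((W x)\<^sup>2 * V x) else 0) \<le> ((W x * y x)\<^sup>2 * V x) * (if i t \<le> i x then (U t)\<^sup>2 else 0)"
      proof (cases "i t \<le> i x")
        case True
        have "(y t)\<^sup>2 * ((U t)\<^sup>2 * ((W x)\<^sup>2 * V x)) \<le> (y x)\<^sup>2 * ((U t)\<^sup>2 * ((W x)\<^sup>2 * V x))"
          by (intro mult_right_mono power_mono y_mono True) auto
        then show ?thesis using True by (simp add: power_mult_distrib mult_ac)
      qed simp
    qed
    also have "\<dots> = (W x * y x)\<^sup>2 * (V x * (\<integral>\<^sup>+t. (if i t \<le> i x then (U t)\<^sup>2 else 0) \<partial>M))"
      by (subst nn_integral_cmult) (auto simp: mult.assoc)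
    also have "\<dots> \<le> (W x * y x)\<^sup>2 * A"
      unfolding V_def by (intro mult_left_mono A x) simp
    finally show "(\<integral>\<^sup>+t. (if i t \<le> i x then (U t * y t)\<^sup>2 * ((W x)\<^sup>2 * V x) else 0) \<partial>M) \<le> A * (W x * y x)\<^sup>2"
      by (simp add: mult.commute)
  qed simp
  also have "\<dots> = 2 * (A * J)"
    by (simp add: J_def nn_integral_cmult)
  finally have "4 * (H * K) \<le> 4 * (H * (2 * (A * J)))"
    by (intro mult_left_mono) auto
  also have "\<dots> = (8 * A * H) * J"
    by (simp add: mult_ac flip: mult.assoc[of 4 2])
  \<comment> \<open>The constant is 8 = 4 * 2. Cancelling one factor J is where its finiteness
    enters.\<close>
  finally have J3: "J * J \<le> J * (8 * A * H)"
    using J2 by (simp add: power2_eq_square mult.commute)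
  show ?thesis
  proof (cases "J = 0")
    case False
    then have "J \<le> 8 * A * H"
      using J3 fin by (subst (asm) ennreal_mult_le_mult_iff) (auto simp: J_def)
    then show ?thesis by (simp add: J_def H_def)
  qed (simp add: J_def)
qed

text \<open>The finiteness of the left side, an assumption in \<open>hardy_finite\<close>, is
  removed by truncation and monotone convergence.\<close>

theorem hardy:
  fixes i :: "'a \<Rightarrow> real" and W U h :: "'a \<Rightarrow> ennreal"
  defines "y \<equiv> \<lambda>x. \<integral>\<^sup>+t. (if i t \<le> i x then U t * h t else 0) \<partial>M"
  assumes [measurable]: "i \<in> borel_measurable M" "W \<in> borel_measurable M" "U \<in> borel_measurable M" "h \<in> borel_measurable M"
    and A: "\<And>r. r \<in> space M \<Longrightarrow> (\<integral>\<^sup>+x. (if i r \<le> i x then (W x)\<^sup>2 else 0) \<partial>M) *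
       (\<integral>\<^sup>+t. (if i t \<le> i r then (U t)\<^sup>2 else 0) \<partial>M) \<le> A"
    and W: "(\<integral>\<^sup>+x. (W x)\<^sup>2 \<partial>M) < \<infinity>"
    and U: "\<And>r. r \<in> space M \<Longrightarrow> (\<integral>\<^sup>+t. (if i t \<le> i r then (U t)\<^sup>2 else 0) \<partial>M) < \<infinity>"
    and h: "(\<integral>\<^sup>+x. (h x)\<^sup>2 \<partial>M) < \<infinity>"
  shows "(\<integral>\<^sup>+x. (W x * y x)\<^sup>2 \<partial>M) \<le> 8 * A * (\<integral>\<^sup>+x. (h x)\<^sup>2 \<partial>M)"
proof -
  have [measurable]: "y \<in> borel_measurable M" unfolding y_def by measurable
  have y_fin: "y x < \<infinity>" if x: "x \<in> space M" for x
  proof -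
    have "(y x)\<^sup>2 = (\<integral>\<^sup>+t. (if i t \<le> i x then U t else 0) * h t \<partial>M)\<^sup>2"
      unfolding y_def by (intro arg_cong[where f="\<lambda>x. x\<^sup>2"] nn_integral_cong) auto
    also have "\<dots> \<le> (\<integral>\<^sup>+t. (if i t \<le> i x then U t else 0)\<^sup>2 \<partial>M) * (\<integral>\<^sup>+t. (h t)\<^sup>2 \<partial>M)"
      by (rule Cauchy_Schwarz_nn_integral) measurable
    also have "(\<integral>\<^sup>+t. (if i t \<le> i x then U t else 0)\<^sup>2 \<partial>M) = (\<integral>\<^sup>+t. (if i t \<le> i x then (U t)\<^sup>2 else 0) \<partial>M)"
      by (intro nn_integral_cong) auto
    finally have "(y x)\<^sup>2 < \<infinity>"
      using U[OF x] h by (auto simp: ennreal_mult_less_top intro: le_less_trans)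
    then show ?thesis by (auto simp: power2_eq_square ennreal_mult_less_top less_top[symmetric])
  qed
  \<comment> \<open>Truncating \<open>W\<close> where \<open>y\<close> is large makes the left side
    finite, while \<open>y\<close> and the bound A persist. As \<open>y\<close> is finite
    everywhere, each point is eventually in the untruncated region.\<close>
  define Wn where "Wn n x = (if y x \<le> of_nat n then W x else 0)" for n :: nat and x
  have [measurable]: "Wn n \<in> borel_measurable M" for n unfolding Wn_def by measurable
  have bound: "(\<integral>\<^sup>+x. (Wn n x * y x)\<^sup>2 \<partial>M) \<le> 8 * A * (\<integral>\<^sup>+x. (h x)\<^sup>2 \<partial>M)" for n
    unfolding y_def
  proof (rule hardy_finite)
    fix r assume r: "r \<in> space M"
    have "(\<integral>\<^sup>+x. (if i r \<le> i x then (Wn n x)\<^sup>2 else 0) \<partial>M) \<le> (\<integral>\<^sup>+x. (if i r \<le> i x then (W x)\<^sup>2 else 0) \<partial>M)"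
      by (intro nn_integral_mono) (auto simp: Wn_def)
    then show "(\<integral>\<^sup>+x. (if i r \<le> i x then (Wn n x)\<^sup>2 else 0) \<partial>M) * (\<integral>\<^sup>+t. (if i t \<le> i r then (U t)\<^sup>2 else 0) \<partial>M) \<le> A"
      using A[OF r] by (meson mult_right_mono order_trans zero_le)
  next
    have "(\<integral>\<^sup>+x. (Wn n x * y x)\<^sup>2 \<partial>M) \<le> (\<integral>\<^sup>+x. (of_nat n)\<^sup>2 * (W x)\<^sup>2 \<partial>M)"
      by (intro nn_integral_mono) (auto simp: Wn_def power_mult_distrib mult.commute[of _ "(W _)\<^sup>2"] intro!: mult_left_mono power_mono)
    also have "\<dots> = (of_nat n)\<^sup>2 * (\<integral>\<^sup>+x. (W x)\<^sup>2 \<partial>M)"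
      by (simp add: nn_integral_cmult)
    also have "\<dots> < \<infinity>" using W by (simp add: ennreal_mult_less_top power2_eq_square of_nat_less_top)
    finally show "(\<integral>\<^sup>+x. (Wn n x * (\<integral>\<^sup>+t. (if i t \<le> i x then U t * h t else 0) \<partial>M))\<^sup>2 \<partial>M) < \<infinity>"
      by (simp add: y_def)
  qed measurable
  have "(\<integral>\<^sup>+x. (W x * y x)\<^sup>2 \<partial>M) = (\<integral>\<^sup>+x. (SUP n. (Wn n x * y x)\<^sup>2) \<partial>M)"
  proof (intro nn_integral_cong antisym)
    fix x assume "x \<in> space M"
    then obtain n where n: "y x \<le> of_nat n"
      using y_fin ennreal_Ex_less_of_nat[of "y x"] by (auto intro: less_imp_le)
    then have "(W x * y x)\<^sup>2 = (Wn n x * y x)\<^sup>2" by (simp add: Wn_def)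
    also have "\<dots> \<le> (SUP n. (Wn n x * y x)\<^sup>2)" by (rule SUP_upper) simp
    finally show "(W x * y x)\<^sup>2 \<le> (SUP n. (Wn n x * y x)\<^sup>2)" .
    show "(SUP n. (Wn n x * y x)\<^sup>2) \<le> (W x * y x)\<^sup>2"
      by (intro SUP_least) (auto simp: Wn_def)
  qed
  also have "\<dots> = (SUP n. \<integral>\<^sup>+x. (Wn n x * y x)\<^sup>2 \<partial>M)"
  proof (rule nn_integral_monotone_convergence_SUP)
    show "incseq (\<lambda>n x. (Wn n x * y x)\<^sup>2)"
    proof (intro incseq_SucI le_funI)
      fix n x
      have "Wn n x \<le> Wn (Suc n) x"
        by (auto simp: Wn_def intro: order_trans)
      then show "(Wn n x * y x)\<^sup>2 \<le> (Wn (Suc n) x * y x)\<^sup>2"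
        by (intro power_mono mult_right_mono) auto
    qed
  qed measurable
  also have "\<dots> \<le> 8 * A * (\<integral>\<^sup>+x. (h x)\<^sup>2 \<partial>M)"
    by (intro SUP_least bound)
  finally show ?thesis .
qed

end

section \<open>Uniform boundedness on square integrable functions\<close>

definition L2_fun :: "'a measure \<Rightarrow> ('a \<Rightarrow> real) \<Rightarrow> bool" where
  "L2_fun M f \<longleftrightarrow> f \<in> borel_measurable M \<and> (\<integral>\<^sup>+x. ennreal ((f x)\<^sup>2) \<partial>M) < \<infinity>"

text \<open>\<open>enn2real\<close> sends infinity to 0, so a bound on \<open>nrm2\<close> carries
  information only together with \<open>L2_fun\<close>. Functions are not identified modulo null
  sets, so this is a seminorm.\<close>

definition nrm2 :: "'a measure \<Rightarrow> ('a \<Rightarrow> real) \<Rightarrow> real" where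
  "nrm2 M f = sqrt (enn2real (\<integral>\<^sup>+x. ennreal ((f x)\<^sup>2) \<partial>M))"

lemma nrm2_nonneg: "0 \<le> nrm2 M f"
  by (simp add: nrm2_def)

lemma nrm2_square: "L2_fun M f \<Longrightarrow> (\<integral>\<^sup>+x. ennreal ((f x)\<^sup>2) \<partial>M) = ennreal ((nrm2 M f)\<^sup>2)"
  by (simp add: nrm2_def L2_fun_def ennreal_enn2real)

lemma L2_fun_measurable: "L2_fun M f \<Longrightarrow> f \<in> borel_measurable M"
  by (simp add: L2_fun_def)

lemma L2_fun_boundI:
  assumes "f \<in> borel_measurable M" "(\<integral>\<^sup>+x. ennreal ((f x)\<^sup>2) \<partial>M) \<le> ennreal (c\<^sup>2)" "0 \<le> c"
  shows "L2_fun M f" "nrm2 M f \<le> c"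
proof -
  show L: "L2_fun M f"
    using assms by (auto simp: L2_fun_def intro: le_less_trans)
  have "ennreal ((nrm2 M f)\<^sup>2) \<le> ennreal (c\<^sup>2)" using assms(2) nrm2_square[OF L] by simp
  then have "(nrm2 M f)\<^sup>2 \<le> c\<^sup>2" by simp
  then show "nrm2 M f \<le> c" using assms(3) by (rule power2_le_imp_le)
qed

lemma L2_fun_mono:
  assumes "f \<in> borel_measurable M" "L2_fun M g" "AE x in M. \<bar>f x\<bar> \<le> \<bar>g x\<bar>"
  shows "L2_fun M f" "nrm2 M f \<le> nrm2 M g"
proof -
  have "(\<integral>\<^sup>+x. ennreal ((f x)\<^sup>2) \<partial>M) \<le> (\<integral>\<^sup>+x. ennreal ((g x)\<^sup>2) \<partial>M)"
    using assms(3) by (intro nn_integral_mono_AE) (auto elim!: eventually_mono intro!: ennreal_leI simp: abs_le_square_iff)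
  also have "\<dots> = ennreal ((nrm2 M g)\<^sup>2)" by (rule nrm2_square[OF assms(2)])
  finally show "L2_fun M f" "nrm2 M f \<le> nrm2 M g"
    using L2_fun_boundI[OF assms(1) _ nrm2_nonneg] by blast+
qed

lemma nrm2_cong_AE: "AE x in M. f x = g x \<Longrightarrow> nrm2 M f = nrm2 M g"
  unfolding nrm2_def by (intro arg_cong[where f="\<lambda>x. sqrt (enn2real x)"] nn_integral_cong_AE) auto

lemma L2_fun_cmult:
  assumes f: "L2_fun M f" shows "L2_fun M (\<lambda>x. c * f x)" "nrm2 M (\<lambda>x. c * f x) = \<bar>c\<bar> * nrm2 M f"
proof -
  have [measurable]: "f \<in> borel_measurable M" using f by (rule L2_fun_measurable)
  have eq: "(\<integral>\<^sup>+x. ennreal ((c * f x)\<^sup>2) \<partial>M) = ennreal ((\<bar>c\<bar> * nrm2 M f)\<^sup>2)"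
    by (simp add: power_mult_distrib ennreal_mult nn_integral_cmult nrm2_square[OF f])
  then show L: "L2_fun M (\<lambda>x. c * f x)" by (simp add: L2_fun_def)
  have "ennreal ((nrm2 M (\<lambda>x. c * f x))\<^sup>2) = ennreal ((\<bar>c\<bar> * nrm2 M f)\<^sup>2)"
    using nrm2_square[OF L] eq by simp
  then have "(nrm2 M (\<lambda>x. c * f x))\<^sup>2 = (\<bar>c\<bar> * nrm2 M f)\<^sup>2" by simp
  then show "nrm2 M (\<lambda>x. c * f x) = \<bar>c\<bar> * nrm2 M f"
    by (rule power2_eq_imp_eq) (auto simp: nrm2_nonneg)
qed

lemma Cauchy_Schwarz_L2:
  assumes f: "L2_fun M f" and g: "L2_fun M g"
  shows "(\<integral>\<^sup>+x. ennreal \<bar>f x * g x\<bar> \<partial>M) \<le> ennreal (nrm2 M f * nrm2 M g)"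
proof (rule ennreal_le_of_square_le)
  have [measurable]: "f \<in> borel_measurable M" "g \<in> borel_measurable M"
    using f g by (auto simp: L2_fun_def)
  have "(\<integral>\<^sup>+x. ennreal \<bar>f x * g x\<bar> \<partial>M)\<^sup>2 = (\<integral>\<^sup>+x. ennreal \<bar>f x\<bar> * ennreal \<bar>g x\<bar> \<partial>M)\<^sup>2"
    by (simp add: abs_mult ennreal_mult)
  also have "\<dots> \<le> (\<integral>\<^sup>+x. (ennreal \<bar>f x\<bar>)\<^sup>2 \<partial>M) * (\<integral>\<^sup>+x. (ennreal \<bar>g x\<bar>)\<^sup>2 \<partial>M)"
    by (rule Cauchy_Schwarz_nn_integral) measurable
  also have "\<dots> = ennreal ((nrm2 M f * nrm2 M g)\<^sup>2)"
    using nrm2_square[OF f] nrm2_square[OF g] by (simp add: ennreal_power power_mult_distrib ennreal_mult)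
  finally show "(\<integral>\<^sup>+x. ennreal \<bar>f x * g x\<bar> \<partial>M)\<^sup>2 \<le> ennreal ((nrm2 M f * nrm2 M g)\<^sup>2)" .
qed (simp add: nrm2_nonneg)

lemma L2_fun_add:
  assumes f: "L2_fun M f" and g: "L2_fun M g"
  shows "L2_fun M (\<lambda>x. f x + g x)" "nrm2 M (\<lambda>x. f x + g x) \<le> nrm2 M f + nrm2 M g"
proof -
  have [measurable]: "f \<in> borel_measurable M" "g \<in> borel_measurable M"
    using f g by (auto simp: L2_fun_def)
  have "(\<integral>\<^sup>+x. ennreal ((f x + g x)\<^sup>2) \<partial>M) \<le> (\<integral>\<^sup>+x. (ennreal ((f x)\<^sup>2) + 2 * ennreal \<bar>f x * g x\<bar>) + ennreal ((g x)\<^sup>2) \<partial>M)"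
  proof (rule nn_integral_mono)
    fix x
    have "(f x + g x)\<^sup>2 \<le> (f x)\<^sup>2 + 2 * \<bar>f x * g x\<bar> + (g x)\<^sup>2"
      by (simp add: power2_sum abs_mult) (metis abs_ge_self abs_mult mult.assoc)
    then have "ennreal ((f x + g x)\<^sup>2) \<le> ennreal ((f x)\<^sup>2 + 2 * \<bar>f x * g x\<bar> + (g x)\<^sup>2)" by (rule ennreal_leI)
    then show "ennreal ((f x + g x)\<^sup>2) \<le> (ennreal ((f x)\<^sup>2) + 2 * ennreal \<bar>f x * g x\<bar>) + ennreal ((g x)\<^sup>2)"
      by (simp add: ennreal_mult)
  qed
  also have "\<dots> = (\<integral>\<^sup>+x. ennreal ((f x)\<^sup>2) \<partial>M) + 2 * (\<integral>\<^sup>+x. ennreal \<bar>f x * g x\<bar> \<partial>M) + (\<integral>\<^sup>+x. ennreal ((g x)\<^sup>2) \<partial>M)"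
    by (simp add: nn_integral_add nn_integral_cmult)
  also have "\<dots> \<le> ennreal ((nrm2 M f)\<^sup>2) + 2 * ennreal (nrm2 M f * nrm2 M g) + ennreal ((nrm2 M g)\<^sup>2)"
    unfolding nrm2_square[OF f] nrm2_square[OF g] by (intro add_mono mult_left_mono Cauchy_Schwarz_L2[OF f g]) auto
  also have "\<dots> = ennreal ((nrm2 M f + nrm2 M g)\<^sup>2)"
    by (simp add: power2_sum nrm2_nonneg ennreal_mult mult.assoc add_ac)
  finally show "L2_fun M (\<lambda>x. f x + g x)" "nrm2 M (\<lambda>x. f x + g x) \<le> nrm2 M f + nrm2 M g"
    using L2_fun_boundI[of "\<lambda>x. f x + g x" M "nrm2 M f + nrm2 M g"] by (auto simp: nrm2_nonneg)
qed

lemma L2_fun_zero: "L2_fun M (\<lambda>_. 0)" "nrm2 M (\<lambda>_. 0) = 0"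
  by (auto simp: L2_fun_def nrm2_def)

lemma L2_fun_sum:
  assumes "\<And>i. i \<in> I \<Longrightarrow> L2_fun M (f i)"
  shows "L2_fun M (\<lambda>x. \<Sum>i\<in>I. f i x) \<and> nrm2 M (\<lambda>x. \<Sum>i\<in>I. f i x) \<le> (\<Sum>i\<in>I. nrm2 M (f i))"
  using assms
proof (induction I rule: infinite_finite_induct)
  case (insert i I)
  then have *: "L2_fun M (f i)" "L2_fun M (\<lambda>x. \<Sum>i\<in>I. f i x)" "nrm2 M (\<lambda>x. \<Sum>i\<in>I. f i x) \<le> (\<Sum>i\<in>I. nrm2 M (f i))"
    by auto
  show ?case using insert(1,2) L2_fun_add[OF *(1,2)] *(3) by simp
qed (auto simp: L2_fun_zero)

lemma L2_fun_diff:
  assumes "L2_fun M f" "L2_fun M g" shows "L2_fun M (\<lambda>x. f x - g x)"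
  using L2_fun_add(1)[OF assms(1) L2_fun_cmult(1)[OF assms(2), of "-1"]] by simp

lemma L2_fun_abs: assumes "L2_fun M f" shows "L2_fun M (\<lambda>x. \<bar>f x\<bar>)" "nrm2 M (\<lambda>x. \<bar>f x\<bar>) = nrm2 M f"
  using assms by (auto simp: L2_fun_def nrm2_def)

text \<open>Completeness in the form of Riesz and Fischer. The partial sums of the absolute values
  have bounded seminorms, so by monotone convergence their supremum is finite almost everywhere and
  dominates the sum.\<close>

lemma L2_fun_suminf:
  assumes d: "\<And>i. L2_fun M (d i)" "\<And>i. nrm2 M (d i) \<le> \<beta> i" and \<beta>: "summable \<beta>"
  shows "AE x in M. summable (\<lambda>i. d i x)"
    and "L2_fun M (\<lambda>x. \<Sum>i. d i x)" "nrm2 M (\<lambda>x. \<Sum>i. d i x) \<le> (\<Sum>i. \<beta> i)"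
proof -
  have \<beta>0: "0 \<le> \<beta> i" for i using d(2)[of i] nrm2_nonneg[of M "d i"] by linarith
  define B where "B = (\<Sum>i. \<beta> i)"
  have B0: "0 \<le> B" unfolding B_def by (rule suminf_nonneg[OF \<beta> \<beta>0])
  have [measurable]: "d i \<in> borel_measurable M" for i using d(1) by (rule L2_fun_measurable)
  define S where "S n x = (\<Sum>i<n. \<bar>d i x\<bar>)" for n x
  have S: "L2_fun M (S n)" "nrm2 M (S n) \<le> B" for n
  proof -
    have *: "L2_fun M (\<lambda>x. \<Sum>i<n. \<bar>d i x\<bar>) \<and> nrm2 M (\<lambda>x. \<Sum>i<n. \<bar>d i x\<bar>) \<le> (\<Sum>i<n. nrm2 M (\<lambda>x. \<bar>d i x\<bar>))"
      by (rule L2_fun_sum) (rule L2_fun_abs(1)[OF d(1)])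
    have "(\<Sum>i<n. nrm2 M (\<lambda>x. \<bar>d i x\<bar>)) \<le> (\<Sum>i<n. \<beta> i)"
      by (intro sum_mono) (simp add: L2_fun_abs(2)[OF d(1)] d(2))
    also have "\<dots> \<le> B" unfolding B_def by (rule sum_le_suminf[OF \<beta>]) (auto simp: \<beta>0)
    finally show "L2_fun M (S n)" "nrm2 M (S n) \<le> B" using * by (auto simp: S_def[abs_def])
  qed
  have S_mono: "incseq (\<lambda>n. ennreal ((S n x)\<^sup>2))" for x
  proof (rule incseq_SucI)
    fix n
    have "(S n x)\<^sup>2 \<le> (S (Suc n) x)\<^sup>2" by (intro power_mono) (auto simp: S_def sum_nonneg)
    then show "ennreal ((S n x)\<^sup>2) \<le> ennreal ((S (Suc n) x)\<^sup>2)" by (rule ennreal_leI)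
  qed
  have "(\<integral>\<^sup>+x. (SUP n. ennreal ((S n x)\<^sup>2)) \<partial>M) = (SUP n. \<integral>\<^sup>+x. ennreal ((S n x)\<^sup>2) \<partial>M)"
  proof (rule nn_integral_monotone_convergence_SUP)
    show "incseq (\<lambda>n x. ennreal ((S n x)\<^sup>2))"
      using S_mono by (auto simp: incseq_def le_fun_def)
    show "\<And>n. (\<lambda>x. ennreal ((S n x)\<^sup>2)) \<in> borel_measurable M" using S(1)[THEN L2_fun_measurable] by measurable
  qed
  also have "\<dots> \<le> ennreal (B\<^sup>2)"
  proof (rule SUP_least)
    fix n
    show "(\<integral>\<^sup>+x. ennreal ((S n x)\<^sup>2) \<partial>M) \<le> ennreal (B\<^sup>2)"
      unfolding nrm2_square[OF S(1)] by (intro ennreal_leI power_mono S(2) nrm2_nonneg)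
  qed
  finally have le: "(\<integral>\<^sup>+x. (SUP n. ennreal ((S n x)\<^sup>2)) \<partial>M) \<le> ennreal (B\<^sup>2)" .
  have [measurable]: "(\<lambda>x. ennreal ((S n x)\<^sup>2)) \<in> borel_measurable M" for n
    using S(1)[THEN L2_fun_measurable] by measurable
  have "AE x in M. (SUP n. ennreal ((S n x)\<^sup>2)) \<noteq> \<infinity>"
    by (rule nn_integral_noteq_infinite) (use le in \<open>auto simp: top_unique\<close>)
  then have sum: "AE x in M. summable (\<lambda>i. \<bar>d i x\<bar>)"
  proof eventually_elim
    case (elim x)
    then obtain c where c: "(SUP n. ennreal ((S n x)\<^sup>2)) = ennreal c" "0 \<le> c"
      by (cases "(SUP n. ennreal ((S n x)\<^sup>2))") auto
    show ?case
    proof (rule summableI_nonneg_bounded)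
      fix n
      have "ennreal ((S n x)\<^sup>2) \<le> ennreal c" unfolding c(1)[symmetric] by (rule SUP_upper) simp
      then have "(S n x)\<^sup>2 \<le> c" using c(2) by simp
      then show "(\<Sum>i<n. \<bar>d i x\<bar>) \<le> sqrt c" using real_le_rsqrt by (simp add: S_def)
    qed simp
  qed
  then show "AE x in M. summable (\<lambda>i. d i x)"
    by eventually_elim (rule summable_rabs_cancel)
  have "(\<integral>\<^sup>+x. ennreal ((\<Sum>i. d i x)\<^sup>2) \<partial>M) \<le> (\<integral>\<^sup>+x. (SUP n. ennreal ((S n x)\<^sup>2)) \<partial>M)"
  proof (rule nn_integral_mono_AE, use sum in eventually_elim)
    case (elim x)
    have "(\<lambda>n. S n x) \<longlonglongrightarrow> (\<Sum>i. \<bar>d i x\<bar>)"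
      unfolding S_def using elim by (rule summable_LIMSEQ)
    then have "(\<lambda>n. ennreal ((S n x)\<^sup>2)) \<longlonglongrightarrow> ennreal ((\<Sum>i. \<bar>d i x\<bar>)\<^sup>2)"
      by (intro tendsto_ennrealI tendsto_power)
    then have "(SUP n. ennreal ((S n x)\<^sup>2)) = ennreal ((\<Sum>i. \<bar>d i x\<bar>)\<^sup>2)"
      using LIMSEQ_SUP[OF S_mono[of x]] LIMSEQ_unique by blast
    moreover have "(\<Sum>i. d i x)\<^sup>2 \<le> (\<Sum>i. \<bar>d i x\<bar>)\<^sup>2"
      using summable_rabs[OF elim] abs_le_square_iff[of "\<Sum>i. d i x" "\<Sum>i. \<bar>d i x\<bar>"]
      by simp
    ultimately show ?case by (simp add: ennreal_leI)
  qed
  with le have fin: "(\<integral>\<^sup>+x. ennreal ((\<Sum>i. d i x)\<^sup>2) \<partial>M) \<le> ennreal (B\<^sup>2)" by simp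
  have "(\<lambda>x. \<Sum>i. d i x) \<in> borel_measurable M" by measurable
  from L2_fun_boundI[OF this fin B0]
  show "L2_fun M (\<lambda>x. \<Sum>i. d i x)" "nrm2 M (\<lambda>x. \<Sum>i. d i x) \<le> (\<Sum>i. \<beta> i)"
    by (simp_all add: B_def)
qed

text \<open>Sokal's proof of the uniform boundedness principle: the signs in a series of almost norming
  vectors with norms \<open>3\<^sup>-\<^sup>j\<close> are chosen so that no term is cancelled by the preceding ones.\<close>

theorem uniform_boundedness:
  fixes p :: "nat \<Rightarrow> ('a \<Rightarrow> real) \<Rightarrow> real"
  assumes nonneg: "\<And>n f. 0 \<le> p n f"
    and add: "\<And>n f g. L2_fun M f \<Longrightarrow> L2_fun M g \<Longrightarrow> p n (\<lambda>x. f x + g x) \<le> p n f + p n g"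
    and cmult: "\<And>n c f. L2_fun M f \<Longrightarrow> p n (\<lambda>x. c * f x) = \<bar>c\<bar> * p n f"
    and bound: "\<And>n f. L2_fun M f \<Longrightarrow> p n f \<le> K n * nrm2 M f"
    and pointwise: "\<And>f. L2_fun M f \<Longrightarrow> \<exists>B. \<forall>n. p n f \<le> B"
  shows "\<exists>C. \<forall>n f. L2_fun M f \<longrightarrow> p n f \<le> C * nrm2 M f"
proof -
  define U where "U = {f. L2_fun M f \<and> nrm2 M f \<le> 1}"
  define \<kappa> where "\<kappa> n = (SUP f\<in>U. p n f)" for n
  have zU: "(\<lambda>_. 0) \<in> U" by (simp add: U_def L2_fun_zero)
  have bdd: "bdd_above (p n ` U)" for n
  proof (rule bdd_aboveI2)
    fix f assume f: "f \<in> U"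
    then have "p n f \<le> K n * nrm2 M f" by (intro bound) (simp add: U_def)
    also have "\<dots> \<le> \<bar>K n\<bar> * 1"
      using f nrm2_nonneg[of M f] by (intro mult_mono) (auto simp: U_def)
    finally show "p n f \<le> \<bar>K n\<bar>" by simp
  qed
  have \<kappa>0: "0 \<le> \<kappa> n" for n
    unfolding \<kappa>_def using cSUP_upper2[OF bdd zU nonneg] .
  have \<kappa>: "p n f \<le> \<kappa> n * nrm2 M f" if f: "L2_fun M f" for n f
  proof (cases "nrm2 M f = 0")
    \<comment> \<open>A function of seminorm 0 cannot be normalized; here the individual bound
      \<open>K n\<close> gives the claim directly.\<close>
    case True then show ?thesis using bound[OF f, of n] by simp
  next
    case False
    then have pos: "0 < nrm2 M f" using nrm2_nonneg[of M f] by simp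
    let ?g = "\<lambda>x. (1 / nrm2 M f) * f x"
    have "?g \<in> U" unfolding U_def using L2_fun_cmult[OF f, of "1 / nrm2 M f"] pos by simp
    then have "p n ?g \<le> \<kappa> n" unfolding \<kappa>_def by (rule cSUP_upper[OF _ bdd])
    moreover have "p n ?g = p n f / nrm2 M f" using cmult[OF f, of n "1 / nrm2 M f"] pos by simp
    ultimately have "p n f / nrm2 M f \<le> \<kappa> n" by (simp only:)
    then show ?thesis using pos by (simp only: pos_divide_le_eq)
  qed
  have "\<exists>C. \<forall>n. \<kappa> n \<le> C"
  proof (rule ccontr)
    assume "\<not> ?thesis"
    \<comment> \<open>Growth 4^j against vectors of size 3^-j leaves (4/3)^j, which is
      unbounded.\<close>
    then have "\<forall>j. \<exists>n. \<kappa> n > 4 ^ j" by (meson not_le)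
    then obtain \<nu> where \<nu>: "\<And>j::nat. \<kappa> (\<nu> j) > 4 ^ j" by metis
    \<comment> \<open>Any factor strictly between 1/2 and 1 would do: the tail of the series costs
      1/2, and 5/6 - 1/2 = 1/3 is kept.\<close>
    have "\<exists>f\<in>U. 5/6 * \<kappa> (\<nu> j) \<le> p (\<nu> j) f" for j
    proof -
      have "0 < \<kappa> (\<nu> j)" using \<nu>[of j] by (rule le_less_trans[rotated]) simp
      then have "5/6 * \<kappa> (\<nu> j) < (SUP f\<in>U. p (\<nu> j) f)" unfolding \<kappa>_def by simp
      then have "\<exists>f\<in>U. 5/6 * \<kappa> (\<nu> j) < p (\<nu> j) f"
        using less_cSUP_iff[OF _ bdd] zU by blast
      then show ?thesis by (meson less_imp_le)
    qed
    then obtain f where f: "\<And>j. f j \<in> U" "\<And>j. 5/6 * \<kappa> (\<nu> j) \<le> p (\<nu> j) (f j)" by metis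
    have fL: "L2_fun M (f j)" "nrm2 M (f j) \<le> 1" for j using f(1)[of j] by (auto simp: U_def)
    define e where "e j = (\<lambda>x. (1/3) ^ j * f j x)" for j
    \<comment> \<open>From 2e = (y + e) - (y - e), at least one of the two signs does not lower the
      value below that of e.\<close>
    define s where "s j y = (if p (\<nu> j) (e j) \<le> p (\<nu> j) (\<lambda>x. y x + e j x) then 1 else -1 :: real)" for j y
    define X where "X = rec_nat (\<lambda>_. 0) (\<lambda>j y x. y x + s j y * e j x)"
    have X: "X 0 = (\<lambda>_. 0)" "X (Suc j) = (\<lambda>x. X j x + s j (X j) * e j x)" for j
      by (auto simp: X_def)
    define d where "d j = (\<lambda>x. s j (X j) * e j x)" for j
    have eL: "L2_fun M (e j)" for j unfolding e_def by (rule L2_fun_cmult(1)[OF fL(1)])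
    have XL: "L2_fun M (X j)" for j
      by (induction j) (auto simp: X L2_fun_zero intro!: L2_fun_add(1) L2_fun_cmult(1) eL)
    have dL: "L2_fun M (d j)" for j unfolding d_def by (rule L2_fun_cmult(1)[OF eL])
    have sa: "\<bar>s j y\<bar> = 1" for j y by (simp add: s_def)
    have dN: "nrm2 M (d j) \<le> (1/3) ^ j" for j
      using fL(2)[of j] unfolding d_def L2_fun_cmult(2)[OF eL] sa unfolding e_def L2_fun_cmult(2)[OF fL(1)]
      by simp
    have big: "p (\<nu> j) (e j) \<le> p (\<nu> j) (X (Suc j))" for j
    proof (cases "p (\<nu> j) (e j) \<le> p (\<nu> j) (\<lambda>x. X j x + e j x)")
      case True then show ?thesis by (simp add: X s_def)
    next
      case False
      have L: "L2_fun M (\<lambda>x. X j x + e j x)" "L2_fun M (\<lambda>x. X j x - e j x)"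
        using XL eL by (auto intro: L2_fun_add(1) L2_fun_diff)
      have "2 * p (\<nu> j) (e j) = p (\<nu> j) (\<lambda>x. (X j x + e j x) + (-1) * (X j x - e j x))"
        using cmult[OF eL, of "\<nu> j" 2 j] by (simp add: algebra_simps)
      also have "\<dots> \<le> p (\<nu> j) (\<lambda>x. X j x + e j x) + p (\<nu> j) (\<lambda>x. X j x - e j x)"
        using add[OF L(1) L2_fun_cmult(1)[OF L(2), of "-1"], of "\<nu> j"] cmult[OF L(2), of "\<nu> j" "-1"] by simp
      finally have "p (\<nu> j) (e j) \<le> p (\<nu> j) (\<lambda>x. X j x - e j x)" using False by simp
      then show ?thesis using False by (simp add: X s_def)
    qed
    have sm: "summable (\<lambda>i. (1/3::real) ^ i)" by (simp add: summable_geometric)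
    define x where "x = (\<lambda>t. \<Sum>i. d i t)"
    have xL: "L2_fun M x" unfolding x_def by (rule L2_fun_suminf(2)[OF dL dN sm])
    have Xsum: "X j t = (\<Sum>i<j. d i t)" for j t by (induction j) (auto simp: X d_def)
    \<comment> \<open>The geometric series of 3^-i over i > j is half of 3^-j.\<close>
    have tail: "nrm2 M (\<lambda>t. X (Suc j) t - x t) \<le> (1/3) ^ j / 2" for j
    proof -
      have "AE t in M. X (Suc j) t - x t = (-1) * (\<Sum>i. d (i + Suc j) t)"
        using L2_fun_suminf(1)[OF dL dN sm]
      proof eventually_elim
        case (elim t)
        show ?case using suminf_split_initial_segment[OF elim, of "Suc j"] by (simp add: x_def Xsum)
      qed
      then have "nrm2 M (\<lambda>t. X (Suc j) t - x t) = nrm2 M (\<lambda>t. (-1) * (\<Sum>i. d (i + Suc j) t))"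
        by (rule nrm2_cong_AE)
      also have "\<dots> = nrm2 M (\<lambda>t. \<Sum>i. d (i + Suc j) t)"
        using L2_fun_cmult(2)[OF L2_fun_suminf(2)[OF dL dN summable_ignore_initial_segment[OF sm]], of "-1" "Suc j"]
        by simp
      also have "\<dots> \<le> (\<Sum>i. (1/3) ^ (i + Suc j))"
        by (rule L2_fun_suminf(3)[OF dL dN summable_ignore_initial_segment[OF sm]])
      also have "\<dots> = (\<Sum>i. (1/3) ^ Suc j * (1/3) ^ i)" by (simp add: power_add mult_ac)
      also have "\<dots> = (1/3) ^ Suc j * (\<Sum>i. (1/3) ^ i)" by (rule suminf_mult[OF sm])
      also have "(\<Sum>i. (1/3::real) ^ i) = 3/2" by (simp add: suminf_geometric)
      finally show ?thesis by simp
    qed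
    have low: "(4/3) ^ j / 3 \<le> p (\<nu> j) x" for j
    proof -
      have DL: "L2_fun M (\<lambda>t. X (Suc j) t - x t)" by (rule L2_fun_diff[OF XL xL])
      have "p (\<nu> j) (X (Suc j)) = p (\<nu> j) (\<lambda>t. (X (Suc j) t - x t) + x t)" by simp
      also have "\<dots> \<le> p (\<nu> j) (\<lambda>t. X (Suc j) t - x t) + p (\<nu> j) x" by (rule add[OF DL xL])
      also have "p (\<nu> j) (\<lambda>t. X (Suc j) t - x t) \<le> \<kappa> (\<nu> j) * ((1/3) ^ j / 2)"
        by (rule order_trans[OF \<kappa>[OF DL] mult_left_mono[OF tail \<kappa>0]])
      finally have 1: "p (\<nu> j) (X (Suc j)) \<le> \<kappa> (\<nu> j) * ((1/3) ^ j / 2) + p (\<nu> j) x" by simp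
      have "(1/3) ^ j * (5/6 * \<kappa> (\<nu> j)) \<le> (1/3) ^ j * p (\<nu> j) (f j)"
        by (intro mult_left_mono f(2)) simp
      also have "\<dots> = p (\<nu> j) (e j)" unfolding e_def using cmult[OF fL(1), of "\<nu> j" "(1/3) ^ j" j] by simp
      finally have 2: "(1/3) ^ j * (5/6 * \<kappa> (\<nu> j)) \<le> p (\<nu> j) (X (Suc j))" using big[of j] by linarith
      have "(1/3) ^ j * 4 ^ j \<le> (1/3) ^ j * \<kappa> (\<nu> j)" using \<nu>[of j] by (intro mult_left_mono) auto
      moreover have "(1/3) ^ j * 4 ^ j = (4/3 :: real) ^ j" by (simp add: power_mult_distrib[symmetric])
      moreover have "\<kappa> (\<nu> j) * ((1/3) ^ j / 2) = ((1/3) ^ j * \<kappa> (\<nu> j)) / 2"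
        "(1/3) ^ j * (5/6 * \<kappa> (\<nu> j)) = 5/6 * ((1/3) ^ j * \<kappa> (\<nu> j))"
        by simp_all
      ultimately show ?thesis using 1 2 by linarith
    qed
    obtain B where B: "\<And>n. p n x \<le> B" using pointwise[OF xL] by blast
    obtain j where "3 * B < (4/3) ^ j" using real_arch_pow[of "4/3" "3 * B"] by auto
    then show False using low[of j] B[of "\<nu> j"] by linarith
  qed
  then obtain C where C: "\<And>n. \<kappa> n \<le> C" by blast
  show ?thesis
  proof (intro exI allI impI)
    fix n f assume f: "L2_fun M f"
    show "p n f \<le> C * nrm2 M f"
      by (rule order_trans[OF \<kappa>[OF f] mult_right_mono[OF C nrm2_nonneg]])
  qed
qed

section \<open>Polynomials and doubling weights\<close>

text \<open>Scale-invariant equivalence of norms on polynomials of degree below n: the values at n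
  nodes in [0,r] with mutual distance at least h r control the coefficients of p(r x). The constant
  depends on neither r nor the nodes.\<close>

definition coeff_bound :: "real \<Rightarrow> nat \<Rightarrow> real \<Rightarrow> bool" where
  "coeff_bound h n C \<longleftrightarrow> (\<forall>p t r M i. 0 < r \<longrightarrow> 0 \<le> M \<longrightarrow> (\<forall>i\<ge>n. coeff p i = 0) \<longrightarrow>
    (\<forall>q<n. 0 \<le> t q \<and> t q \<le> r \<and> \<bar>poly p (t q)\<bar> \<le> M) \<longrightarrow>
    (\<forall>q<n. \<forall>q'<n. q \<noteq> q' \<longrightarrow> h * r \<le> \<bar>t q - t q'\<bar>) \<longrightarrow> \<bar>coeff p i\<bar> * r ^ i \<le> C * M)"

lemma coeff_boundD:
  assumes "coeff_bound h n C" "0 < r" "0 \<le> M" "\<forall>i\<ge>n. coeff p i = 0"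
    "\<forall>q<n. 0 \<le> t q \<and> t q \<le> r \<and> \<bar>poly p (t q)\<bar> \<le> M"
    "\<forall>q<n. \<forall>q'<n. q \<noteq> q' \<longrightarrow> h * r \<le> \<bar>t q - t q'\<bar>"
  shows "\<bar>coeff p i\<bar> * r ^ i \<le> C * M"
  using assms unfolding coeff_bound_def by simp

text \<open>Induction by synthetic division at the last node c, p = (x - c) s + p(c). At the other
  nodes |t - c| is at least h r, so the quotient s is bounded there by 2M/(h r) and has one node
  less to satisfy.\<close>

lemma coeff_bound_exists:
  assumes "0 < (h::real)"
  shows "\<exists>C\<ge>0. coeff_bound h n C"
proof (induction n)
  case 0
  show ?case by (intro exI[of _ 0]) (auto simp: coeff_bound_def)
next
  case (Suc n)
  then obtain C where "C \<ge> 0" and C: "coeff_bound h n C" by blast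
  show ?case
    unfolding coeff_bound_def
  \<comment> \<open>A division costs the factor 2/h; each coefficient of \<open>p\<close> involves
    two coefficients of the quotient, and the constant one also the value p(c).\<close>
  proof (intro exI[of _ "4 * C / h + 1"] conjI allI impI)
    show "0 \<le> 4 * C / h + 1" using \<open>C \<ge> 0\<close> assms by simp
    fix p :: "real poly" and t :: "nat \<Rightarrow> real" and r M :: real and i :: nat
    assume r: "0 < r" and M: "0 \<le> M" and p: "\<forall>i\<ge>Suc n. coeff p i = 0"
      and t: "\<forall>q<Suc n. 0 \<le> t q \<and> t q \<le> r \<and> \<bar>poly p (t q)\<bar> \<le> M"
      and sep: "\<forall>q<Suc n. \<forall>q'<Suc n. q \<noteq> q' \<longrightarrow> h * r \<le> \<bar>t q - t q'\<bar>"
    define c where "c = t n"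
    define s where "s = synthetic_div p c"
    have ps: "p = [:- c, 1:] * s + [:poly p c:]"
      using synthetic_div_correct'[of c p] by (simp add: s_def)
    have c: "0 \<le> c" "c \<le> r" "\<bar>poly p c\<bar> \<le> M" using t by (auto simp: c_def)
    have dp: "degree p \<le> n" using p by (intro degree_le) auto
    have s0: "\<forall>i\<ge>n. coeff s i = 0"
    proof (intro allI impI)
      fix i assume "n \<le> i"
      show "coeff s i = 0"
      proof (cases "degree p = 0")
        case True
        then have "s = 0" by (simp add: s_def synthetic_div_eq_0_iff)
        then show ?thesis by simp
      next
        case False
        then have "degree s < i" using dp \<open>n \<le> i\<close> by (simp add: s_def degree_synthetic_div)
        then show ?thesis by (rule coeff_eq_0)
      qed
    qed
    have hr: "0 < h * r" using assms r by simp
    have sv: "\<bar>poly s (t q)\<bar> \<le> 2 * M / (h * r)" if q: "q < n" for q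
    proof -
      have "poly p (t q) - poly p c = (t q - c) * poly s (t q)"
        by (subst (1) ps) (simp add: algebra_simps)
      then have "\<bar>t q - c\<bar> * \<bar>poly s (t q)\<bar> = \<bar>poly p (t q) - poly p c\<bar>"
        by (simp add: abs_mult)
      also have "\<dots> \<le> 2 * M" using t[rule_format, of q] c(3) q by auto
      finally have 1: "\<bar>t q - c\<bar> * \<bar>poly s (t q)\<bar> \<le> 2 * M" .
      have "h * r * \<bar>poly s (t q)\<bar> \<le> \<bar>t q - c\<bar> * \<bar>poly s (t q)\<bar>"
        using sep q by (intro mult_right_mono) (auto simp: c_def)
      with 1 have "h * r * \<bar>poly s (t q)\<bar> \<le> 2 * M" by linarith
      then show ?thesis using hr by (simp add: pos_le_divide_eq mult.commute)
    qed
    define E where "E = C * (2 * M / (h * r))"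
    have E: "\<bar>coeff s i\<bar> * r ^ i \<le> E" for i
      unfolding E_def using s0 sv t sep r M hr by (intro coeff_boundD[OF C, of r _ s t]) auto
    have E0: "0 \<le> E" unfolding E_def using \<open>C \<ge> 0\<close> M hr by simp
    have rE: "r * E = 2 * C / h * M" using r assms by (simp add: E_def)
    have cs: "c * \<bar>coeff s i\<bar> * r ^ i \<le> r * E" for i
      using mult_mono[OF c(2) E[of i]] r c(1) by (simp add: mult.assoc)
    show "\<bar>coeff p i\<bar> * r ^ i \<le> (4 * C / h + 1) * M"
    proof (cases i)
      case 0
      have "coeff p 0 = poly p c - c * coeff s 0" by (subst (1) ps) simp
      then have "\<bar>coeff p 0\<bar> \<le> \<bar>poly p c\<bar> + c * \<bar>coeff s 0\<bar>" using c(1) abs_triangle_ineq4[of "poly p c" "c * coeff s 0"] by (simp add: abs_mult)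
      also have "\<dots> \<le> M + r * E" using c(3) cs[of 0] by simp
      also have "\<dots> \<le> (4 * C / h + 1) * M"
        unfolding rE using \<open>C \<ge> 0\<close> M assms by (simp add: algebra_simps divide_right_mono)
      finally show ?thesis using 0 by simp
    next
      case (Suc j)
      have "coeff p (Suc j) = coeff s j - c * coeff s (Suc j)" by (subst (1) ps) simp
      then have "\<bar>coeff p (Suc j)\<bar> \<le> \<bar>coeff s j\<bar> + c * \<bar>coeff s (Suc j)\<bar>"
        using c(1) abs_triangle_ineq4[of "coeff s j" "c * coeff s (Suc j)"] by (simp add: abs_mult)
      then have "\<bar>coeff p (Suc j)\<bar> * r ^ Suc j \<le> (\<bar>coeff s j\<bar> + c * \<bar>coeff s (Suc j)\<bar>) * r ^ Suc j"
        using r by (intro mult_right_mono) auto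
      also have "\<dots> = r * (\<bar>coeff s j\<bar> * r ^ j) + c * \<bar>coeff s (Suc j)\<bar> * r ^ Suc j"
        by (simp add: algebra_simps)
      also have "\<dots> \<le> r * E + r * E"
        using mult_left_mono[OF E[of j], of r] cs[of "Suc j"] r by linarith
      also have "\<dots> = 4 * C / h * M" unfolding rE by simp
      also have "\<dots> \<le> (4 * C / h + 1) * M" using M by (simp add: algebra_simps)
      finally show ?thesis using Suc by simp
    qed
  qed
qed

text \<open>Cut (0,r) into 2l cells and use every other one: points in different chosen cells are at
  least r/(2l) apart. If the polynomial were small somewhere in each of the l cells,
  \<open>coeff_bound\<close> would force its i-th coefficient below 1.\<close>

lemma poly_large_on_interval:
  fixes l :: nat
  assumes "0 < l"
  shows "\<exists>c>0. \<forall>(p::real poly) r i. 0 < r \<longrightarrow> (\<forall>j\<ge>l. coeff p j = 0) \<longrightarrow> coeff p i = 1 \<longrightarrow>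
    (\<exists>q<l. \<forall>t\<in>{2 * real q * r / (2 * real l)<..<(2 * real q + 1) * r / (2 * real l)}. c * r ^ i \<le> \<bar>poly p t\<bar>)"
proof -
  define N where "N = 2 * real l"
  have N: "N > 0" using assms by (simp add: N_def)
  obtain C where C0: "C \<ge> 0" and C: "coeff_bound (1 / N) l C"
    using coeff_bound_exists[of "1 / N" l] N by auto
  show ?thesis
  \<comment> \<open>Chosen so that \<open>C / (C + 1) < 1\<close> contradicts the coefficient being
    1.\<close>
  proof (intro exI[of _ "1 / (C + 1)"] conjI allI impI)
    show "0 < 1 / (C + 1)" using C0 by simp
    fix p :: "real poly" and r :: real and i
    assume r: "0 < r" and p: "\<forall>j\<ge>l. coeff p j = 0" "coeff p i = 1"
    define M where "M = 1 / (C + 1) * r ^ i"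
    show "\<exists>q<l. \<forall>t\<in>{2 * real q * r / (2 * real l)<..<(2 * real q + 1) * r / (2 * real l)}. 1 / (C + 1) * r ^ i \<le> \<bar>poly p t\<bar>"
    proof (rule ccontr)
      assume "\<not> ?thesis"
      then have "\<forall>q<l. \<exists>t\<in>{2 * real q * r / N<..<(2 * real q + 1) * r / N}. \<bar>poly p t\<bar> \<le> M"
        unfolding M_def N_def by (meson not_le less_imp_le)
      then have "\<forall>q. \<exists>t. q < l \<longrightarrow> t \<in> {2 * real q * r / N<..<(2 * real q + 1) * r / N} \<and> \<bar>poly p t\<bar> \<le> M"
        by blast
      then obtain t where t: "\<And>q. q < l \<Longrightarrow> t q \<in> {2 * real q * r / N<..<(2 * real q + 1) * r / N} \<and> \<bar>poly p (t q)\<bar> \<le> M"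
        by metis
      have sep1: "1 / N * r \<le> \<bar>t q - t q'\<bar>" if "q < l" "q' < l" "q < q'" for q q'
      proof -
        have "(2 * real q + 2) * r / N \<le> 2 * real q' * r / N"
          using that(3) r N by (intro divide_right_mono mult_right_mono) auto
        moreover have "(2 * real q + 2) * r / N = (2 * real q + 1) * r / N + 1 / N * r"
          by (simp add: add_divide_distrib algebra_simps)
        ultimately show ?thesis using t[OF that(1)] t[OF that(2)] by auto
      qed
      have "\<bar>coeff p i\<bar> * r ^ i \<le> C * M"
      proof (rule coeff_boundD[OF C r _ p(1)])
        show "0 \<le> M" using C0 r by (simp add: M_def)
        show "\<forall>q<l. \<forall>q'<l. q \<noteq> q' \<longrightarrow> 1 / N * r \<le> \<bar>t q - t q'\<bar>"
          using sep1 by (metis abs_minus_commute linorder_neqE_nat)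
        show "\<forall>q<l. 0 \<le> t q \<and> t q \<le> r \<and> \<bar>poly p (t q)\<bar> \<le> M"
        proof (intro allI impI)
          fix q assume q: "q < l"
          have "0 \<le> 2 * real q * r / N" using r N by simp
          moreover have "(2 * real q + 1) * r / N \<le> N * r / N"
            using q r N by (intro divide_right_mono mult_right_mono) (auto simp: N_def)
          then have "(2 * real q + 1) * r / N \<le> r" using N by simp
          ultimately show "0 \<le> t q \<and> t q \<le> r \<and> \<bar>poly p (t q)\<bar> \<le> M" using t[OF q] by auto
        qed
      qed
      then have "(C + 1) * r ^ i \<le> C * r ^ i" using p(2) C0 by (simp add: M_def field_simps)
      then show False using zero_less_power[OF r, of i] by (simp add: algebra_simps)
    qed
  qed
qed

text \<open>The middle half of the enlarged interval lies inside (a,b). Clipping at 0 moves the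
  centre to the right, and \<open>4 * s \<le> b - a\<close> leaves room for that.\<close>

lemma doubling_step:
  fixes \<nu> :: "real \<Rightarrow> real \<Rightarrow> ennreal"
  assumes mono: "\<And>a b a' b'. a' \<le> a \<Longrightarrow> b \<le> b' \<Longrightarrow> \<nu> a b \<le> \<nu> a' b'"
    and doubling: "\<And>a b. 0 \<le> a \<Longrightarrow> a < b \<Longrightarrow> \<delta> \<le> b - a \<Longrightarrow> \<nu> a b \<le> D * \<nu> ((3 * a + b) / 4) ((a + 3 * b) / 4)"
    and ab: "0 \<le> a" "4 * s \<le> b - a" "0 < s" "\<delta> \<le> 4 * s"
  shows "\<nu> (max 0 (a - s)) (b + s) \<le> D * \<nu> a b"
proof -
  define a' where "a' = max 0 (a - s)"
  have "\<nu> a' (b + s) \<le> D * \<nu> ((3 * a' + (b + s)) / 4) ((a' + 3 * (b + s)) / 4)"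
    using ab by (intro doubling) (auto simp: a'_def)
  also have "\<dots> \<le> D * \<nu> a b"
    using ab by (intro mult_left_mono mono) (auto simp: a'_def max_def)
  finally show ?thesis by (simp add: a'_def)
qed

lemma doubling_iterate:
  fixes \<nu> :: "real \<Rightarrow> real \<Rightarrow> ennreal"
  assumes mono: "\<And>a b a' b'. a' \<le> a \<Longrightarrow> b \<le> b' \<Longrightarrow> \<nu> a b \<le> \<nu> a' b'"
    and doubling: "\<And>a b. 0 \<le> a \<Longrightarrow> a < b \<Longrightarrow> \<delta> \<le> b - a \<Longrightarrow> \<nu> a b \<le> D * \<nu> ((3 * a + b) / 4) ((a + 3 * b) / 4)"
    and ab: "0 \<le> a" "4 * s \<le> b - a" "0 < s" "\<delta> \<le> 4 * s"
  shows "\<nu> (max 0 (a - real n * s)) (b + real n * s) \<le> D ^ n * \<nu> a b"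
proof (induction n)
  case 0 then show ?case using ab(1) by simp
next
  case (Suc n)
  let ?a = "max 0 (a - real n * s)" and ?b = "b + real n * s"
  have ns: "0 \<le> real n * s" using ab(3) by simp
  have "max 0 (a - real (Suc n) * s) = max 0 (?a - s)" "b + real (Suc n) * s = ?b + s"
    using ab(3) by (auto simp: algebra_simps max_def)
  then have "\<nu> (max 0 (a - real (Suc n) * s)) (b + real (Suc n) * s) = \<nu> (max 0 (?a - s)) (?b + s)" by (simp only:)
  also have "\<dots> \<le> D * \<nu> ?a ?b"
  proof (rule doubling_step[where \<nu>=\<nu> and \<delta>=\<delta>, OF mono doubling])
    have "?a \<le> a" using ns ab(1) by simp
    then show "4 * s \<le> ?b - ?a" using ns ab(2) by linarith
  qed (use ab in auto)
  also have "\<dots> \<le> D * (D ^ n * \<nu> a b)" by (intro mult_left_mono Suc.IH) simp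
  finally show ?case by (simp add: mult.assoc)
qed

section \<open>Orthogonal projection onto spans of monomials\<close>

definition supported_poly :: "nat set \<Rightarrow> real poly \<Rightarrow> bool" where
  "supported_poly J p \<longleftrightarrow> (\<forall>j. j \<notin> J \<longrightarrow> coeff p j = 0)"

lemma supported_poly_add: "supported_poly J p \<Longrightarrow> supported_poly J q \<Longrightarrow> supported_poly J (p + q)"
  and supported_poly_smult: "supported_poly J p \<Longrightarrow> supported_poly J (smult c p)"
  and supported_poly_subset: "supported_poly J p \<Longrightarrow> J \<subseteq> J' \<Longrightarrow> supported_poly J' p"
  by (auto simp: supported_poly_def)

text \<open>Gram-Schmidt, one exponent at a time. The form may be degenerate, so a new direction
  \<open>e\<close> with \<open>B e e = 0\<close> has to be treated separately.\<close>

lemma projection_exists: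
  fixes B :: "real poly \<Rightarrow> real poly \<Rightarrow> real"
  assumes add: "\<And>p q s. B (p + q) s = B p s + B q s" and smult: "\<And>c p s. B (smult c p) s = c * B p s"
    and sym: "\<And>p q. B p q = B q p" and nonneg: "\<And>p. 0 \<le> B p p"
    and "finite J"
  shows "\<exists>y. supported_poly J y \<and> (\<forall>q. supported_poly J q \<longrightarrow> B (p - y) q = 0)"
  using \<open>finite J\<close>
proof (induction J arbitrary: p rule: finite_induct)
  case empty
  have "B (p - 0) 0 = 0" for p using smult[of 0 0 p] sym[of 0 p] by simp
  moreover have "supported_poly {} q \<Longrightarrow> q = 0" for q by (simp add: supported_poly_def poly_eq_iff)
  ultimately show ?case by (intro exI[of _ 0]) (auto simp: supported_poly_def)
next
  case (insert n J)
  have addr: "B p (q + s) = B p q + B p s" for p q s using add[of q s p] sym by metis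
  have smultr: "B p (smult c q) = c * B p q" for c p q using smult[of c q p] sym by metis
  obtain y0 where y0: "supported_poly J y0" "\<And>q. supported_poly J q \<Longrightarrow> B (monom 1 n - y0) q = 0"
    using insert.IH[of "monom 1 n"] by blast
  obtain y1 where y1: "supported_poly J y1" "\<And>q. supported_poly J q \<Longrightarrow> B (p - y1) q = 0"
    using insert.IH[of p] by blast
  define e where "e = monom 1 n - y0"
  \<comment> \<open>If \<open>B e e = 0\<close>, division yields c = 0, and the claim reduces to
    \<open>B (p - y1) e = 0\<close>.\<close>
  define c where "c = B (p - y1) e / B e e"
  define y where "y = y1 + smult c e"
  have eS: "supported_poly (insert n J) e"
    using y0(1) by (auto simp: e_def supported_poly_def)
  have Be: "B (p - y) e = 0"
  proof -
    have "B (p - y) e = B ((p - y1) + smult (- c) e) e" by (simp add: y_def diff_diff_eq)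
    also have "\<dots> = B (p - y1) e - c * B e e" by (simp only: add smult)
    also have "\<dots> = 0"
    proof (cases "B e e = 0")
      case True
      define b where "b = B (p - y1) e"
      have "0 \<le> B (p - y1) (p - y1) + 2 * s * b" for s
      proof -
        have "0 \<le> B ((p - y1) + smult s e) ((p - y1) + smult s e)" by (rule nonneg)
        also have "\<dots> = B (p - y1) (p - y1) + 2 * s * b + s\<^sup>2 * B e e"
          by (simp add: add addr smult smultr b_def sym[of e "p - y1"] power2_eq_square distrib_left mult.assoc)
        finally show ?thesis using True by simp
      qed
      \<comment> \<open>An affine function of s that is never negative has slope 0; at this s it
        would take the value -1.\<close>
      from this[of "- (B (p - y1) (p - y1) + 1) / (2 * b)"] have "b = 0"
        by (cases "b = 0") (auto simp: field_simps)
      then show ?thesis using True by (simp add: b_def)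
    qed (simp add: c_def)
    finally show ?thesis .
  qed
  have "B (p - y) q = 0" if q: "supported_poly (insert n J) q" for q
  proof -
    define q0 where "q0 = (q - monom (coeff q n) n) + smult (coeff q n) y0"
    have "supported_poly J (q - monom (coeff q n) n)"
      using q by (auto simp: supported_poly_def)
    then have q0: "supported_poly J q0"
      unfolding q0_def using y0(1) by (intro supported_poly_add supported_poly_smult)
    have eq: "q = smult (coeff q n) e + q0"
      by (simp add: q0_def e_def smult_diff_right smult_monom)
    have "B (p - y) q0 = B ((p - y1) + smult (- c) e) q0" by (simp add: y_def diff_diff_eq)
    also have "\<dots> = B (p - y1) q0 - c * B e q0" by (simp only: add smult)
    also have "\<dots> = 0" using y1(2)[OF q0] y0(2)[OF q0] by (simp add: e_def)
    finally show ?thesis by (subst eq) (simp add: addr smultr Be)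
  qed
  moreover have "supported_poly (insert n J) y"
    unfolding y_def using y1(1) eS
    by (intro supported_poly_add supported_poly_smult) (auto intro: supported_poly_subset)
  ultimately show ?case by blast
qed

section \<open>Boundedness of the integral operator\<close>

definition L2_near0 :: "(real \<Rightarrow> real) \<Rightarrow> bool" where
  "L2_near0 b \<longleftrightarrow> b \<in> borel_measurable half_line \<and> (\<forall>r. L2_fun half_line (\<lambda>t. indicator {..r} t * b t))"

lemma L2_near0_mult_L1_0:
  assumes b: "L2_near0 b" and h: "L2_fun half_line h"
  shows "L1_0 (\<lambda>t. b t * h t)"
proof (rule L1_0I)
  have [measurable]: "b \<in> borel_measurable half_line" "h \<in> borel_measurable half_line"
    using b h by (auto simp: L2_near0_def L2_fun_def)
  show "(\<lambda>t. b t * h t) \<in> borel_measurable half_line" by measurable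
  fix r
  have "(\<integral>\<^sup>+t. ennreal \<bar>b t * h t\<bar> * indicator {..r} t \<partial>half_line) = (\<integral>\<^sup>+t. ennreal \<bar>(indicator {..r} t * b t) * h t\<bar> \<partial>half_line)"
    by (intro nn_integral_cong) (auto simp: indicator_def)
  also have "\<dots> < \<infinity>"
    using Cauchy_Schwarz_L2[of half_line "\<lambda>t. indicator {..r} t * b t" h] b h
    by (auto simp: L2_near0_def intro: le_less_trans)
  finally show "(\<integral>\<^sup>+t. ennreal \<bar>b t * h t\<bar> * indicator {..r} t \<partial>half_line) < \<infinity>" .
qed

lemma abs_integral_le_nn_integral:
  assumes f: "L1_0 f"
  shows "ennreal \<bar>integral {0..x} f\<bar> \<le> (\<integral>\<^sup>+t. (if t \<le> x then ennreal \<bar>f t\<bar> else 0) \<partial>half_line)"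
proof -
  have i: "integrable (lebesgue_on {0..x}) f" by (rule L1_0_integrable[OF f])
  have "ennreal \<bar>integral {0..x} f\<bar> = ennreal (norm (LINT t|lebesgue_on {0..x}. f t))"
    by (subst lebesgue_integral_eq_integral[OF i]) auto
  also have "\<dots> \<le> (\<integral>\<^sup>+t. ennreal (norm (f t)) \<partial>lebesgue_on {0..x})"
    by (rule integral_norm_bound_ennreal[OF i])
  also have "\<dots> = (\<integral>\<^sup>+t. ennreal \<bar>f t\<bar> * indicator {0..x} t \<partial>lebesgue)"
    by (subst nn_integral_restrict_space) auto
  also have "\<dots> = (\<integral>\<^sup>+t. (if t \<le> x then ennreal \<bar>f t\<bar> else 0) * indicator {0<..} t \<partial>lebesgue)"
  proof (rule nn_integral_cong_AE)
    have "AE t in lebesgue. t \<noteq> (0::real)"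
      using AE_not_in[of "{0::real}" lebesgue] by (auto elim: eventually_mono)
    then show "AE t in lebesgue. ennreal \<bar>f t\<bar> * indicator {0..x} t = (if t \<le> x then ennreal \<bar>f t\<bar> else 0) * indicator {0<..} t"
      by eventually_elim (auto simp: indicator_def)
  qed
  also have "\<dots> = (\<integral>\<^sup>+t. (if t \<le> x then ennreal \<bar>f t\<bar> else 0) \<partial>half_line)"
    by (subst nn_integral_restrict_space) auto
  finally show ?thesis .
qed

lemma abs_integral_le_nrm2:
  assumes b: "L2_near0 b" and h: "L2_fun half_line h" and x: "x \<le> r"
  shows "\<bar>integral {0..x} (\<lambda>t. b t * h t)\<bar> \<le> nrm2 half_line (\<lambda>t. indicator {..r} t * b t) * nrm2 half_line h"
proof -
  have "ennreal \<bar>integral {0..x} (\<lambda>t. b t * h t)\<bar> \<le> (\<integral>\<^sup>+t. (if t \<le> x then ennreal \<bar>b t * h t\<bar> else 0) \<partial>half_line)"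
    by (rule abs_integral_le_nn_integral[OF L2_near0_mult_L1_0[OF b h]])
  also have "\<dots> \<le> (\<integral>\<^sup>+t. ennreal \<bar>(indicator {..r} t * b t) * h t\<bar> \<partial>half_line)"
    using x by (intro nn_integral_mono) (auto simp: indicator_def)
  also have "\<dots> \<le> ennreal (nrm2 half_line (\<lambda>t. indicator {..r} t * b t) * nrm2 half_line h)"
    using b h by (intro Cauchy_Schwarz_L2) (auto simp: L2_near0_def)
  finally show ?thesis by (simp add: nrm2_nonneg)
qed

lemma integral_op_measurable:
  assumes "L2_near0 b" "L2_fun half_line h"
  shows "(\<lambda>x. integral {0..x} (\<lambda>t. b t * h t)) \<in> borel_measurable half_line"
  by (rule L1_0_measurable[OF primitive_L1_0[OF primitive_integral[OF L2_near0_mult_L1_0[OF assms]]]])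

lemma nn_integral_half_line_open_closed:
  "(\<integral>\<^sup>+x. (if r \<le> x then f x else 0) \<partial>half_line) = (\<integral>\<^sup>+x. f x * indicator {r<..} x \<partial>half_line)"
  "(\<integral>\<^sup>+x. (if x \<le> r then f x else 0) \<partial>half_line) = (\<integral>\<^sup>+x. f x * indicator {..<r} x \<partial>half_line)"
proof -
  have "AE t in lebesgue. t \<noteq> r"
    using AE_not_in[of "{r}" lebesgue] by (auto elim: eventually_mono)
  then have "AE t in half_line. t \<noteq> r" unfolding AE_half_line by (auto elim: eventually_mono)
  then show "(\<integral>\<^sup>+x. (if r \<le> x then f x else 0) \<partial>half_line) = (\<integral>\<^sup>+x. f x * indicator {r<..} x \<partial>half_line)"
    "(\<integral>\<^sup>+x. (if x \<le> r then f x else 0) \<partial>half_line) = (\<integral>\<^sup>+x. f x * indicator {..<r} x \<partial>half_line)"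
    by (intro nn_integral_cong_AE; eventually_elim; auto simp: indicator_def)+
qed

text \<open>The square root appears because \<open>hardy\<close> bounds squared norms. The open rays
  of the condition and the closed ones of \<open>hardy\<close> differ by a single point.\<close>

lemma hardy_real:
  assumes a: "L2_fun half_line a" and b: "L2_near0 b" and h: "L2_fun half_line h" and A0: "0 \<le> A"
    and A: "\<And>r. 0 < r \<Longrightarrow> (\<integral>\<^sup>+x. ennreal ((a x)\<^sup>2) * indicator {r<..} x \<partial>half_line) *
       (\<integral>\<^sup>+t. ennreal ((b t)\<^sup>2) * indicator {..<r} t \<partial>half_line) \<le> ennreal A"
  shows "L2_fun half_line (\<lambda>x. a x * integral {0..x} (\<lambda>t. b t * h t))"
    and "nrm2 half_line (\<lambda>x. a x * integral {0..x} (\<lambda>t. b t * h t)) \<le> sqrt (8 * A) * nrm2 half_line h"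
proof -
  have [measurable]: "a \<in> borel_measurable half_line" "b \<in> borel_measurable half_line" "h \<in> borel_measurable half_line"
    using a b h by (auto simp: L2_near0_def L2_fun_def)
  have [measurable]: "(\<lambda>x. integral {0..x} (\<lambda>t. b t * h t)) \<in> borel_measurable half_line"
    by (rule integral_op_measurable[OF b h])
  have pw: "ennreal (y\<^sup>2) = (ennreal \<bar>y\<bar>)\<^sup>2" for y :: real by (simp add: ennreal_power)
  have "(\<integral>\<^sup>+x. ennreal ((a x * integral {0..x} (\<lambda>t. b t * h t))\<^sup>2) \<partial>half_line) \<le>
    (\<integral>\<^sup>+x. (ennreal \<bar>a x\<bar> * (\<integral>\<^sup>+t. (if t \<le> x then ennreal \<bar>b t\<bar> * ennreal \<bar>h t\<bar> else 0) \<partial>half_line))\<^sup>2 \<partial>half_line)"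
  proof (rule nn_integral_mono)
    fix x
    have "ennreal \<bar>integral {0..x} (\<lambda>t. b t * h t)\<bar> \<le> (\<integral>\<^sup>+t. (if t \<le> x then ennreal \<bar>b t\<bar> * ennreal \<bar>h t\<bar> else 0) \<partial>half_line)"
      using abs_integral_le_nn_integral[OF L2_near0_mult_L1_0[OF b h]] by (simp only: abs_mult ennreal_mult abs_ge_zero)
    then show "ennreal ((a x * integral {0..x} (\<lambda>t. b t * h t))\<^sup>2) \<le>
      (ennreal \<bar>a x\<bar> * (\<integral>\<^sup>+t. (if t \<le> x then ennreal \<bar>b t\<bar> * ennreal \<bar>h t\<bar> else 0) \<partial>half_line))\<^sup>2"
      unfolding pw abs_mult by (simp only: ennreal_mult abs_ge_zero) (intro power_mono mult_left_mono; simp)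
  qed
  also have "\<dots> \<le> 8 * ennreal A * (\<integral>\<^sup>+x. (ennreal \<bar>h x\<bar>)\<^sup>2 \<partial>half_line)"
  proof (rule half_line.hardy[of "\<lambda>x. x"])
    fix r :: real assume "r \<in> space half_line"
    then have r: "0 < r" by simp
    show "(\<integral>\<^sup>+x. (if r \<le> x then (ennreal \<bar>a x\<bar>)\<^sup>2 else 0) \<partial>half_line) * (\<integral>\<^sup>+t. (if t \<le> r then (ennreal \<bar>b t\<bar>)\<^sup>2 else 0) \<partial>half_line) \<le> ennreal A"
      using A[OF r] unfolding nn_integral_half_line_open_closed pw .
    have "(\<integral>\<^sup>+t. (if t \<le> r then (ennreal \<bar>b t\<bar>)\<^sup>2 else 0) \<partial>half_line) = (\<integral>\<^sup>+t. ennreal ((indicator {..r} t * b t)\<^sup>2) \<partial>half_line)"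
      by (intro nn_integral_cong) (auto simp: indicator_def ennreal_power)
    then show "(\<integral>\<^sup>+t. (if t \<le> r then (ennreal \<bar>b t\<bar>)\<^sup>2 else 0) \<partial>half_line) < \<infinity>"
      using b by (simp add: L2_near0_def L2_fun_def)
  next
    show "(\<integral>\<^sup>+x. (ennreal \<bar>a x\<bar>)\<^sup>2 \<partial>half_line) < \<infinity>" using a by (simp add: L2_fun_def flip: pw)
    show "(\<integral>\<^sup>+x. (ennreal \<bar>h x\<bar>)\<^sup>2 \<partial>half_line) < \<infinity>" using h by (simp add: L2_fun_def flip: pw)
  qed measurable
  also have "\<dots> = 8 * ennreal A * ennreal ((nrm2 half_line h)\<^sup>2)"
    using nrm2_square[OF h] by (simp only: pw)
  also have "\<dots> = ennreal ((sqrt (8 * A) * nrm2 half_line h)\<^sup>2)"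
    using A0 by (simp add: power_mult_distrib ennreal_mult)
  finally have "(\<integral>\<^sup>+x. ennreal ((a x * integral {0..x} (\<lambda>t. b t * h t))\<^sup>2) \<partial>half_line) \<le> ennreal ((sqrt (8 * A) * nrm2 half_line h)\<^sup>2)" .
  from L2_fun_boundI[OF _ this]
  show "L2_fun half_line (\<lambda>x. a x * integral {0..x} (\<lambda>t. b t * h t))"
    "nrm2 half_line (\<lambda>x. a x * integral {0..x} (\<lambda>t. b t * h t)) \<le> sqrt (8 * A) * nrm2 half_line h"
    using A0 nrm2_nonneg[of half_line h] by auto
qed

text \<open>The form that multiplication by \<phi> takes on the level of square integrable
  functions: finitely many Hardy operators, with outer weights \<open>a\<close> and inner weights
  \<open>b\<close>, plus multiplication by \<open>e\<close>.\<close>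

definition integral_op ::
  "nat \<Rightarrow> (nat \<Rightarrow> real \<Rightarrow> real) \<Rightarrow> (nat \<Rightarrow> real \<Rightarrow> real) \<Rightarrow> (real \<Rightarrow> real) \<Rightarrow> (real \<Rightarrow> real) \<Rightarrow> real \<Rightarrow> real" where
  "integral_op l a b e h x = (\<Sum>k<l. a k x * integral {0..x} (\<lambda>t. b k t * h t)) + e x * h x"

lemma integral_op_add:
  assumes b: "\<And>k. k < l \<Longrightarrow> L2_near0 (b k)" and f: "L2_fun half_line f" and g: "L2_fun half_line g"
  shows "integral_op l a b e (\<lambda>x. f x + g x) x = integral_op l a b e f x + integral_op l a b e g x"
proof -
  have "integral {0..x} (\<lambda>t. b k t * (f t + g t)) = integral {0..x} (\<lambda>t. b k t * f t) + integral {0..x} (\<lambda>t. b k t * g t)" if "k < l" for k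
    unfolding distrib_left
    by (intro Henstock_Kurzweil_Integration.integral_add L1_0_integrable_on L2_near0_mult_L1_0 b that f g)
  then show ?thesis by (simp add: integral_op_def algebra_simps sum.distrib)
qed

lemma integral_op_cmult:
  "integral_op l a b e (\<lambda>x. c * f x) x = c * integral_op l a b e f x"
proof -
  have "integral {0..x} (\<lambda>t. b k t * (c * f t)) = c * integral {0..x} (\<lambda>t. b k t * f t)" for k
    using integral_mult_right[of "{0..x}" c "\<lambda>t. b k t * f t"] by (simp only: mult.left_commute)
  then show ?thesis by (simp add: integral_op_def sum_distrib_left algebra_simps)
qed

text \<open>The operator is only known to map into the square integrable functions. Its truncations
  are bounded one by one and are pointwise dominated by it, so uniform boundedness yields a common
  constant, and monotone convergence transfers it to the full operator.\<close>

lemma integral_op_bounded: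
  assumes a: "\<And>k. k < l \<Longrightarrow> L2_fun half_line (a k)" and b: "\<And>k. k < l \<Longrightarrow> L2_near0 (b k)"
    and e[measurable]: "e \<in> borel_measurable half_line"
    and T: "\<And>h. L2_fun half_line h \<Longrightarrow> L2_fun half_line (integral_op l a b e h)"
  shows "\<exists>C\<ge>0. \<forall>h. L2_fun half_line h \<longrightarrow> nrm2 half_line (integral_op l a b e h) \<le> C * nrm2 half_line h"
proof -
  \<comment> \<open>For x \<le> n the inner integrals are bounded by Cauchy and Schwarz, and
    \<bar>e\<bar> \<le> n bounds the multiplication part: exactly what the truncation needs.\<close>
  define E where "E n = {x. x \<le> real n \<and> \<bar>e x\<bar> \<le> real n}" for n
  have [measurable]: "E n \<inter> space half_line \<in> sets half_line" for n
  proof -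
    have "{x \<in> space half_line. x \<le> real n \<and> \<bar>e x\<bar> \<le> real n} \<in> sets half_line" by measurable
    also have "{x \<in> space half_line. x \<le> real n \<and> \<bar>e x\<bar> \<le> real n} = E n \<inter> space half_line" by (auto simp: E_def)
    finally show ?thesis .
  qed
  define T' where "T' n h x = indicator (E n) x * integral_op l a b e h x" for n h x
  have T'L: "L2_fun half_line (T' n h)" "nrm2 half_line (T' n h) \<le> nrm2 half_line (integral_op l a b e h)"
    if h: "L2_fun half_line h" for n h
  proof -
    have [measurable]: "integral_op l a b e h \<in> borel_measurable half_line" using T[OF h] by (rule L2_fun_measurable)
    have "T' n h \<in> borel_measurable half_line"
    proof -
      have "(\<lambda>x. if x \<le> real n \<and> \<bar>e x\<bar> \<le> real n then integral_op l a b e h x else 0) \<in> borel_measurable half_line"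
        by measurable
      also have "(\<lambda>x. if x \<le> real n \<and> \<bar>e x\<bar> \<le> real n then integral_op l a b e h x else 0) = T' n h"
        by (auto simp: T'_def E_def indicator_def)
      finally show ?thesis .
    qed
    then show "L2_fun half_line (T' n h)" "nrm2 half_line (T' n h) \<le> nrm2 half_line (integral_op l a b e h)"
      by (rule L2_fun_mono[OF _ T[OF h]]; auto simp: T'_def indicator_def)+
  qed
  have "\<exists>C. \<forall>n h. L2_fun half_line h \<longrightarrow> nrm2 half_line (T' n h) \<le> C * nrm2 half_line h"
  proof (rule uniform_boundedness[where K="\<lambda>n. (\<Sum>k<l. nrm2 half_line (a k) * nrm2 half_line (\<lambda>t. indicator {..real n} t * b k t)) + real n"])
    show "0 \<le> nrm2 half_line (T' n h)" for n h by (rule nrm2_nonneg)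
    show "nrm2 half_line (T' n (\<lambda>x. f x + g x)) \<le> nrm2 half_line (T' n f) + nrm2 half_line (T' n g)"
      if fg: "L2_fun half_line f" "L2_fun half_line g" for n f g
    proof -
      have "T' n (\<lambda>x. f x + g x) = (\<lambda>x. T' n f x + T' n g x)"
        unfolding T'_def using integral_op_add[of l b, OF b fg] by (simp add: distrib_left)
      then show ?thesis using L2_fun_add(2)[OF T'L(1)[OF fg(1)] T'L(1)[OF fg(2)]] by simp
    qed
    show "nrm2 half_line (T' n (\<lambda>x. c * f x)) = \<bar>c\<bar> * nrm2 half_line (T' n f)"
      if f: "L2_fun half_line f" for n c f
    proof -
      have "T' n (\<lambda>x. c * f x) = (\<lambda>x. c * T' n f x)"
        unfolding T'_def integral_op_cmult by (simp add: mult.left_commute)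
      then show ?thesis using L2_fun_cmult(2)[OF T'L(1)[OF f]] by simp
    qed
    show "\<exists>B. \<forall>n. nrm2 half_line (T' n f) \<le> B" if "L2_fun half_line f" for f
      using T'L(2)[OF that] by blast
    show "nrm2 half_line (T' n f) \<le>
       ((\<Sum>k<l. nrm2 half_line (a k) * nrm2 half_line (\<lambda>t. indicator {..real n} t * b k t)) + real n) * nrm2 half_line f"
      if f: "L2_fun half_line f" for n f
    proof -
      define \<beta> where "\<beta> k = nrm2 half_line (\<lambda>t. indicator {..real n} t * b k t) * nrm2 half_line f" for k
      have \<beta>0: "0 \<le> \<beta> k" for k by (simp add: \<beta>_def nrm2_nonneg)
      let ?g = "\<lambda>x. (\<Sum>k<l. \<beta> k * \<bar>a k x\<bar>) + real n * \<bar>f x\<bar>"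
      have aL: "L2_fun half_line (\<lambda>x. \<beta> k * \<bar>a k x\<bar>)" "nrm2 half_line (\<lambda>x. \<beta> k * \<bar>a k x\<bar>) = \<beta> k * nrm2 half_line (a k)" if "k < l" for k
        using L2_fun_cmult[OF L2_fun_abs(1)[OF a[OF that]], of "\<beta> k"] L2_fun_abs(2)[OF a[OF that]] \<beta>0 by auto
      have fL: "L2_fun half_line (\<lambda>x. real n * \<bar>f x\<bar>)" "nrm2 half_line (\<lambda>x. real n * \<bar>f x\<bar>) = real n * nrm2 half_line f"
        using L2_fun_cmult[OF L2_fun_abs(1)[OF f], of "real n"] L2_fun_abs(2)[OF f] by auto
      have sL: "L2_fun half_line (\<lambda>x. \<Sum>k<l. \<beta> k * \<bar>a k x\<bar>) \<and>
          nrm2 half_line (\<lambda>x. \<Sum>k<l. \<beta> k * \<bar>a k x\<bar>) \<le> (\<Sum>k<l. nrm2 half_line (\<lambda>x. \<beta> k * \<bar>a k x\<bar>))"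
        by (rule L2_fun_sum) (use aL in auto)
      have gL: "L2_fun half_line ?g" "nrm2 half_line ?g \<le> (\<Sum>k<l. \<beta> k * nrm2 half_line (a k)) + real n * nrm2 half_line f"
        using L2_fun_add[OF conjunct1[OF sL] fL(1)] sL aL(2) fL(2) by auto
      have "\<bar>T' n f x\<bar> \<le> \<bar>?g x\<bar>" for x
      proof (cases "x \<in> E n")
        case True
        then have x: "x \<le> real n" "\<bar>e x\<bar> \<le> real n" by (auto simp: E_def)
        have "\<bar>T' n f x\<bar> \<le> \<bar>\<Sum>k<l. a k x * integral {0..x} (\<lambda>t. b k t * f t)\<bar> + \<bar>e x * f x\<bar>"
          using True by (simp add: T'_def integral_op_def)
        also have "\<dots> \<le> (\<Sum>k<l. \<bar>a k x * integral {0..x} (\<lambda>t. b k t * f t)\<bar>) + \<bar>e x * f x\<bar>"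
          by (intro add_right_mono sum_abs)
        also have "\<dots> \<le> ?g x"
        proof (intro add_mono sum_mono)
          fix k assume "k \<in> {..<l}"
          then have "\<bar>integral {0..x} (\<lambda>t. b k t * f t)\<bar> \<le> \<beta> k"
            unfolding \<beta>_def by (intro abs_integral_le_nrm2 b f x) simp
          then show "\<bar>a k x * integral {0..x} (\<lambda>t. b k t * f t)\<bar> \<le> \<beta> k * \<bar>a k x\<bar>"
            unfolding abs_mult mult.commute[of "\<beta> k"] by (rule mult_left_mono) simp
        next
          show "\<bar>e x * f x\<bar> \<le> real n * \<bar>f x\<bar>" using x(2) by (simp add: abs_mult mult_right_mono)
        qed
        finally show ?thesis by simp
      qed (simp add: T'_def)
      then have "nrm2 half_line (T' n f) \<le> nrm2 half_line ?g"
        by (intro L2_fun_mono(2)[OF L2_fun_measurable[OF T'L(1)[OF f]] gL(1)]) simp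
      also note gL(2)
      also have "(\<Sum>k<l. \<beta> k * nrm2 half_line (a k)) + real n * nrm2 half_line f =
        ((\<Sum>k<l. nrm2 half_line (a k) * nrm2 half_line (\<lambda>t. indicator {..real n} t * b k t)) + real n) * nrm2 half_line f"
        unfolding distrib_right sum_distrib_right by (simp add: \<beta>_def mult_ac)
      finally show ?thesis .
    qed
  qed
  then obtain C where C: "\<And>n h. L2_fun half_line h \<Longrightarrow> nrm2 half_line (T' n h) \<le> C * nrm2 half_line h" by blast
  \<comment> \<open>Uniform boundedness makes no claim about the sign of its constant, which matters
    for the squares below.\<close>
  define C' where "C' = max C 0"
  have C': "nrm2 half_line (T' n h) \<le> C' * nrm2 half_line h" if "L2_fun half_line h" for n h
    using C[OF that, of n] mult_right_mono[of C C' "nrm2 half_line h"] nrm2_nonneg[of half_line h] by (simp add: C'_def)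
  have C0: "0 \<le> C'" by (simp add: C'_def)
  show ?thesis
  proof (intro exI[of _ C'] conjI allI impI C0)
    fix h assume h: "L2_fun half_line h"
    have [measurable]: "T' n h \<in> borel_measurable half_line" for n by (rule L2_fun_measurable[OF T'L(1)[OF h]])
    have "(\<integral>\<^sup>+x. ennreal ((integral_op l a b e h x)\<^sup>2) \<partial>half_line) = (\<integral>\<^sup>+x. (SUP n. ennreal ((T' n h x)\<^sup>2)) \<partial>half_line)"
    proof (intro nn_integral_cong antisym)
      fix x
      obtain n where "max x \<bar>e x\<bar> \<le> real n" using real_arch_simple by blast
      then have "integral_op l a b e h x = T' n h x" by (simp add: T'_def E_def)
      then show "ennreal ((integral_op l a b e h x)\<^sup>2) \<le> (SUP n. ennreal ((T' n h x)\<^sup>2))"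
        by (metis SUP_upper UNIV_I)
      show "(SUP n. ennreal ((T' n h x)\<^sup>2)) \<le> ennreal ((integral_op l a b e h x)\<^sup>2)"
        by (intro SUP_least) (auto simp: T'_def indicator_def)
    qed
    also have "\<dots> = (SUP n. \<integral>\<^sup>+x. ennreal ((T' n h x)\<^sup>2) \<partial>half_line)"
    proof (rule nn_integral_monotone_convergence_SUP)
      show "incseq (\<lambda>n x. ennreal ((T' n h x)\<^sup>2))"
        by (intro incseq_SucI le_funI ennreal_leI) (auto simp: T'_def E_def indicator_def)
    qed measurable
    also have "\<dots> \<le> ennreal ((C' * nrm2 half_line h)\<^sup>2)"
      unfolding nrm2_square[OF T'L(1)[OF h]]
      by (intro SUP_least ennreal_leI power_mono C' h nrm2_nonneg)
    finally show "nrm2 half_line (integral_op l a b e h) \<le> C' * nrm2 half_line h"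
      using L2_fun_boundI(2)[OF L2_fun_measurable[OF T[OF h]]] C0 nrm2_nonneg[of half_line h] by simp
  qed
qed

text \<open>Tested on the indicator of a set where \<bar>e\<bar> exceeds C + 1, the bound reads (C +
  1)^2 \<mu> \<le> C^2 \<mu> for its measure \<mu>, so \<mu> = 0. Restricting to x \<le> n keeps
  \<mu> finite.\<close>

lemma essentially_bounded_multiplier:
  assumes [measurable]: "e \<in> borel_measurable half_line"
    and bound: "\<And>h. L2_fun half_line h \<Longrightarrow> nrm2 half_line (\<lambda>x. e x * h x) \<le> C * nrm2 half_line h"
    and L: "\<And>h. L2_fun half_line h \<Longrightarrow> L2_fun half_line (\<lambda>x. e x * h x)" and C0: "0 \<le> C"
  shows "AE x in half_line. \<bar>e x\<bar> \<le> C + 1"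
proof -
  have "AE x in half_line. \<not> (x \<le> real n \<and> C + 1 < \<bar>e x\<bar>)" for n
  proof -
    define S where "S = {x \<in> space half_line. x \<le> real n \<and> C + 1 < \<bar>e x\<bar>}"
    have S[measurable]: "S \<in> sets half_line" unfolding S_def by measurable
    have "emeasure half_line S \<le> emeasure half_line {0<..real n}"
      by (intro emeasure_mono) (auto simp: S_def sets_restrict_space_iff)
    also have "\<dots> < \<infinity>" by (subst emeasure_restrict_space) auto
    finally obtain \<mu> where \<mu>: "emeasure half_line S = ennreal \<mu>" "0 \<le> \<mu>"
      by (cases "emeasure half_line S") auto
    let ?h = "indicat_real S"
    have hi: "(\<integral>\<^sup>+x. ennreal ((?h x)\<^sup>2) \<partial>half_line) = ennreal \<mu>"
    proof -
      have "(\<integral>\<^sup>+x. ennreal ((?h x)\<^sup>2) \<partial>half_line) = (\<integral>\<^sup>+x. indicator S x \<partial>half_line)"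
        by (intro nn_integral_cong) (auto simp: indicator_def)
      then show ?thesis using \<mu> by simp
    qed
    have hL: "L2_fun half_line ?h" unfolding L2_fun_def using hi by simp
    have "ennreal ((C + 1)\<^sup>2 * \<mu>) = (\<integral>\<^sup>+x. ennreal ((C + 1)\<^sup>2) * indicator S x \<partial>half_line)"
      using \<mu> by (simp add: nn_integral_cmult ennreal_mult)
    also have "\<dots> \<le> (\<integral>\<^sup>+x. ennreal ((e x * ?h x)\<^sup>2) \<partial>half_line)"
    proof (rule nn_integral_mono)
      fix x
      show "ennreal ((C + 1)\<^sup>2) * indicator S x \<le> ennreal ((e x * ?h x)\<^sup>2)"
      proof (cases "x \<in> S")
        case True
        then have "(C + 1)\<^sup>2 \<le> \<bar>e x\<bar>\<^sup>2" using C0 by (intro power_mono) (auto simp: S_def)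
        then show ?thesis using True by (simp add: ennreal_leI)
      qed simp
    qed
    also have "\<dots> = ennreal ((nrm2 half_line (\<lambda>x. e x * ?h x))\<^sup>2)" by (rule nrm2_square[OF L[OF hL]])
    also have "\<dots> \<le> ennreal ((C * nrm2 half_line ?h)\<^sup>2)"
      by (intro ennreal_leI power_mono bound hL nrm2_nonneg)
    also have "\<dots> = ennreal (C\<^sup>2 * \<mu>)"
      using nrm2_square[OF hL] hi \<mu>(2) by (simp add: power_mult_distrib)
    finally have "(C + 1)\<^sup>2 * \<mu> \<le> C\<^sup>2 * \<mu>" using \<mu>(2) by simp
    then have "(2 * C + 1) * \<mu> \<le> 0" by (simp add: power2_eq_square algebra_simps)
    then have "\<mu> = 0" using \<mu>(2) C0 by (simp add: mult_le_0_iff)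
    then have "S \<in> null_sets half_line" using \<mu> S by auto
    from AE_not_in[OF this] AE_space show ?thesis
      by eventually_elim (simp add: S_def)
  qed
  then have "AE x in half_line. \<forall>n. \<not> (x \<le> real n \<and> C + 1 < \<bar>e x\<bar>)" by (subst AE_all_countable) blast
  then show ?thesis
    by eventually_elim (metis not_le real_arch_simple)
qed

section \<open>Separating the coefficients by test functions\<close>

definition interval_mass :: "(real \<Rightarrow> real) \<Rightarrow> real \<Rightarrow> real \<Rightarrow> ennreal" where
  "interval_mass w a b = (\<integral>\<^sup>+x\<in>{a<..<b}. ennreal (w x) \<partial>lebesgue)"

lemma interval_mass_mono: "a' \<le> a \<Longrightarrow> b \<le> b' \<Longrightarrow> interval_mass w a b \<le> interval_mass w a' b'"
  unfolding interval_mass_def by (rule nn_set_integral_set_mono) auto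

lemma B_classE:
  assumes "w \<in> B_class \<delta>"
  obtains D :: real where "0 \<le> D"
    "\<And>a b. 0 \<le> a \<Longrightarrow> a < b \<Longrightarrow> \<delta> \<le> b - a \<Longrightarrow>
      interval_mass w a b \<le> ennreal D * interval_mass w ((3 * a + b) / 4) ((a + 3 * b) / 4)"
proof -
  from assms obtain D :: real where D: "\<And>a b. 0 \<le> a \<Longrightarrow> a < b \<Longrightarrow> \<delta> \<le> b - a \<Longrightarrow>
      interval_mass w a b \<le> ennreal D * interval_mass w ((3 * a + b) / 4) ((a + 3 * b) / 4)"
    unfolding B_class_def interval_mass_def by blast
  have "ennreal D = ennreal (max D 0)" by (simp add: max_def ennreal_neg)
  with D show thesis by (intro that[of "max D 0"]) auto
qed

text \<open>Doubling on (0,R), with R at least \<delta>, bounds its mass by that of (R/4, 3R/4),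
  which stays away from 0 and is finite by local integrability.\<close>

lemma B_class_finite_mass:
  assumes w: "w \<in> B_class \<delta>" and r: "0 < r"
  shows "interval_mass w 0 r < \<infinity>"
proof -
  obtain D where D: "0 \<le> D" "\<And>a b. 0 \<le> a \<Longrightarrow> a < b \<Longrightarrow> \<delta> \<le> b - a \<Longrightarrow>
      interval_mass w a b \<le> ennreal D * interval_mass w ((3 * a + b) / 4) ((a + 3 * b) / 4)"
    using B_classE[OF w] by blast
  define R where "R = max r \<delta>"
  have R: "0 < R" "r \<le> R" "\<delta> \<le> R" using r by (auto simp: R_def)
  have li: "locally_integrable w" using w by (simp add: B_class_def)
  have "interval_mass w (R / 4) (3 * R / 4) \<le> (\<integral>\<^sup>+x. ennreal (norm (indicator {R/4..3*R/4} x *\<^sub>R w x)) \<partial>lebesgue)"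
    unfolding interval_mass_def by (intro nn_integral_mono) (auto simp: indicator_def ennreal_leI)
  also have "\<dots> < \<infinity>"
    using locally_integrableD[OF li, of "R / 4" "3 * R / 4"] R
    unfolding set_integrable_def integrable_iff_bounded by simp
  finally have fin: "interval_mass w (R / 4) (3 * R / 4) < \<infinity>" .
  have "interval_mass w 0 r \<le> interval_mass w 0 R" using R by (intro interval_mass_mono) auto
  also have "\<dots> \<le> ennreal D * interval_mass w (R / 4) (3 * R / 4)"
    using D(2)[of 0 R] R by simp
  also have "\<dots> < \<infinity>" using fin by (simp add: ennreal_mult_less_top)
  finally show ?thesis .
qed

text \<open>Some cell of (0,r) carries \<bar>p\<bar> \<ge> c r^i, and doubling compares the mass of
  this cell with that of all of (0,r). Which cell it is depends on \<open>p\<close>, but the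
  constants do not.\<close>

lemma doubling_poly_lower_bound:
  assumes w: "w \<in> B_class \<delta>" and "0 \<le> \<delta>" and l: "0 < l"
  shows "\<exists>R>0. \<exists>\<kappa>\<ge>0. \<forall>r\<ge>R. \<forall>p i. (\<forall>j\<ge>l. coeff p j = 0) \<longrightarrow> coeff p i = 1 \<longrightarrow>
    ennreal (r ^ (2 * i)) * interval_mass w 0 r \<le>
      ennreal \<kappa> * (\<integral>\<^sup>+x\<in>{0<..<r}. ennreal ((poly p x)\<^sup>2 * w x) \<partial>lebesgue)"
proof -
  obtain D where D: "0 \<le> D" "\<And>a b. 0 \<le> a \<Longrightarrow> a < b \<Longrightarrow> \<delta> \<le> b - a \<Longrightarrow>
      interval_mass w a b \<le> ennreal D * interval_mass w ((3 * a + b) / 4) ((a + 3 * b) / 4)"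
    using B_classE[OF w] by blast
  obtain c where c: "0 < c" "\<And>(p::real poly) r i. 0 < r \<Longrightarrow> (\<forall>j\<ge>l. coeff p j = 0) \<Longrightarrow> coeff p i = 1 \<Longrightarrow>
    (\<exists>q<l. \<forall>t\<in>{2 * real q * r / (2 * real l)<..<(2 * real q + 1) * r / (2 * real l)}. c * r ^ i \<le> \<bar>poly p t\<bar>)"
    using poly_large_on_interval[OF l] by blast
  have wm: "w \<in> borel_measurable half_line"
    using w by (intro locally_integrable_measurable) (simp add: B_class_def)
  \<comment> \<open>A cell has length r/(2l) = 4s with s = r/(8l), so n = 8l enlargements by s cover
    a distance r and hence (0,r). \<open>R\<close> guarantees that cells have length at least
    \<delta>; \<open>\<kappa>\<close> collects the n doublings and the squared constant c.\<close>
  define n where "n = 8 * l"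
  define R where "R = 2 * real l * \<delta> + 1"
  define \<kappa> where "\<kappa> = D ^ n / c\<^sup>2"
  have R0: "0 < R" using \<open>0 \<le> \<delta>\<close> by (simp add: R_def add_nonneg_pos)
  have \<kappa>0: "0 \<le> \<kappa>" using D(1) by (simp add: \<kappa>_def)
  show ?thesis
  proof (rule exI[of _ R], rule conjI[OF R0], rule exI[of _ \<kappa>], rule conjI[OF \<kappa>0], intro allI impI)
    fix r :: real and p :: "real poly" and i
    assume r: "R \<le> r" and p: "\<forall>j\<ge>l. coeff p j = 0" "coeff p i = 1"
    have r0: "0 < r" using r R0 by simp
    obtain q where q: "q < l" "\<And>t. t \<in> {2 * real q * r / (2 * real l)<..<(2 * real q + 1) * r / (2 * real l)} \<Longrightarrow> c * r ^ i \<le> \<bar>poly p t\<bar>"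
      using c(2)[OF r0 p] by blast
    define a where "a = 2 * real q * r / (2 * real l)"
    define b where "b = (2 * real q + 1) * r / (2 * real l)"
    define s where "s = r / (8 * real l)"
    have ba: "b - a = 4 * s" using l by (simp add: a_def b_def s_def field_simps)
    have a0: "0 \<le> a" using r0 by (simp add: a_def)
    have s0: "0 < s" using r0 l by (simp add: s_def)
    have ns: "real n * s = r" using l by (simp add: n_def s_def)
    have "a \<le> r" "b \<le> r"
      using q(1) r0 l by (auto simp: a_def b_def divide_le_eq mult.commute[of r] intro!: mult_right_mono)
    have \<delta>s: "\<delta> \<le> 4 * s"
    proof -
      have "2 * real l * \<delta> \<le> r" using r by (simp add: R_def)
      then show ?thesis using l by (simp add: s_def field_simps)
    qed
    have "interval_mass w 0 r \<le> interval_mass w (max 0 (a - real n * s)) (b + real n * s)"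
    proof (rule interval_mass_mono)
      show "max 0 (a - real n * s) \<le> 0" using ns \<open>a \<le> r\<close> by simp
      show "r \<le> b + real n * s" using ns a0 ba s0 by simp
    qed
    also have "\<dots> \<le> ennreal D ^ n * interval_mass w a b"
      by (rule doubling_iterate[where \<nu>="interval_mass w" and \<delta>=\<delta>, OF interval_mass_mono D(2)])
         (use a0 ba s0 \<delta>s in auto)
    finally have 1: "interval_mass w 0 r \<le> ennreal (D ^ n) * interval_mass w a b"
      using D(1) by (simp add: ennreal_power)
    let ?I = "\<integral>\<^sup>+x\<in>{0<..<r}. ennreal ((poly p x)\<^sup>2 * w x) \<partial>lebesgue"
    have sub: "{a<..<b} \<subseteq> {0<..<r}" using a0 \<open>b \<le> r\<close> by auto
    have "ennreal ((c * r ^ i)\<^sup>2) * interval_mass w a b = (\<integral>\<^sup>+x. ennreal ((c * r ^ i)\<^sup>2) * (ennreal (w x) * indicator {a<..<b} x) \<partial>half_line)"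
      unfolding interval_mass_def using sub wm
      by (subst set_nn_integral_half_line) (auto intro!: nn_integral_cmult[symmetric])
    also have "\<dots> \<le> (\<integral>\<^sup>+x. ennreal ((poly p x)\<^sup>2 * w x) * indicator {0<..<r} x \<partial>half_line)"
    proof (rule nn_integral_mono)
      fix x
      show "ennreal ((c * r ^ i)\<^sup>2) * (ennreal (w x) * indicator {a<..<b} x) \<le> ennreal ((poly p x)\<^sup>2 * w x) * indicator {0<..<r} x"
      proof (cases "x \<in> {a<..<b}")
        case True
        then have "(c * r ^ i)\<^sup>2 \<le> \<bar>poly p x\<bar>\<^sup>2"
          using q(2)[of x] c(1) r0 by (intro power_mono) (auto simp: a_def b_def)
        then have "ennreal ((c * r ^ i)\<^sup>2) * ennreal (w x) \<le> ennreal ((poly p x)\<^sup>2) * ennreal (w x)"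
          by (intro mult_right_mono ennreal_leI) auto
        then show ?thesis using True sub by (auto simp: ennreal_mult' subset_eq)
      qed simp
    qed
    also have "\<dots> = ?I" by (subst set_nn_integral_half_line) auto
    finally have 2: "ennreal ((c * r ^ i)\<^sup>2) * interval_mass w a b \<le> ?I" .
    have "ennreal (r ^ (2 * i)) * interval_mass w 0 r \<le> ennreal (r ^ (2 * i)) * (ennreal (D ^ n) * interval_mass w a b)"
      by (intro mult_left_mono 1) simp
    also have "\<dots> = ennreal \<kappa> * (ennreal ((c * r ^ i)\<^sup>2) * interval_mass w a b)"
    proof -
      have "r ^ (2 * i) * D ^ n = \<kappa> * (c * r ^ i)\<^sup>2"
        using c(1) by (simp add: \<kappa>_def power_mult_distrib power_even_eq)
      then have "ennreal (r ^ (2 * i)) * ennreal (D ^ n) = ennreal \<kappa> * ennreal ((c * r ^ i)\<^sup>2)"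
        using D(1) r0 \<kappa>0 by (simp flip: ennreal_mult)
      then show ?thesis by (simp only: mult.assoc[symmetric])
    qed
    also have "\<dots> \<le> ennreal \<kappa> * ?I" by (intro mult_left_mono 2) simp
    finally show "ennreal (r ^ (2 * i)) * interval_mass w 0 r \<le> ennreal \<kappa> * ?I" .
  qed
qed

lemma integral_indicator_lessThan:
  fixes f :: "real \<Rightarrow> real"
  assumes f: "L1_0 f" and x: "0 \<le> r" "r \<le> x"
  shows "integral {0..x} (\<lambda>t. indicator {..<r} t * f t) = integral {0..r} f"
proof -
  have fi: "integrable (lebesgue_on {0..x}) f" by (rule L1_0_integrable[OF f])
  have "integrable lebesgue (\<lambda>t. indicator {0..x} t *\<^sub>R f t)"
    using fi by (simp add: integrable_restrict_space)
  then have "integrable lebesgue (\<lambda>t. indicator {..<r} t *\<^sub>R (indicator {0..x} t *\<^sub>R f t))"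
    by (rule integrable_mult_indicator[rotated]) simp
  then have "integrable (lebesgue_on {0..x}) (\<lambda>t. indicator {..<r} t *\<^sub>R f t)"
    by (simp add: integrable_restrict_space mult.left_commute)
  then have "integral {0..x} (\<lambda>t. indicator {..<r} t * f t) = (LINT t|lebesgue_on {0..x}. indicator {..<r} t * f t)"
    by (subst lebesgue_integral_eq_integral) auto
  then show ?thesis using integral_lebesgue_on_indicator(2)[OF fi x] by simp
qed

lemma nn_integral_eq_integral_Icc:
  assumes f: "L1_0 f" and nonneg: "\<And>x. 0 \<le> f x" and r: "0 < r"
  shows "(\<integral>\<^sup>+x\<in>{0<..<r}. ennreal (f x) \<partial>lebesgue) = ennreal (integral {0..r} f)"
proof -
  have i: "integrable (lebesgue_on {0..r}) f" by (rule L1_0_integrable[OF f])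
  have "(\<integral>\<^sup>+x\<in>{0<..<r}. ennreal (f x) \<partial>lebesgue) = (\<integral>\<^sup>+x. ennreal (f x) * indicator {0..r} x \<partial>lebesgue)"
  proof (rule nn_integral_cong_AE)
    have "AE t in lebesgue. t \<notin> {0, r}"
      by (rule AE_not_in) auto
    then show "AE t in lebesgue. ennreal (f t) * indicator {0<..<r} t = ennreal (f t) * indicator {0..r} t"
      by eventually_elim (auto simp: indicator_def)
  qed
  also have "\<dots> = (\<integral>\<^sup>+x. ennreal (f x) \<partial>lebesgue_on {0..r})"
    by (subst nn_integral_restrict_space) auto
  also have "\<dots> = ennreal (LINT x|lebesgue_on {0..r}. f x)"
    by (rule nn_integral_eq_integral[OF i]) (simp add: nonneg)
  also have "(LINT x|lebesgue_on {0..r}. f x) = integral {0..r} f"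
    by (rule lebesgue_integral_eq_integral[OF i]) simp
  finally show ?thesis .
qed

text \<open>z is the component of the i-th monomial orthogonal to the other monomials of degree
  below l. Keeping its i-th coefficient equal to 1 is what later bounds its norm from below.\<close>

lemma exists_separating_poly:
  fixes w :: "real \<Rightarrow> real"
  assumes w: "L1_0 w" "\<And>x. 0 \<le> w x" and i: "i < l"
  shows "\<exists>z. coeff z i = 1 \<and> (\<forall>j\<ge>l. coeff z j = 0) \<and>
    (\<forall>j<l. integral {0..r} (\<lambda>t. poly z t * t ^ j * w t) =
      (if j = i then integral {0..r} (\<lambda>t. (poly z t)\<^sup>2 * w t) else 0))"
proof -
  define B where "B p q = integral {0..r} (\<lambda>t. poly p t * poly q t * w t)" for p q
  have int: "(\<lambda>t. poly p t * poly q t * w t) integrable_on {0..r}" for p q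
    by (intro L1_0_integrable_on L1_0_continuous_mult[OF _ w(1)] continuous_intros)
  have add: "B (p + q) s = B p s + B q s" for p q s
    unfolding B_def poly_add distrib_right
    by (intro Henstock_Kurzweil_Integration.integral_add int)
  have smult: "B (smult c p) s = c * B p s" for c p s
    unfolding B_def using integral_mult_right[of "{0..r}" c "\<lambda>t. poly p t * poly s t * w t"]
    by (simp add: mult.assoc)
  have sym: "B p q = B q p" for p q by (simp add: B_def mult.commute)
  have nonneg: "0 \<le> B p p" for p
    unfolding B_def by (intro Henstock_Kurzweil_Integration.integral_nonneg int) (simp add: w(2))
  define J where "J = {..<l} - {i}"
  obtain y where y: "supported_poly J y" "\<And>q. supported_poly J q \<Longrightarrow> B (monom 1 i - y) q = 0"
    using projection_exists[of B, OF add smult sym nonneg, of J] by (auto simp: J_def)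
  define z where "z = monom 1 i - y"
  have "coeff z i = 1" using y(1) by (simp add: z_def supported_poly_def J_def)
  moreover have "\<forall>j\<ge>l. coeff z j = 0" using y(1) i by (auto simp: z_def supported_poly_def J_def)
  moreover have "B z (monom 1 j) = (if j = i then B z z else 0)" if "j < l" for j
  proof (cases "j = i")
    case False
    then show ?thesis using y(2)[of "monom 1 j"] that by (auto simp: z_def supported_poly_def J_def)
  next
    case True
    \<comment> \<open>The projection y is orthogonal to z, so pairing z with the i-th monomial gives
      the squared norm of z.\<close>
    have "monom 1 i = z + y" by (simp add: z_def)
    then have "B (monom 1 i) z = B z z + B y z" using add[of z y z] by simp
    then have "B z (monom 1 i) = B z z + B z y" using sym[of z "monom 1 i"] sym[of z y] by linarith
    then show ?thesis using True y(2)[OF y(1)] by (simp add: z_def)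
  qed
  ultimately show ?thesis
    by (intro exI[of _ z]) (auto simp: B_def poly_monom power2_eq_square)
qed

text \<open>Let \<beta> be the squared norm of the separating polynomial z. The test function has
  squared norm \<beta>, and the operator maps it to \<beta> times \<open>a k\<close> beyond r. Thus
  \<beta>^2 Q \<le> C^2 \<beta>, while doubling gives P \<le> \<kappa> \<beta> for the inner factor;
  in the product QP the unknown \<beta> cancels.\<close>

lemma coefficient_bound:
  fixes u :: "real \<Rightarrow> real" and l :: nat
  defines "w \<equiv> \<lambda>x. 1 / (u x)\<^sup>2" and "b \<equiv> \<lambda>k t. t ^ (l - 1 - k) / u t"
  assumes um: "u \<in> borel_measurable half_line" and upos: "AE x in half_line. 0 < u x"
    and w: "w \<in> B_class \<delta>" "L1_0 w" and \<delta>: "0 \<le> \<delta>"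
    and a: "\<And>k. k < l \<Longrightarrow> L2_fun half_line (a k)"
    and T: "\<And>h. L2_fun half_line h \<Longrightarrow> L2_fun half_line (integral_op l a b e h)"
    and C: "\<And>h. L2_fun half_line h \<Longrightarrow> nrm2 half_line (integral_op l a b e h) \<le> C * nrm2 half_line h"
    and C0: "0 \<le> C" and k: "k < l"
  shows "\<exists>A\<ge>0. \<forall>r>0. (\<integral>\<^sup>+x. ennreal ((a k x)\<^sup>2) * indicator {r<..} x \<partial>half_line) *
       (\<integral>\<^sup>+t. ennreal ((b k t)\<^sup>2) * indicator {..<r} t \<partial>half_line) \<le> ennreal A"
proof -
  have [measurable]: "u \<in> borel_measurable half_line" by fact
  have wm[measurable]: "w \<in> borel_measurable half_line" unfolding w_def by measurable
  have w0: "0 \<le> w x" for x by (simp add: w_def)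
  \<comment> \<open>The index is reflected: the k-th summand carries the inner power l - 1 - k, and
    this is the exponent to be separated.\<close>
  define i where "i = l - 1 - k"
  have i: "i < l" using k by (simp add: i_def)
  obtain R \<kappa> where R: "0 < R" "0 \<le> \<kappa>" and lower: "\<forall>r\<ge>R. \<forall>p i. (\<forall>j\<ge>l. coeff p j = 0) \<longrightarrow> coeff p i = 1 \<longrightarrow>
    ennreal (r ^ (2 * i)) * interval_mass w 0 r \<le> ennreal \<kappa> * (\<integral>\<^sup>+x\<in>{0<..<r}. ennreal ((poly p x)\<^sup>2 * w x) \<partial>lebesgue)"
    using doubling_poly_lower_bound[OF w(1) \<delta> less_le_trans[OF le_less_trans[OF le0 k] order_refl]]
    by (elim exE conjE) (rule that)
  define Q where "Q r = (\<integral>\<^sup>+x. ennreal ((a k x)\<^sup>2) * indicator {r<..} x \<partial>half_line)" for r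
  define P where "P r = (\<integral>\<^sup>+t. ennreal ((b k t)\<^sup>2) * indicator {..<r} t \<partial>half_line)" for r
  have P_le: "P r \<le> ennreal (r ^ (2 * i)) * interval_mass w 0 r" if r: "0 < r" for r
  proof -
    have "P r \<le> (\<integral>\<^sup>+t. ennreal (r ^ (2 * i)) * (ennreal (w t) * indicator {0<..<r} t) \<partial>half_line)"
      unfolding P_def
    proof (rule nn_integral_mono)
      fix t assume "t \<in> space half_line"
      then have t: "0 < t" by simp
      show "ennreal ((b k t)\<^sup>2) * indicator {..<r} t \<le> ennreal (r ^ (2 * i)) * (ennreal (w t) * indicator {0<..<r} t)"
      proof (cases "t < r")
        case True
        have "(b k t)\<^sup>2 = t ^ (2 * i) * w t"
          by (simp add: b_def w_def i_def power_divide power_even_eq)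
        also have "\<dots> \<le> r ^ (2 * i) * w t"
          using t True w0 by (intro mult_right_mono power_mono) auto
        finally show ?thesis using True t r w0 by (simp add: ennreal_leI flip: ennreal_mult)
      qed simp
    qed
    also have "\<dots> = ennreal (r ^ (2 * i)) * interval_mass w 0 r"
      unfolding interval_mass_def by (subst set_nn_integral_half_line) (auto intro!: nn_integral_cmult)
    finally show ?thesis .
  qed
  have Q_le: "Q r \<le> ennreal ((nrm2 half_line (a k))\<^sup>2)" for r
    unfolding Q_def nrm2_square[OF a[OF k], symmetric]
    by (intro nn_integral_mono) (auto simp: indicator_def)
  have large: "Q r * P r \<le> ennreal (\<kappa> * C\<^sup>2)" if r: "R \<le> r" for r
  proof -
    have r0: "0 < r" using r R by simp
    obtain z where z: "coeff z i = 1" "\<forall>j\<ge>l. coeff z j = 0"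
      "\<And>j. j < l \<Longrightarrow> integral {0..r} (\<lambda>t. poly z t * t ^ j * w t) = (if j = i then integral {0..r} (\<lambda>t. (poly z t)\<^sup>2 * w t) else 0)"
      using exists_separating_poly[OF w(2) w0 i] by blast
    define \<beta> where "\<beta> = integral {0..r} (\<lambda>t. (poly z t)\<^sup>2 * w t)"
    have zL: "L1_0 (\<lambda>t. (poly z t)\<^sup>2 * w t)"
      by (intro L1_0_continuous_mult[OF _ w(2)] continuous_intros)
    have \<beta>: "(\<integral>\<^sup>+x\<in>{0<..<r}. ennreal ((poly z x)\<^sup>2 * w x) \<partial>lebesgue) = ennreal \<beta>"
      unfolding \<beta>_def by (rule nn_integral_eq_integral_Icc[OF zL _ r0]) (simp add: w0)
    have \<beta>0: "0 \<le> \<beta>" unfolding \<beta>_def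
      by (intro Henstock_Kurzweil_Integration.integral_nonneg L1_0_integrable_on zL) (simp add: w0)
    \<comment> \<open>Dividing by u turns the pairing with \<open>b j\<close> into the inner product
      of z with a monomial in the weight \<open>w\<close>.\<close>
    define h where "h t = indicator {..<r} t * (poly z t / u t)" for t
    have [measurable]: "poly z \<in> borel_measurable half_line"
      by (intro L1_0_measurable L1_0_continuous continuous_on_poly)
    have hm[measurable]: "h \<in> borel_measurable half_line" unfolding h_def by measurable
    have h2: "(\<integral>\<^sup>+x. ennreal ((h x)\<^sup>2) \<partial>half_line) = ennreal \<beta>"
      unfolding \<beta>[symmetric]
      by (subst set_nn_integral_half_line) (auto intro!: nn_integral_cong simp: h_def w_def indicator_def power_divide)
    have hL: "L2_fun half_line h" unfolding L2_fun_def using h2 hm by simp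
    have hn: "(nrm2 half_line h)\<^sup>2 = \<beta>" using nrm2_square[OF hL] h2 \<beta>0 by simp
    \<comment> \<open>Beyond r the moments of h have reached their final values and the
      multiplication term is 0, as h vanishes there.\<close>
    have Th: "integral_op l a b e h x = a k x * \<beta>" if x: "r < x" for x
    proof -
      have "integral {0..x} (\<lambda>t. b j t * h t) = (if j = k then \<beta> else 0)" if j: "j < l" for j
      proof -
        have "(\<lambda>t. b j t * h t) = (\<lambda>t. indicator {..<r} t * (poly z t * t ^ (l - 1 - j) * w t))"
          by (rule ext) (simp add: b_def h_def w_def power2_eq_square)
        then have "integral {0..x} (\<lambda>t. b j t * h t) = integral {0..r} (\<lambda>t. poly z t * t ^ (l - 1 - j) * w t)"
          using x r0 by (simp only:) (intro integral_indicator_lessThan L1_0_continuous_mult[OF _ w(2)] continuous_intros; simp)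
        also have "\<dots> = (if j = k then \<beta> else 0)"
          using z(3)[of "l - 1 - j"] j k by (auto simp: i_def \<beta>_def)
        finally show ?thesis .
      qed
      then have "integral_op l a b e h x = (\<Sum>j<l. a j x * (if j = k then \<beta> else 0)) + e x * h x"
        by (simp add: integral_op_def)
      also have "\<dots> = a k x * \<beta>" using k x by (simp add: h_def if_distrib[of "\<lambda>y. _ * y"] cong: if_cong)
      finally show ?thesis .
    qed
    have [measurable]: "a k \<in> borel_measurable half_line" using a[OF k] by (rule L2_fun_measurable)
    have "ennreal (\<beta>\<^sup>2) * Q r = (\<integral>\<^sup>+x. ennreal (\<beta>\<^sup>2) * (ennreal ((a k x)\<^sup>2) * indicator {r<..} x) \<partial>half_line)"
      unfolding Q_def by (intro nn_integral_cmult[symmetric]) measurable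
    also have "\<dots> \<le> (\<integral>\<^sup>+x. ennreal ((integral_op l a b e h x)\<^sup>2) \<partial>half_line)"
    proof (rule nn_integral_mono)
      fix x
      show "ennreal (\<beta>\<^sup>2) * (ennreal ((a k x)\<^sup>2) * indicator {r<..} x) \<le> ennreal ((integral_op l a b e h x)\<^sup>2)"
        by (cases "r < x") (simp_all add: Th power_mult_distrib ennreal_mult mult.commute)
    qed
    also have "\<dots> = ennreal ((nrm2 half_line (integral_op l a b e h))\<^sup>2)" by (rule nrm2_square[OF T[OF hL]])
    also have "\<dots> \<le> ennreal ((C * nrm2 half_line h)\<^sup>2)"
      by (intro ennreal_leI power_mono C hL nrm2_nonneg)
    also have "\<dots> = ennreal (C\<^sup>2 * \<beta>)" by (simp add: power_mult_distrib hn)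
    finally have 1: "ennreal (\<beta>\<^sup>2) * Q r \<le> ennreal (C\<^sup>2 * \<beta>)" .
    have "P r \<le> ennreal (r ^ (2 * i)) * interval_mass w 0 r" by (rule P_le[OF r0])
    also have "\<dots> \<le> ennreal \<kappa> * ennreal \<beta>" using lower[rule_format, OF r z(2)[rule_format] z(1)] by (simp add: \<beta>)
    finally have P: "P r \<le> ennreal (\<kappa> * \<beta>)" using R \<beta>0 by (simp add: ennreal_mult)
    obtain q where q: "Q r = ennreal q" "0 \<le> q"
      using Q_le[of r] by (cases "Q r") (auto simp: top_unique)
    have "q * (\<kappa> * \<beta>) \<le> \<kappa> * C\<^sup>2"
    \<comment> \<open>For \<beta> = 0 nothing can be cancelled, but then the left side is 0.\<close>
    proof (cases "\<beta> = 0")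
      case False
      then have "0 < \<beta>" using \<beta>0 by simp
      have "\<beta>\<^sup>2 * q \<le> C\<^sup>2 * \<beta>" using 1 q \<beta>0 by (simp flip: ennreal_mult)
      then have "\<beta> * (\<beta> * q) \<le> \<beta> * C\<^sup>2" by (simp add: power2_eq_square mult_ac)
      then have "\<beta> * q \<le> C\<^sup>2" using \<open>0 < \<beta>\<close> by simp
      then have "\<kappa> * (\<beta> * q) \<le> \<kappa> * C\<^sup>2" using R by (intro mult_left_mono) auto
      then show ?thesis by (simp add: mult_ac)
    qed (use R in simp)
    moreover have "Q r * P r \<le> ennreal (q * (\<kappa> * \<beta>))"
      using mult_left_mono[OF P, of "Q r"] q R \<beta>0 by (simp add: ennreal_mult)
    ultimately show ?thesis by (meson ennreal_leI order_trans)
  qed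
  have P_mono: "P r \<le> P R" if "r \<le> R" for r
    unfolding P_def using that by (intro nn_integral_mono) (auto simp: indicator_def)
  have "P R \<le> ennreal (R ^ (2 * i)) * interval_mass w 0 R" by (rule P_le[OF R(1)])
  also have "\<dots> < \<infinity>" using B_class_finite_mass[OF w(1) R(1)] by (simp add: ennreal_mult_less_top)
  finally obtain \<pi> where \<pi>: "P R = ennreal \<pi>" "0 \<le> \<pi>" by (cases "P R") auto
  \<comment> \<open>The first summand serves r \<ge> R. For r < R both factors are monotone: Q is at
    most the full squared norm and P at most its value at R.\<close>
  define A where "A = \<kappa> * C\<^sup>2 + (nrm2 half_line (a k))\<^sup>2 * \<pi>"
  have A: "\<kappa> * C\<^sup>2 \<le> A" "(nrm2 half_line (a k))\<^sup>2 * \<pi> \<le> A" "0 \<le> A" using R \<pi> by (auto simp: A_def)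
  have "Q r * P r \<le> ennreal A" if r: "0 < r" for r
  proof (cases "R \<le> r")
    case True
    then show ?thesis using large[OF True] A(1) by (meson ennreal_leI order_trans)
  next
    case False
    then have "Q r * P r \<le> ennreal ((nrm2 half_line (a k))\<^sup>2) * ennreal \<pi>"
      using Q_le[of r] P_mono[of r] \<pi> by (intro mult_mono) auto
    also have "\<dots> \<le> ennreal A" using A(2) \<pi> by (simp add: ennreal_leI flip: ennreal_mult)
    finally show ?thesis .
  qed
  then show ?thesis unfolding Q_def P_def using A(3) by blast
qed

section \<open>The multiplier theorem\<close>

lemma sobolev_spaceD:
  assumes "f \<in> sobolev_space n w"
  shows "has_gen_deriv n f (gen_deriv n f)"
    and "(\<integral>\<^sup>+x. ennreal ((gen_deriv n f x * w x)\<^sup>2) \<partial>half_line) < \<infinity>"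
proof -
  show "has_gen_deriv n f (gen_deriv n f)"
    using assms by (intro gen_differentiableD) (simp add: sobolev_space_def)
  have "L2_norm {0<..} (\<lambda>x. ennreal \<bar>gen_deriv n f x * w x\<bar>) < top"
    using assms by (auto simp: sobolev_space_def sobolev_norm_def)
  then have "(\<integral>\<^sup>+x\<in>{0<..}. (ennreal \<bar>gen_deriv n f x * w x\<bar>)\<^sup>2 \<partial>lebesgue) < top"
    by (simp add: L2_norm_eq)
  also have "(\<integral>\<^sup>+x\<in>{0<..}. (ennreal \<bar>gen_deriv n f x * w x\<bar>)\<^sup>2 \<partial>lebesgue) = (\<integral>\<^sup>+x. ennreal ((gen_deriv n f x * w x)\<^sup>2) \<partial>half_line)"
    by (subst set_nn_integral_half_line) (auto intro!: nn_integral_cong simp: ennreal_power)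
  finally show "(\<integral>\<^sup>+x. ennreal ((gen_deriv n f x * w x)\<^sup>2) \<partial>half_line) < \<infinity>" by simp
qed

lemma L2_norm_half_line_AE:
  assumes S: "S \<subseteq> {0<..}" and f: "AE x in half_line. (f x)\<^sup>2 = ennreal ((g x)\<^sup>2)"
  shows "(L2_norm S f)\<^sup>2 = (\<integral>\<^sup>+x. ennreal ((g x)\<^sup>2) * indicator S x \<partial>half_line)"
  unfolding L2_norm_square set_nn_integral_half_line[OF S]
  using f by (intro nn_integral_cong_AE) (auto elim: eventually_mono)

text \<open>Passes from products of norms to products of integrals, the form in which the Hardy
  inequality is used.\<close>

lemma SUP_product_finite_iff:
  fixes X Y :: "real \<Rightarrow> ennreal"
  shows "(SUP r\<in>{0<..}. X r * Y r) < top \<longleftrightarrow> (\<exists>A\<ge>0. \<forall>r>0. (X r)\<^sup>2 * (Y r)\<^sup>2 \<le> ennreal A)"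
proof
  assume "(SUP r\<in>{0<..}. X r * Y r) < top"
  then obtain s where s: "(SUP r\<in>{0<..}. X r * Y r) = ennreal s" "0 \<le> s"
    by (cases "(SUP r\<in>{0<..}. X r * Y r)") auto
  have "(X r)\<^sup>2 * (Y r)\<^sup>2 \<le> ennreal (s\<^sup>2)" if "0 < r" for r
  proof -
    have "X r * Y r \<le> ennreal s" unfolding s(1)[symmetric] by (rule SUP_upper) (use that in simp)
    then have "(X r * Y r)\<^sup>2 \<le> (ennreal s)\<^sup>2" by (rule power_mono) simp
    then show ?thesis using s(2) by (simp add: power_mult_distrib ennreal_power)
  qed
  then show "\<exists>A\<ge>0. \<forall>r>0. (X r)\<^sup>2 * (Y r)\<^sup>2 \<le> ennreal A" by (intro exI[of _ "s\<^sup>2"]) simp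
next
  assume "\<exists>A\<ge>0. \<forall>r>0. (X r)\<^sup>2 * (Y r)\<^sup>2 \<le> ennreal A"
  then obtain A where A: "0 \<le> A" "\<And>r. 0 < r \<Longrightarrow> (X r)\<^sup>2 * (Y r)\<^sup>2 \<le> ennreal A" by blast
  have "(SUP r\<in>{0<..}. X r * Y r) \<le> ennreal (sqrt A)"
  proof (rule SUP_least)
    fix r :: real assume r: "r \<in> {0<..}"
    have "(X r * Y r)\<^sup>2 \<le> ennreal A" using A(2)[of r] r by (simp add: power_mult_distrib)
    then have "(X r * Y r)\<^sup>2 \<le> ennreal ((sqrt A)\<^sup>2)" using A(1) by simp
    then show "X r * Y r \<le> ennreal (sqrt A)"
      by (rule ennreal_le_of_square_le) (simp add: A(1))
  qed
  also have "\<dots> < top" by simp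
  finally show "(SUP r\<in>{0<..}. X r * Y r) < top" .
qed

text \<open>In \<open>ennreal\<close> the inverse of 0 is infinite, so finiteness of the norms
  forces v > 0 almost everywhere; there the real reciprocal agrees.\<close>

lemma AE_pos_of_L2_norm_inverse:
  assumes v: "weight v" and fin: "\<And>r. r > 0 \<Longrightarrow> L2_norm {0<..<r} (\<lambda>x. inverse (ennreal (v x))) < top"
  shows "near0_weight v"
proof -
  have [measurable]: "v \<in> borel_measurable half_line" using v by (simp add: weight_def)
  have v0: "0 \<le> v x" if "0 < x" for x using v that by (simp add: weight_def)
  have fin': "(\<integral>\<^sup>+x. (inverse (ennreal (v x)))\<^sup>2 * indicator {0<..<r} x \<partial>half_line) < \<infinity>" if "0 < r" for r
    using fin[OF that] unfolding L2_norm_eq by (subst (asm) set_nn_integral_half_line) auto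
  have "AE x in half_line. \<forall>n::nat. (inverse (ennreal (v x)))\<^sup>2 * indicator {0<..<real (Suc n)} x \<noteq> \<infinity>"
    unfolding AE_all_countable
  proof
    fix n :: nat
    show "AE x in half_line. (inverse (ennreal (v x)))\<^sup>2 * indicator {0<..<real (Suc n)} x \<noteq> \<infinity>"
      by (rule nn_integral_noteq_infinite) (use fin'[of "real (Suc n)"] in auto)
  qed
  then have pos: "AE x in half_line. 0 < v x"
    using AE_space
  proof eventually_elim
    case (elim x)
    then have x: "0 < x" by simp
    obtain n where "x \<le> real n" using real_arch_simple by blast
    then have "x \<in> {0<..<real (Suc n)}" using x by simp
    with elim(1)[rule_format, of n] have "(inverse (ennreal (v x)))\<^sup>2 \<noteq> \<infinity>" by simp
    then have "v x \<noteq> 0" by (auto simp: power2_eq_square)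
    with v0[OF x] show "0 < v x" by simp
  qed
  have "(\<integral>\<^sup>+x. ennreal (1 / (v x)\<^sup>2) * indicator {..r} x \<partial>half_line) < \<infinity>" if r: "0 < r" for r
  proof -
    have "(\<integral>\<^sup>+x. ennreal (1 / (v x)\<^sup>2) * indicator {..r} x \<partial>half_line) \<le> (\<integral>\<^sup>+x. (inverse (ennreal (v x)))\<^sup>2 * indicator {0<..<r + 1} x \<partial>half_line)"
    proof (rule nn_integral_mono_AE, use pos AE_space in eventually_elim)
      case (elim x)
      then show ?case
        by (auto simp: indicator_def inverse_ennreal ennreal_power power_divide inverse_eq_divide)
    qed
    also have "\<dots> < \<infinity>" using fin'[of "r + 1"] r by simp
    finally show ?thesis .
  qed
  then show ?thesis using v pos by (simp add: near0_weight_def)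
qed

locale multiplier_setting =
  fixes l m :: nat and u v :: "real \<Rightarrow> real" and \<delta> :: real
  assumes m1: "1 \<le> m" and ml: "m \<le> l" and wu: "weight u" and wv: "near0_weight v"
    and \<delta>0: "0 \<le> \<delta>" and uB: "(\<lambda>x. 1 / (u x)\<^sup>2) \<in> B_class \<delta>"
begin

definition deriv_norm :: "(real \<Rightarrow> real) \<Rightarrow> nat \<Rightarrow> real set \<Rightarrow> ennreal" where
  "deriv_norm \<phi> k S = L2_norm S (\<lambda>x. ennreal \<bar>gen_deriv m (\<lambda>t. \<phi> t * t ^ k) x * v x\<bar>)"

definition hardy_product :: "(real \<Rightarrow> real) \<Rightarrow> nat \<Rightarrow> real \<Rightarrow> ennreal" where
  "hardy_product \<phi> k r = deriv_norm \<phi> k {r<..} *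
     L2_norm {0<..<r} (\<lambda>x. ennreal (x ^ (l - k - 1)) * inverse (ennreal (u x)))"

definition quotient_norm :: "(real \<Rightarrow> real) \<Rightarrow> ennreal" where
  "quotient_norm \<phi> = Linf_norm {0<..} (\<lambda>x. ennreal (\<bar>\<phi> x\<bar> * v x) * inverse (ennreal (u x)))"

text \<open>The three ingredients of \<open>integral_op\<close> for this problem. With h = g u,
  dividing by u in \<open>inner_coeff\<close> and multiplying by v in \<open>outer_coeff\<close>
  reduces both weighted spaces to the unweighted one.\<close>

definition inner_coeff :: "nat \<Rightarrow> real \<Rightarrow> real" where
  "inner_coeff k t = t ^ (l - 1 - k) / u t"

definition outer_coeff :: "(nat \<Rightarrow> real \<Rightarrow> real) \<Rightarrow> nat \<Rightarrow> real \<Rightarrow> real" where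
  "outer_coeff A k x = taylor_coeff l k * (monom_deriv m A k x * v x)"

definition diag_coeff :: "(nat \<Rightarrow> real \<Rightarrow> real) \<Rightarrow> real \<Rightarrow> real" where
  "diag_coeff A x = (if m = l then A 0 x * v x / u x else 0)"

section \<open>The weights, and the translation of the conditions into statements on the integral
  operator\<close>

lemma u_measurable[measurable]: "u \<in> borel_measurable half_line"
  and v_measurable[measurable]: "v \<in> borel_measurable half_line"
  using wu wv by (auto simp: weight_def near0_weight_def)

lemma v_pos: "AE x in half_line. 0 < v x"
  using wv by (simp add: near0_weight_def)

lemma u_pos: "AE x in half_line. 0 < u x"
proof -
  have "AE x in half_line. 0 < 1 / (u x)\<^sup>2" using uB by (simp add: B_class_def)
  then show ?thesis using AE_space
  proof eventually_elim
    case (elim x)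
    then have "u x \<noteq> 0" by auto
    moreover have "0 \<le> u x" using wu elim(2) by (simp add: weight_def)
    ultimately show ?case by simp
  qed
qed

lemma u_fin: "(\<integral>\<^sup>+x. ennreal (1 / (u x)\<^sup>2) * indicator {..r} x \<partial>half_line) < \<infinity>"
proof -
  have "(\<integral>\<^sup>+x. ennreal (1 / (u x)\<^sup>2) * indicator {..r} x \<partial>half_line) \<le> (\<integral>\<^sup>+x. ennreal (1 / (u x)\<^sup>2) * indicator {0<..<\<bar>r\<bar> + 1} x \<partial>half_line)"
    by (intro nn_integral_mono) (auto simp: indicator_def)
  also have "\<dots> = interval_mass (\<lambda>x. 1 / (u x)\<^sup>2) 0 (\<bar>r\<bar> + 1)"
    unfolding interval_mass_def by (subst set_nn_integral_half_line) auto
  also have "\<dots> < \<infinity>" by (rule B_class_finite_mass[OF uB]) simp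
  finally show ?thesis .
qed

lemma near0_u: "near0_weight u"
  using wu u_pos u_fin by (simp add: near0_weight_def)

lemma L1_0_u: "L1_0 (\<lambda>x. 1 / (u x)\<^sup>2)"
  by (rule L1_0I) (use u_fin in auto)

lemma inner_coeff_measurable[measurable]: "inner_coeff k \<in> borel_measurable half_line"
  unfolding inner_coeff_def by measurable

lemma inner_coeff_L2: "L2_near0 (inner_coeff k)"
  unfolding L2_near0_def
proof (intro conjI allI)
  fix r :: real
  let ?c = "\<bar>r\<bar> ^ (2 * (l - 1 - k))"
  have "(\<integral>\<^sup>+t. ennreal ((indicator {..r} t * inner_coeff k t)\<^sup>2) \<partial>half_line) \<le> (\<integral>\<^sup>+t. ennreal ?c * (ennreal (1 / (u t)\<^sup>2) * indicator {..r} t) \<partial>half_line)"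
  proof (rule nn_integral_mono)
    fix t assume "t \<in> space half_line"
    then have t: "0 < t" by simp
    show "ennreal ((indicator {..r} t * inner_coeff k t)\<^sup>2) \<le> ennreal ?c * (ennreal (1 / (u t)\<^sup>2) * indicator {..r} t)"
    proof (cases "t \<le> r")
      case True
      have "(inner_coeff k t)\<^sup>2 = t ^ (2 * (l - 1 - k)) * (1 / (u t)\<^sup>2)"
        by (simp add: inner_coeff_def power_divide power_even_eq)
      also have "\<dots> \<le> ?c * (1 / (u t)\<^sup>2)"
        using t True by (intro mult_right_mono power_mono) auto
      finally show ?thesis using True by (simp add: ennreal_leI flip: ennreal_mult)
    qed simp
  qed
  also have "\<dots> = ennreal ?c * (\<integral>\<^sup>+t. ennreal (1 / (u t)\<^sup>2) * indicator {..r} t \<partial>half_line)"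
    by (rule nn_integral_cmult) measurable
  also have "\<dots> < \<infinity>" using u_fin[of r] by (simp add: ennreal_mult_less_top)
  finally show "L2_fun half_line (\<lambda>t. indicator {..r} t * inner_coeff k t)"
    by (simp add: L2_fun_def)
qed measurable

text \<open>Every square integrable h arises as g u from an admissible derivative g = h/u, so the
  whole space is available for testing.\<close>

lemma quotient_L1_0:
  assumes h: "L2_fun half_line h"
  shows "L1_0 (\<lambda>x. h x / u x)" "(\<integral>\<^sup>+x. ennreal ((h x / u x * u x)\<^sup>2) \<partial>half_line) < \<infinity>"
proof -
  have [measurable]: "h \<in> borel_measurable half_line" using h by (rule L2_fun_measurable)
  have "(\<integral>\<^sup>+x. ennreal ((h x / u x * u x)\<^sup>2) \<partial>half_line) = (\<integral>\<^sup>+x. ennreal ((h x)\<^sup>2) \<partial>half_line)"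
    using u_pos by (intro nn_integral_cong_AE) (auto elim!: eventually_mono)
  then show fin: "(\<integral>\<^sup>+x. ennreal ((h x / u x * u x)\<^sup>2) \<partial>half_line) < \<infinity>"
    using h by (simp add: L2_fun_def)
  show "L1_0 (\<lambda>x. h x / u x)"
    by (rule near0_weight_L1_0[OF near0_u _ fin]) measurable
qed

lemma monom_deriv_measurable: "chain m A \<Longrightarrow> monom_deriv m A k \<in> borel_measurable half_line"
  using monom_deriv_has_gen_deriv[of m A k] m1 by (auto simp: has_gen_deriv_iff intro: locally_integrable_measurable)

lemma chain_cont0: "chain m A \<Longrightarrow> continuous_on {0..} (A 0)"
  using m1 by (intro chain_continuous[of m]) auto

lemma diag_coeff_measurable:
  assumes "chain m A" shows "diag_coeff A \<in> borel_measurable half_line"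
proof -
  have [measurable]: "A 0 \<in> borel_measurable half_line"
    by (intro L1_0_measurable chain_L1_0[OF assms]) simp
  show ?thesis unfolding diag_coeff_def by measurable
qed

lemma product_deriv:
  assumes A: "chain m A" and h: "L2_fun half_line h"
  obtains D where "has_gen_deriv m (\<lambda>x. A 0 x * iterated_integral l (\<lambda>x. h x / u x) 0 x) D"
    "\<And>x. D x * v x = integral_op l (outer_coeff A) inner_coeff (diag_coeff A) h x"
proof
  show "has_gen_deriv m (\<lambda>x. A 0 x * iterated_integral l (\<lambda>x. h x / u x) 0 x)
    (\<lambda>x. (\<Sum>k<l. taylor_coeff l k * (monom_deriv m A k x * moment (\<lambda>x. h x / u x) (l - 1 - k) x)) +
         (if m = l then A 0 x * (h x / u x) else 0))"
    using m1 ml by (intro product_has_gen_deriv A quotient_L1_0 h) auto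
  fix x
  have "moment (\<lambda>x. h x / u x) (l - 1 - k) x = integral {0..x} (\<lambda>t. inner_coeff k t * h t)" for k
    by (simp add: moment_def inner_coeff_def)
  then show "((\<Sum>k<l. taylor_coeff l k * (monom_deriv m A k x * moment (\<lambda>x. h x / u x) (l - 1 - k) x)) +
         (if m = l then A 0 x * (h x / u x) else 0)) * v x = integral_op l (outer_coeff A) inner_coeff (diag_coeff A) h x"
    unfolding integral_op_def distrib_right sum_distrib_right by (simp add: outer_coeff_def diag_coeff_def mult_ac)
qed

lemma iterated_integral_props:
  assumes g: "L1_0 g"
  shows "has_gen_deriv l (iterated_integral l g 0) g" "continuous_on {0..} (iterated_integral l g 0)"
proof -
  note c = iterated_integral_chain[OF g, of l]
  show "has_gen_deriv l (iterated_integral l g 0) g"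
    using chain_has_gen_deriv[OF c] by (simp add: iterated_integral_def[of l g l, abs_def])
  show "continuous_on {0..} (iterated_integral l g 0)"
    using m1 ml by (intro chain_continuous[OF c]) auto
qed

text \<open>A continuous representative of \<open>\<phi>\<close> turns all conditions into statements about \<open>integral_op\<close>.\<close>

lemma representative:
  assumes gd: "has_gen_deriv m \<phi> \<psi>" and fin: "(\<integral>\<^sup>+x. ennreal ((\<psi> x * v x)\<^sup>2) \<partial>half_line) < \<infinity>"
  obtains A where "chain m A" "AE x in half_line. \<phi> x = A 0 x"
proof -
  have "\<psi> \<in> borel_measurable half_line"
    using gd by (auto simp: has_gen_deriv_iff intro: locally_integrable_measurable)
  then have "L1_0 \<psi>" by (rule near0_weight_L1_0[OF wv _ fin])
  then show thesis using has_gen_deriv_representation'[OF gd] that by blast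
qed

lemma monom_gen_deriv:
  assumes A: "chain m A" "AE x in half_line. \<phi> x = A 0 x"
  shows "has_gen_deriv m (\<lambda>t. \<phi> t * t ^ k) (monom_deriv m A k)"
  using m1 A by (intro has_gen_deriv_cong[OF monom_deriv_has_gen_deriv[of m A k]]) (auto elim: eventually_mono)

lemma outer_coeff_L2_iff:
  assumes A: "chain m A" "AE x in half_line. \<phi> x = A 0 x" and k: "k < l"
  shows "L2_fun half_line (outer_coeff A k) \<longleftrightarrow>
    deriv_norm \<phi> k {0<..} < top"
proof -
  have [measurable]: "monom_deriv m A k \<in> borel_measurable half_line" by (rule monom_deriv_measurable[OF A(1)])
  have m: "(\<lambda>x. monom_deriv m A k x * v x) \<in> borel_measurable half_line" by measurable
  have "L2_fun half_line (outer_coeff A k) \<longleftrightarrow> L2_fun half_line (\<lambda>x. monom_deriv m A k x * v x)"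
    using L2_fun_cmult(1)[of half_line "\<lambda>x. monom_deriv m A k x * v x" "taylor_coeff l k"]
      L2_fun_cmult(1)[of half_line "outer_coeff A k" "1 / taylor_coeff l k"] taylor_coeff_nonzero[OF k]
    by (auto simp: outer_coeff_def[abs_def])
  also have "\<dots> \<longleftrightarrow> deriv_norm \<phi> k {0<..} < top"
  proof -
    have "(\<integral>\<^sup>+x. (ennreal \<bar>gen_deriv m (\<lambda>t. \<phi> t * t ^ k) x * v x\<bar>)\<^sup>2 * indicator {0<..} x \<partial>half_line) =
      (\<integral>\<^sup>+x. ennreal ((monom_deriv m A k x * v x)\<^sup>2) \<partial>half_line)"
      using gen_deriv_eqI(2)[OF monom_gen_deriv[OF A, of k]] AE_space
      by (intro nn_integral_cong_AE, eventually_elim) (simp add: ennreal_power)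
    then show ?thesis
      unfolding deriv_norm_def L2_norm_eq L2_fun_def using m by (subst set_nn_integral_half_line) auto
  qed
  finally show ?thesis .
qed

text \<open>After squaring, the two conditions differ only by the constant square of
  \<open>taylor_coeff\<close>, which is positive and rescales the bound.\<close>

lemma hardy_condition_iff:
  assumes A: "chain m A" "AE x in half_line. \<phi> x = A 0 x" and k: "k < l"
  shows "(SUP r\<in>{0<..}. hardy_product \<phi> k r) < top \<longleftrightarrow>
    (\<exists>B\<ge>0. \<forall>r>0. (\<integral>\<^sup>+x. ennreal ((outer_coeff A k x)\<^sup>2) * indicator {r<..} x \<partial>half_line) *
       (\<integral>\<^sup>+t. ennreal ((inner_coeff k t)\<^sup>2) * indicator {..<r} t \<partial>half_line) \<le> ennreal B)"
proof -
  define c where "c = (taylor_coeff l k)\<^sup>2"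
  have c: "0 < c" using taylor_coeff_nonzero[OF k] by (simp add: c_def)
  have [measurable]: "monom_deriv m A k \<in> borel_measurable half_line" by (rule monom_deriv_measurable[OF A(1)])
  define X where "X r = (\<integral>\<^sup>+x. ennreal ((monom_deriv m A k x * v x)\<^sup>2) * indicator {r<..} x \<partial>half_line)" for r
  define Y where "Y r = (\<integral>\<^sup>+t. ennreal ((inner_coeff k t)\<^sup>2) * indicator {..<r} t \<partial>half_line)" for r
  have 1: "(L2_norm {r<..} (\<lambda>x. ennreal \<bar>gen_deriv m (\<lambda>t. \<phi> t * t ^ k) x * v x\<bar>))\<^sup>2 = X r" if "0 < r" for r
    unfolding X_def using that gen_deriv_eqI(2)[OF monom_gen_deriv[OF A, of k]]
    by (intro L2_norm_half_line_AE) (auto elim!: eventually_mono simp: ennreal_power)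
  have 2: "(L2_norm {0<..<r} (\<lambda>x. ennreal (x ^ (l - k - 1)) * inverse (ennreal (u x))))\<^sup>2 = Y r" for r
  proof -
    have "(L2_norm {0<..<r} (\<lambda>x. ennreal (x ^ (l - k - 1)) * inverse (ennreal (u x))))\<^sup>2 =
      (\<integral>\<^sup>+t. ennreal ((inner_coeff k t)\<^sup>2) * indicator {0<..<r} t \<partial>half_line)"
    proof (rule L2_norm_half_line_AE)
      show "AE x in half_line. (ennreal (x ^ (l - k - 1)) * inverse (ennreal (u x)))\<^sup>2 = ennreal ((inner_coeff k x)\<^sup>2)"
        using u_pos AE_space
      proof eventually_elim
        case (elim x)
        then have "ennreal (x ^ (l - k - 1)) * inverse (ennreal (u x)) = ennreal (inner_coeff k x)"
          by (simp add: inverse_ennreal inner_coeff_def divide_inverse diff_commute ennreal_mult)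
        moreover have "0 \<le> inner_coeff k x" using elim by (simp add: inner_coeff_def)
        ultimately show ?case by (simp add: ennreal_power)
      qed
    qed auto
    also have "\<dots> = Y r" unfolding Y_def by (intro nn_integral_cong) (auto simp: indicator_def)
    finally show ?thesis .
  qed
  have 3: "(\<integral>\<^sup>+x. ennreal ((outer_coeff A k x)\<^sup>2) * indicator {r<..} x \<partial>half_line) = ennreal c * X r" for r
  proof -
    have "(\<integral>\<^sup>+x. ennreal ((outer_coeff A k x)\<^sup>2) * indicator {r<..} x \<partial>half_line) =
       (\<integral>\<^sup>+x. ennreal c * (ennreal ((monom_deriv m A k x * v x)\<^sup>2) * indicator {r<..} x) \<partial>half_line)"
      by (intro nn_integral_cong) (simp add: outer_coeff_def c_def power_mult_distrib ennreal_mult mult.assoc)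
    then show ?thesis unfolding X_def by (simp add: nn_integral_cmult)
  qed
  have "(\<exists>B\<ge>0. \<forall>r>0. X r * Y r \<le> ennreal B) \<longleftrightarrow> (\<exists>B\<ge>0. \<forall>r>0. ennreal c * X r * Y r \<le> ennreal B)"
  proof
    assume "\<exists>B\<ge>0. \<forall>r>0. X r * Y r \<le> ennreal B"
    then obtain B where B: "B \<ge> 0" "\<And>r. 0 < r \<Longrightarrow> X r * Y r \<le> ennreal B" by blast
    have "ennreal c * X r * Y r \<le> ennreal (c * B)" if "0 < r" for r
      using mult_left_mono[OF B(2)[OF that], of "ennreal c"] c B(1) by (simp add: mult.assoc ennreal_mult)
    then show "\<exists>B\<ge>0. \<forall>r>0. ennreal c * X r * Y r \<le> ennreal B"
      using c B(1) by (intro exI[of _ "c * B"]) auto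
  next
    assume "\<exists>B\<ge>0. \<forall>r>0. ennreal c * X r * Y r \<le> ennreal B"
    then obtain B where B: "B \<ge> 0" "\<And>r. 0 < r \<Longrightarrow> ennreal c * X r * Y r \<le> ennreal B" by blast
    have "X r * Y r \<le> ennreal (B / c)" if "0 < r" for r
    proof -
      have "ennreal (1 / c) * (ennreal c * X r * Y r) \<le> ennreal (1 / c) * ennreal B"
        by (intro mult_left_mono B(2) that) simp
      moreover have "ennreal (1 / c) * ennreal c = 1" using c by (simp flip: ennreal_mult)
      then have "ennreal (1 / c) * (ennreal c * X r * Y r) = X r * Y r"
        by (metis mult.assoc mult_1)
      moreover have "ennreal (1 / c) * ennreal B = ennreal (B / c)"
        using c B(1) by (simp flip: ennreal_mult)
      ultimately show ?thesis by simp
    qed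
    then show "\<exists>B\<ge>0. \<forall>r>0. X r * Y r \<le> ennreal B"
      using c B(1) by (intro exI[of _ "B / c"]) auto
  qed
  then show ?thesis
    unfolding hardy_product_def deriv_norm_def SUP_product_finite_iff 2 3 Y_def[symmetric] by (simp add: 1)
qed

text \<open>Almost everywhere u > 0 and \<phi> agrees with \<open>A 0\<close>, so the
  \<open>ennreal\<close> quotient is the absolute value of \<open>diag_coeff\<close>.\<close>

lemma Linf_iff:
  assumes A: "chain m A" "AE x in half_line. \<phi> x = A 0 x" and "m = l" and \<phi>: "\<phi> \<in> borel_measurable half_line"
  shows "quotient_norm \<phi> < top \<longleftrightarrow>
    (\<exists>C. AE x in half_line. \<bar>diag_coeff A x\<bar> \<le> C)"
proof -
  let ?f = "\<lambda>x. ennreal (\<bar>\<phi> x\<bar> * v x) * inverse (ennreal (u x))"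
  have f[measurable]: "?f \<in> borel_measurable half_line" using \<phi> by measurable
  have e: "diag_coeff A x = A 0 x * v x / u x" for x unfolding diag_coeff_def using \<open>m = l\<close> by simp
  have eq: "AE x in half_line. ?f x = ennreal \<bar>diag_coeff A x\<bar>"
    using A(2) u_pos v_pos
  proof eventually_elim
    case (elim x)
    then have "ennreal \<bar>diag_coeff A x\<bar> = ennreal ((\<bar>\<phi> x\<bar> * v x) * inverse (u x))"
      by (simp add: e abs_mult divide_inverse)
    also have "\<dots> = ?f x" using elim by (simp add: inverse_ennreal ennreal_mult')
    finally show ?case by simp
  qed
  show ?thesis
    unfolding quotient_norm_def
  proof
    assume "Linf_norm {0<..} ?f < top"
    then obtain c where c: "esssup half_line ?f = ennreal c" "0 \<le> c"
      unfolding Linf_norm_def by (cases "esssup half_line ?f") auto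
    have "AE x in half_line. ?f x \<le> ennreal c" using esssup_AE[where f="?f" and M=half_line] c by simp
    with eq have "AE x in half_line. \<bar>diag_coeff A x\<bar> \<le> c" by eventually_elim (simp add: c(2))
    then show "\<exists>C. AE x in half_line. \<bar>diag_coeff A x\<bar> \<le> C" by blast
  next
    assume "\<exists>C. AE x in half_line. \<bar>diag_coeff A x\<bar> \<le> C"
    then obtain C where "AE x in half_line. \<bar>diag_coeff A x\<bar> \<le> C" by blast
    with eq have "AE x in half_line. ?f x \<le> ennreal C" by eventually_elim (simp add: ennreal_leI)
    then have "esssup half_line ?f \<le> ennreal C"
      unfolding esssup_eq_AE[OF f] by (intro Inf_lower) simp
    then show "Linf_norm {0<..} ?f < top"
      unfolding Linf_norm_def by (rule le_less_trans) simp
  qed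
qed

lemma L2_fun_diag_coeff_mult:
  assumes "chain m A" "AE x in half_line. \<bar>diag_coeff A x\<bar> \<le> C" and h: "L2_fun half_line h"
  shows "L2_fun half_line (\<lambda>x. diag_coeff A x * h x)"
proof (rule L2_fun_mono(1)[OF _ L2_fun_cmult(1)[OF h, of C]])
  have [measurable]: "diag_coeff A \<in> borel_measurable half_line" "h \<in> borel_measurable half_line"
    using diag_coeff_measurable[OF assms(1)] L2_fun_measurable[OF h] .
  show "(\<lambda>x. diag_coeff A x * h x) \<in> borel_measurable half_line" by measurable
  show "AE x in half_line. \<bar>diag_coeff A x * h x\<bar> \<le> \<bar>C * h x\<bar>"
    using assms(2)
  proof eventually_elim
    case (elim x)
    then have "\<bar>diag_coeff A x\<bar> \<le> \<bar>C\<bar>" by simp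
    then show ?case by (simp add: abs_mult mult_right_mono)
  qed
qed

text \<open>Monomials in the domain give the first condition and with it a representative of \<phi>.
  Iterated integrals then show that \<open>integral_op\<close> maps into square integrable
  functions, from which the other conditions follow by boundedness.\<close>

lemma multiplier_necessary:
  assumes \<phi>: "\<phi> \<in> multipliers (sobolev_space l u) (sobolev_space m v)"
  shows "(\<forall>k<l. gen_differentiable m (\<lambda>t. \<phi> t * t ^ k) \<and>
             deriv_norm \<phi> k {0<..} < top) \<and>
         (\<forall>k<l. (SUP r\<in>{0<..}. hardy_product \<phi> k r) < top) \<and>
         (m = l \<longrightarrow>
           quotient_norm \<phi> < top)"
proof -
  have mem: "(\<lambda>x. \<phi> x * f x) \<in> sobolev_space m v" if "f \<in> sobolev_space l u" for f
    using \<phi> that by (simp add: multipliers_def)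
  have monom_mem: "(\<lambda>t. \<phi> t * t ^ k) \<in> sobolev_space m v" if k: "k < l" for k
  proof (rule mem)
    have "poly (monom 1 k) = (\<lambda>t::real. t ^ k)" "poly 0 = (\<lambda>_::real. 0)"
      by (auto simp: poly_monom)
    \<comment> \<open>Monomials of degree below l have l-th derivative 0, so they belong to the
      domain whatever the weight u is.\<close>
    then have "has_gen_deriv l (\<lambda>t. t ^ k) (\<lambda>_. 0)"
      using chain_has_gen_deriv[OF chain_poly[of l "monom 1 k"]] k
      by (simp add: pderiv_iterate_eq_0 degree_monom_eq)
    then show "(\<lambda>t. t ^ k) \<in> sobolev_space l u"
      by (subst sobolev_space_iff[where F="\<lambda>t. t ^ k"]) (auto intro!: continuous_intros)
  qed
  have l0: "0 < l" using m1 ml by simp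
  have "\<phi> \<in> sobolev_space m v" using monom_mem[OF l0] by simp
  note gd = sobolev_spaceD[OF this]
  obtain A where A: "chain m A" "AE x in half_line. \<phi> x = A 0 x"
    using representative[OF gd] by blast
  have \<phi>m: "\<phi> \<in> borel_measurable half_line"
    using gd(1) by (auto simp: has_gen_deriv_iff intro: locally_integrable_measurable)
  have c1: "gen_differentiable m (\<lambda>t. \<phi> t * t ^ k)"
    "deriv_norm \<phi> k {0<..} < top" if k: "k < l" for k
    using monom_mem[OF k] by (auto simp: sobolev_space_def sobolev_norm_def deriv_norm_def)
  have aL: "L2_fun half_line (outer_coeff A k)" if "k < l" for k
    using c1(2)[OF that] outer_coeff_L2_iff[OF A that] by simp
  have T: "L2_fun half_line (integral_op l (outer_coeff A) inner_coeff (diag_coeff A) h)" if h: "L2_fun half_line h" for h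
  proof -
    let ?g = "\<lambda>x. h x / u x" and ?F = "iterated_integral l (\<lambda>x. h x / u x) 0"
    note g = quotient_L1_0[OF h]
    note F = iterated_integral_props[OF g(1)]
    \<comment> \<open>Each h is realized by a function in the domain whose l-th derivative is
      h/u.\<close>
    have "?F \<in> sobolev_space l u"
      using sobolev_space_iff[OF F(1,2), of u] g(2) by simp
    then have mem': "(\<lambda>x. \<phi> x * ?F x) \<in> sobolev_space m v" by (rule mem)
    obtain D where D: "has_gen_deriv m (\<lambda>x. A 0 x * ?F x) D" "\<And>x. D x * v x = integral_op l (outer_coeff A) inner_coeff (diag_coeff A) h x"
      using product_deriv[OF A(1) h] by blast
    have D': "has_gen_deriv m (\<lambda>x. \<phi> x * ?F x) D"
      by (rule has_gen_deriv_cong[OF D(1)]) (use A(2) in \<open>auto elim: eventually_mono\<close>)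
    have Dm[measurable]: "D \<in> borel_measurable half_line"
      using D(1) by (auto simp: has_gen_deriv_iff intro: locally_integrable_measurable)
    have "(\<integral>\<^sup>+x. ennreal ((D x * v x)\<^sup>2) \<partial>half_line) < \<infinity>"
    proof (subst sobolev_space_iff[OF D', symmetric])
      show "continuous_on {0..} (\<lambda>x. A 0 x * ?F x)" by (intro continuous_on_mult chain_cont0 A F)
      show "AE x in half_line. \<phi> x * ?F x = A 0 x * ?F x" using A(2) by (auto elim: eventually_mono)
    qed (rule mem')
    moreover have "(\<lambda>x. D x * v x) \<in> borel_measurable half_line" by measurable
    ultimately show ?thesis unfolding D(2) L2_fun_def by simp
  qed
  obtain C where C: "C \<ge> 0" "\<And>h. L2_fun half_line h \<Longrightarrow> nrm2 half_line (integral_op l (outer_coeff A) inner_coeff (diag_coeff A) h) \<le> C * nrm2 half_line h"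
    using integral_op_bounded[OF aL inner_coeff_L2 diag_coeff_measurable[OF A(1)] T] by blast
  have H: "\<exists>B\<ge>0. \<forall>r>0. (\<integral>\<^sup>+x. ennreal ((outer_coeff A k x)\<^sup>2) * indicator {r<..} x \<partial>half_line) *
       (\<integral>\<^sup>+t. ennreal ((inner_coeff k t)\<^sup>2) * indicator {..<r} t \<partial>half_line) \<le> ennreal B" if k: "k < l" for k
    using coefficient_bound[OF u_measurable u_pos uB L1_0_u \<delta>0 aL T[unfolded inner_coeff_def[abs_def]] C(2)[unfolded inner_coeff_def[abs_def]] C(1) k]
    by (simp add: inner_coeff_def)
  have "quotient_norm \<phi> < top" if "m = l"
  proof -
    define P where "P k B \<longleftrightarrow> 0 \<le> B \<and> (\<forall>r>0. (\<integral>\<^sup>+x. ennreal ((outer_coeff A k x)\<^sup>2) * indicator {r<..} x \<partial>half_line) *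
       (\<integral>\<^sup>+t. ennreal ((inner_coeff k t)\<^sup>2) * indicator {..<r} t \<partial>half_line) \<le> ennreal B)" for k B
    have "\<exists>B. P k B" if "k < l" for k
      unfolding P_def by (rule H[OF that])
    then obtain B where P: "\<And>k. k < l \<Longrightarrow> P k (B k)" by metis
    have B: "0 \<le> B k" "\<And>r. 0 < r \<Longrightarrow> (\<integral>\<^sup>+x. ennreal ((outer_coeff A k x)\<^sup>2) * indicator {r<..} x \<partial>half_line) *
       (\<integral>\<^sup>+t. ennreal ((inner_coeff k t)\<^sup>2) * indicator {..<r} t \<partial>half_line) \<le> ennreal (B k)" if "k < l" for k
      using P[OF that] by (auto simp: P_def)
    \<comment> \<open>The bound for the whole operator plus the Hardy bounds of the l summands that
      are subtracted from it.\<close>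
    define C' where "C' = C + (\<Sum>k<l. sqrt (8 * B k))"
    have eh: "L2_fun half_line (\<lambda>x. diag_coeff A x * h x) \<and> nrm2 half_line (\<lambda>x. diag_coeff A x * h x) \<le> C' * nrm2 half_line h"
      if h: "L2_fun half_line h" for h
    proof -
      let ?s = "\<lambda>x. \<Sum>k<l. outer_coeff A k x * integral {0..x} (\<lambda>t. inner_coeff k t * h t)"
      have s1: "L2_fun half_line (\<lambda>x. outer_coeff A k x * integral {0..x} (\<lambda>t. inner_coeff k t * h t))"
        "nrm2 half_line (\<lambda>x. outer_coeff A k x * integral {0..x} (\<lambda>t. inner_coeff k t * h t)) \<le> sqrt (8 * B k) * nrm2 half_line h" if k: "k < l" for k
        using hardy_real[OF aL[OF k] inner_coeff_L2 h B(1)[OF k] B(2)[OF k]] by auto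
      have s: "L2_fun half_line ?s \<and> nrm2 half_line ?s \<le> (\<Sum>k<l. nrm2 half_line (\<lambda>x. outer_coeff A k x * integral {0..x} (\<lambda>t. inner_coeff k t * h t)))"
        by (rule L2_fun_sum) (use s1 in auto)
      have "(\<Sum>k<l. nrm2 half_line (\<lambda>x. outer_coeff A k x * integral {0..x} (\<lambda>t. inner_coeff k t * h t))) \<le> (\<Sum>k<l. sqrt (8 * B k) * nrm2 half_line h)"
        by (intro sum_mono s1) simp
      then have s2: "nrm2 half_line ?s \<le> (\<Sum>k<l. sqrt (8 * B k)) * nrm2 half_line h"
        using s by (simp add: sum_distrib_right)
      have eq: "(\<lambda>x. diag_coeff A x * h x) = (\<lambda>x. integral_op l (outer_coeff A) inner_coeff (diag_coeff A) h x + (-1) * ?s x)"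
        by (simp add: integral_op_def)
      show ?thesis
        unfolding eq using L2_fun_add[OF T[OF h] L2_fun_cmult(1)[OF conjunct1[OF s], of "-1"]]
          L2_fun_cmult(2)[OF conjunct1[OF s], of "-1"] s2 C(2)[OF h]
        by (auto simp: C'_def distrib_right)
    qed
    have "0 \<le> C'" using C(1) B(1) by (auto simp: C'_def intro!: add_nonneg_nonneg sum_nonneg)
    then have "AE x in half_line. \<bar>diag_coeff A x\<bar> \<le> C' + 1"
      using eh by (intro essentially_bounded_multiplier diag_coeff_measurable A) auto
    then show ?thesis using Linf_iff[OF A that \<phi>m] by blast
  qed
  then show ?thesis
    using c1 H hardy_condition_iff[OF A] by simp
qed

text \<open>By linearity f splits into its iterated integral, handled by Hardy and the bound on
  \<open>diag_coeff\<close>, and a polynomial, handled by the first condition alone.\<close>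

lemma multiplier_sufficient:
  assumes c1: "\<And>k. k < l \<Longrightarrow> gen_differentiable m (\<lambda>t. \<phi> t * t ^ k)"
      "\<And>k. k < l \<Longrightarrow> deriv_norm \<phi> k {0<..} < top"
    and c2: "\<And>k. k < l \<Longrightarrow> (SUP r\<in>{0<..}. hardy_product \<phi> k r) < top"
    and c3: "m = l \<Longrightarrow> quotient_norm \<phi> < top"
  shows "\<phi> \<in> multipliers (sobolev_space l u) (sobolev_space m v)"
  unfolding multipliers_def
proof (intro CollectI ballI)
  fix f assume f: "f \<in> sobolev_space l u"
  have l0: "0 < l" using m1 ml by simp
  have gd: "has_gen_deriv m \<phi> (gen_deriv m \<phi>)"
    using gen_differentiableD[OF c1(1)[OF l0]] by simp
  have "(\<integral>\<^sup>+x. ennreal ((gen_deriv m \<phi> x * v x)\<^sup>2) \<partial>half_line) < \<infinity>"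
  proof -
    have "(\<integral>\<^sup>+x\<in>{0<..}. (ennreal \<bar>gen_deriv m \<phi> x * v x\<bar>)\<^sup>2 \<partial>lebesgue) < top"
      using c1(2)[OF l0] unfolding deriv_norm_def L2_norm_eq by simp
    also have "(\<integral>\<^sup>+x\<in>{0<..}. (ennreal \<bar>gen_deriv m \<phi> x * v x\<bar>)\<^sup>2 \<partial>lebesgue) = (\<integral>\<^sup>+x. ennreal ((gen_deriv m \<phi> x * v x)\<^sup>2) \<partial>half_line)"
      by (subst set_nn_integral_half_line) (auto intro!: nn_integral_cong simp: ennreal_power)
    finally show ?thesis by simp
  qed
  then obtain A where A: "chain m A" "AE x in half_line. \<phi> x = A 0 x"
    using representative[OF gd] by blast
  have \<phi>m: "\<phi> \<in> borel_measurable half_line"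
    using gd by (auto simp: has_gen_deriv_iff intro: locally_integrable_measurable)
  have aL: "L2_fun half_line (outer_coeff A k)" if "k < l" for k
    using c1(2)[OF that] outer_coeff_L2_iff[OF A that] by simp
  note fd = sobolev_spaceD[OF f]
  have gm[measurable]: "gen_deriv l f \<in> borel_measurable half_line"
    using fd(1) by (auto simp: has_gen_deriv_iff intro: locally_integrable_measurable)
  define h where "h x = gen_deriv l f x * u x" for x
  have hm: "h \<in> borel_measurable half_line" unfolding h_def by measurable
  have h: "L2_fun half_line h" using fd(2) hm by (simp add: L2_fun_def h_def)
  let ?g = "\<lambda>x. h x / u x" and ?F = "iterated_integral l (\<lambda>x. h x / u x) 0"
  note g = quotient_L1_0[OF h]
  have fg: "has_gen_deriv l f ?g"
    by (rule has_gen_deriv_cong[OF fd(1)]) (use u_pos in \<open>auto elim!: eventually_mono simp: h_def\<close>)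
  have Fl: "iterated_integral l ?g l = ?g" by (auto simp: iterated_integral_def)
  obtain p :: "real poly" where p: "\<forall>i\<ge>l. coeff p i = 0" "AE x in half_line. f x = ?F x + poly p x"
    using has_gen_deriv_representation[OF fg g(1) iterated_integral_chain[OF g(1)] Fl] by blast
  have poly_eq: "poly p x = (\<Sum>k<l. coeff p k * x ^ k)" for x
  proof -
    have "degree p \<le> l - 1" using p(1) l0 by (intro degree_le) auto
    then have "{..degree p} \<subseteq> {..<l}" using l0 by auto
    then show ?thesis
      unfolding poly_altdef by (intro sum.mono_neutral_left) (auto simp: coeff_eq_0)
  qed
  obtain D where D: "has_gen_deriv m (\<lambda>x. A 0 x * ?F x) D" "\<And>x. D x * v x = integral_op l (outer_coeff A) inner_coeff (diag_coeff A) h x"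
    using product_deriv[OF A(1) h] by blast
  \<comment> \<open>The derivative of the product: \<open>D\<close> from the iterated integral, the
    sum from the polynomial part of f.\<close>
  define G where "G x = D x + (\<Sum>k<l. coeff p k * monom_deriv m A k x)" for x
  have "has_gen_deriv m (\<lambda>x. A 0 x * ?F x + (\<Sum>k<l. coeff p k * (A 0 x * x ^ k))) G"
    unfolding G_def using m1
    by (intro has_gen_deriv_add D has_gen_deriv_sum has_gen_deriv_cmult monom_deriv_has_gen_deriv A) simp
  moreover have eqF: "A 0 x * ?F x + (\<Sum>k<l. coeff p k * (A 0 x * x ^ k)) = A 0 x * (?F x + poly p x)" for x
    by (simp add: poly_eq distrib_left sum_distrib_left mult_ac)
  ultimately have gdA: "has_gen_deriv m (\<lambda>x. A 0 x * (?F x + poly p x)) G" by simp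
  have ae: "AE x in half_line. \<phi> x * f x = A 0 x * (?F x + poly p x)"
    using A(2) p(2) by eventually_elim simp
  have gdf: "has_gen_deriv m (\<lambda>x. \<phi> x * f x) G"
    by (rule has_gen_deriv_cong[OF gdA]) (use ae in \<open>auto elim: eventually_mono\<close>)
  have cont: "continuous_on {0..} (\<lambda>x. A 0 x * (?F x + poly p x))"
    by (intro continuous_on_mult continuous_on_add chain_cont0 A iterated_integral_props(2) g continuous_on_poly)
  have hl: "L2_fun half_line (\<lambda>x. outer_coeff A k x * integral {0..x} (\<lambda>t. inner_coeff k t * h t))" if k: "k < l" for k
    using c2[OF k] hardy_condition_iff[OF A k] hardy_real(1)[OF aL[OF k] inner_coeff_L2 h] by blast
  have el: "L2_fun half_line (\<lambda>x. diag_coeff A x * h x)"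
  proof (cases "m = l")
    case True
    then obtain C where "AE x in half_line. \<bar>diag_coeff A x\<bar> \<le> C" using c3 Linf_iff[OF A True \<phi>m] by blast
    then show ?thesis by (rule L2_fun_diag_coeff_mult[OF A(1) _ h])
  qed (simp add: diag_coeff_def L2_fun_zero)
  have "L2_fun half_line (integral_op l (outer_coeff A) inner_coeff (diag_coeff A) h)"
    unfolding integral_op_def by (intro L2_fun_add(1) conjunct1[OF L2_fun_sum] el) (use hl in auto)
  then have "L2_fun half_line (\<lambda>x. D x * v x)" by (simp only: D(2))
  \<comment> \<open>Dividing by \<open>taylor_coeff\<close> undoes the factor built into
    \<open>outer_coeff\<close>.\<close>
  moreover have "L2_fun half_line (\<lambda>x. \<Sum>k<l. (coeff p k / taylor_coeff l k) * outer_coeff A k x)"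
    by (intro conjunct1[OF L2_fun_sum] L2_fun_cmult(1) aL) simp
  ultimately have "L2_fun half_line (\<lambda>x. D x * v x + (\<Sum>k<l. (coeff p k / taylor_coeff l k) * outer_coeff A k x))"
    by (rule L2_fun_add(1))
  also have "(\<lambda>x. D x * v x + (\<Sum>k<l. (coeff p k / taylor_coeff l k) * outer_coeff A k x)) = (\<lambda>x. G x * v x)"
  proof
    fix x
    have "(\<Sum>k<l. (coeff p k / taylor_coeff l k) * outer_coeff A k x) = (\<Sum>k<l. coeff p k * monom_deriv m A k x) * v x"
      unfolding sum_distrib_right by (intro sum.cong refl) (simp add: outer_coeff_def taylor_coeff_nonzero)
    then show "D x * v x + (\<Sum>k<l. (coeff p k / taylor_coeff l k) * outer_coeff A k x) = G x * v x"
      by (simp add: G_def distrib_right)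
  qed
  finally show "(\<lambda>x. \<phi> x * f x) \<in> sobolev_space m v"
    using sobolev_space_iff[OF gdf cont ae, of v] by (simp add: L2_fun_def)
qed

end

theorem theorem2p4:
  fixes l m :: nat and u v :: "real \<Rightarrow> real" and \<delta> :: real
  assumes "1 \<le> m" and "m \<le> l"
    and "weight u" and "weight v"
    and "\<delta> \<ge> 0" and "(\<lambda>x. 1 / (u x)\<^sup>2) \<in> B_class \<delta>"
    and "\<And>r. r > 0 \<Longrightarrow> L2_norm {0<..<r} (\<lambda>x. inverse (ennreal (v x))) < top"
  shows "multipliers (sobolev_space l u) (sobolev_space m v) =
    {\<phi>. (\<forall>k<l. gen_differentiable m (\<lambda>t. \<phi> t * t ^ k) \<and>
             L2_norm {0<..} (\<lambda>x. ennreal \<bar>gen_deriv m (\<lambda>t. \<phi> t * t ^ k) x * v x\<bar>) < top) \<and>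
         (\<forall>k<l. (SUP r\<in>{0<..}.
             L2_norm {r<..} (\<lambda>x. ennreal \<bar>gen_deriv m (\<lambda>t. \<phi> t * t ^ k) x * v x\<bar>) *
             L2_norm {0<..<r} (\<lambda>x. ennreal (x ^ (l - k - 1)) * inverse (ennreal (u x)))) < top) \<and>
         (m = l \<longrightarrow>
           Linf_norm {0<..} (\<lambda>x. ennreal (\<bar>\<phi> x\<bar> * v x) * inverse (ennreal (u x))) < top)}"
proof -
  interpret multiplier_setting l m u v \<delta>
    using assms AE_pos_of_L2_norm_inverse by unfold_locales auto
  show ?thesis
    using multiplier_necessary multiplier_sufficient
    unfolding hardy_product_def deriv_norm_def quotient_norm_def by blast
qed

end
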